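(* Let $f\in\mathbb{Z}[X,Y]$ be a binary quadratic form with discriminant $q\neq0$ and $\epsilon$-invariants $\epsilon_v=\epsilon_v(f)\in\{\pm1\}$ for places $v$ of $\mathbb{Q}$. The root stack $\mathcal{X}=\mathbb{P}^1_{\mathbb{Z}[\frac1{2q}]}[\sqrt f]$ always has local integral points everywhere, i.e. $\mathcal{X}(\mathbb{Z}_p)\neq\emptyset$ for all primes $p\nmid 2q$ and $\mathcal{X}(\mathbb{Q}_v)\neq\emptyset$ for all places $v\mid 2q\infty$. Moreover $\mathcal{X}$ has a $\mathbb{Z}[\frac1{2q}]$-point if and only if there exists no integer $d\mid 2q$ (possibly negative) such that: (1) for all places $v\mid 2q\infty$ one has $d\in\mathbb{Q}_v^{\times2}$ or $d\in q\,\mathbb{Q}_v^{\times2}$; (2) $\displaystyle\prod_{v\mid2q\infty,\ d\notin\mathbb{Q}_v^{\times2}}\epsilon_v=\prod_{v\mid2q\infty,\ d\in\mathbb{Q}_v^{\times2}}\epsilon_v=-1$.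
   Context: For $f=aX^2+bXY+cY^2$ the discriminant is $q:=b^2-4ac$. The notation $v\mid 2q\infty$ means that $v$ is the real place or the $p$-adic place for a prime $p\mid 2q$; $\mathbb{Q}_\infty=\mathbb{R}$. The $\epsilon$-invariant (as in Serre's Course in Arithmetic): if $f$ is equivalent over $\mathbb{Q}$ to $a_1x^2+a_2y^2$ with $a_i\in\mathbb{Q}^\times$, then $\epsilon_v(f):=(a_1,a_2)_v\in\{\pm1\}$, the Hilbert symbol over $\mathbb{Q}_v$. Root stack: $f$ is a section of $\mathcal{O}(2)$ on $\mathbb{P}^1_{\mathbb{Z}[\frac1{2q}]}$, and $\mathbb{P}^1_{\mathbb{Z}[\frac1{2q}]}[\sqrt f]$ is the stack of square roots of $(\mathcal{O}(2),f)$: its objects over a scheme $T$ are a morphism $h:T\to\mathbb{P}^1_{\mathbb{Z}[\frac1{2q}]}$, a line bundle $M$ on $T$, a section $t$ of $M$ and an isomorphism $M^{\otimes2}\cong h^*\mathcal{O}(2)$ sending $t^{2}$ to $h^*f$. For a stack $\mathcal{X}$, $\mathcal{X}(R)$ denotes the set of isomorphism classes of morphisms $\operatorname{Spec}R\to\mathcal{X}$. *)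

theory Defs
  imports Complex_Main "HOL-Algebra.QuotRing" "HOL-Algebra.Module"
    "HOL-Algebra.Algebraic_Closure_Type" "HOL-Computational_Algebra.Primes"
begin

section \<open>Linear algebra over a commutative ring\<close>

definition module_isos ::
    "('r, 'u) ring_scheme \<Rightarrow> ('r, 'm, 'v) module_scheme \<Rightarrow> ('r, 'n, 'w) module_scheme \<Rightarrow> ('m \<Rightarrow> 'n) set"
  where "module_isos R M N = {\<phi> \<in> iso (add_monoid M) (add_monoid N).
    \<forall>r\<in>carrier R. \<forall>m\<in>carrier M. \<phi> (r \<odot>\<^bsub>M\<^esub> m) = r \<odot>\<^bsub>N\<^esub> \<phi> m}"

text \<open>
  The HOL-Algebra record of modules extends the record of rings, so a module carries meaningless
  ring components \<open>mult\<close> and \<open>one\<close>; these are left undefined below.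
\<close>

definition free_module :: "('r, 'u) ring_scheme \<Rightarrow> 's set \<Rightarrow> ('r, 's \<Rightarrow> 'r) module"
  where "free_module R S = \<lparr>
    carrier = {c. (\<forall>x. c x \<in> carrier R) \<and> (\<forall>x. x \<notin> S \<longrightarrow> c x = \<zero>\<^bsub>R\<^esub>) \<and> finite {x. c x \<noteq> \<zero>\<^bsub>R\<^esub>}},
    monoid.mult = undefined,
    monoid.one = undefined,
    zero = (\<lambda>_. \<zero>\<^bsub>R\<^esub>),
    add = (\<lambda>c d x. c x \<oplus>\<^bsub>R\<^esub> d x),
    module.smult = (\<lambda>r c x. r \<otimes>\<^bsub>R\<^esub> c x)\<rparr>"

definition free_gen :: "('r, 'u) ring_scheme \<Rightarrow> 's \<Rightarrow> 's \<Rightarrow> 'r"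
  where "free_gen R s = (\<lambda>x. if x = s then \<one>\<^bsub>R\<^esub> else \<zero>\<^bsub>R\<^esub>)"

text \<open>
  The tensor product \<open>M \<otimes>\<^sub>R N\<close> is the free module on \<open>M \<times> N\<close> modulo the submodule
  generated by the bilinearity relations; its elements are cosets.
\<close>

definition tensor_relations ::
    "('r, 'u) ring_scheme \<Rightarrow> ('r, 'm, 'v) module_scheme \<Rightarrow> ('r, 'n, 'w) module_scheme
      \<Rightarrow> ('m \<times> 'n \<Rightarrow> 'r) set"
  where "tensor_relations R M N =
    (let F = free_module R (carrier M \<times> carrier N); g = (\<lambda>m n. free_gen R (m, n)) in
      {g (m \<oplus>\<^bsub>M\<^esub> m') n \<ominus>\<^bsub>F\<^esub> (g m n \<oplus>\<^bsub>F\<^esub> g m' n) | m m' n.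
         m \<in> carrier M \<and> m' \<in> carrier M \<and> n \<in> carrier N} \<union>
      {g m (n \<oplus>\<^bsub>N\<^esub> n') \<ominus>\<^bsub>F\<^esub> (g m n \<oplus>\<^bsub>F\<^esub> g m n') | m n n'.
         m \<in> carrier M \<and> n \<in> carrier N \<and> n' \<in> carrier N} \<union>
      {g (r \<odot>\<^bsub>M\<^esub> m) n \<ominus>\<^bsub>F\<^esub> r \<odot>\<^bsub>F\<^esub> g m n | r m n.
         r \<in> carrier R \<and> m \<in> carrier M \<and> n \<in> carrier N} \<union>
      {g m (r \<odot>\<^bsub>N\<^esub> n) \<ominus>\<^bsub>F\<^esub> r \<odot>\<^bsub>F\<^esub> g m n | r m n.
         r \<in> carrier R \<and> m \<in> carrier M \<and> n \<in> carrier N})"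

definition tensor_kernel ::
    "('r, 'u) ring_scheme \<Rightarrow> ('r, 'm, 'v) module_scheme \<Rightarrow> ('r, 'n, 'w) module_scheme
      \<Rightarrow> ('m \<times> 'n \<Rightarrow> 'r) set"
  where "tensor_kernel R M N =
    \<Inter>{H. submodule H R (free_module R (carrier M \<times> carrier N)) \<and> tensor_relations R M N \<subseteq> H}"

definition tensor_product ::
    "('r, 'u) ring_scheme \<Rightarrow> ('r, 'm, 'v) module_scheme \<Rightarrow> ('r, 'n, 'w) module_scheme
      \<Rightarrow> ('r, ('m \<times> 'n \<Rightarrow> 'r) set) module"
  where "tensor_product R M N =
    (let F = free_module R (carrier M \<times> carrier N); K = tensor_kernel R M N in
      \<lparr>carrier = a_rcosets\<^bsub>F\<^esub> K,
       monoid.mult = undefined,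
       monoid.one = undefined,
       zero = K,
       add = set_add F,
       module.smult = (\<lambda>r C. \<Union>c\<in>C. K +>\<^bsub>F\<^esub> (r \<odot>\<^bsub>F\<^esub> c))\<rparr>)"

definition pure_tensor ::
    "('r, 'u) ring_scheme \<Rightarrow> ('r, 'm, 'v) module_scheme \<Rightarrow> ('r, 'n, 'w) module_scheme
      \<Rightarrow> 'm \<Rightarrow> 'n \<Rightarrow> ('m \<times> 'n \<Rightarrow> 'r) set"
  where "pure_tensor R M N m n =
    tensor_kernel R M N +>\<^bsub>free_module R (carrier M \<times> carrier N)\<^esub> free_gen R (m, n)"

text \<open>
  A line bundle on \<open>Spec R\<close> is a module \<open>M\<close> that is free of rank one on each set \<open>D(g)\<close> of a
  covering by basic open sets. A basis of \<open>M[1/g]\<close> may be scaled by a power of the unit \<open>g\<close> so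
  that it is the image of an element \<open>e\<close> of \<open>M\<close>; the last two conditions say that \<open>e\<close> spans
  \<open>M[1/g]\<close> over \<open>R[1/g]\<close> and has zero annihilator there.
\<close>

definition line_bundle :: "('r, 'u) ring_scheme \<Rightarrow> ('r, 'm, 'v) module_scheme \<Rightarrow> bool"
  where "line_bundle R M \<longleftrightarrow> module R M \<and>
    (\<exists>G. G \<subseteq> carrier R \<and> genideal R G = carrier R \<and>
      (\<forall>g\<in>G. \<exists>e\<in>carrier M.
        (\<forall>m\<in>carrier M. \<exists>n::nat. \<exists>r\<in>carrier R. (g [^]\<^bsub>R\<^esub> n) \<odot>\<^bsub>M\<^esub> m = r \<odot>\<^bsub>M\<^esub> e) \<and>
        (\<forall>r\<in>carrier R. r \<odot>\<^bsub>M\<^esub> e = \<zero>\<^bsub>M\<^esub> \<longrightarrow> (\<exists>n::nat. (g [^]\<^bsub>R\<^esub> n) \<otimes>\<^bsub>R\<^esub> r = \<zero>\<^bsub>R\<^esub>))))"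

section \<open>The root stack of a binary quadratic form\<close>

definition disc :: "int \<Rightarrow> int \<Rightarrow> int \<Rightarrow> int"
  where "disc a b c = b\<^sup>2 - 4 * a * c"

text \<open>
  An object over \<open>Spec R\<close> of the stack of square roots of \<open>(\<O>(2), f)\<close>, for
  \<open>f = a X\<^sup>2 + b X Y + c Y\<^sup>2\<close>. The morphism \<open>h\<close> to the projective line is given, as usual, by the
  line bundle \<open>L = h\<^sup>* \<O>(1)\<close> together with the pair of generating sections \<open>(h\<^sup>* X, h\<^sup>* Y)\<close>.
\<close>

record ('r, 'm) root_object =
  o1_bundle :: "('r, 'm) module"
  sec_X :: 'm
  sec_Y :: 'm
  root_bundle :: "('r, 'm) module"
  root_sec :: 'm
  root_iso :: "('m \<times> 'm \<Rightarrow> 'r) set \<Rightarrow> ('m \<times> 'm \<Rightarrow> 'r) set"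

definition tensor_square :: "('r, 'u) ring_scheme \<Rightarrow> ('r, 'm) module \<Rightarrow> ('r, ('m \<times> 'm \<Rightarrow> 'r) set) module"
  where "tensor_square R M = tensor_product R M M"

definition pulled_back_form ::
    "('r, 'u) ring_scheme \<Rightarrow> int \<Rightarrow> int \<Rightarrow> int \<Rightarrow> ('r, 'm) module \<Rightarrow> 'm \<Rightarrow> 'm \<Rightarrow> ('m \<times> 'm \<Rightarrow> 'r) set"
  where "pulled_back_form R a b c L x y =
    (let T = tensor_square R L in
      [a] \<cdot>\<^bsub>T\<^esub> pure_tensor R L L x x \<oplus>\<^bsub>T\<^esub> [b] \<cdot>\<^bsub>T\<^esub> pure_tensor R L L x y
        \<oplus>\<^bsub>T\<^esub> [c] \<cdot>\<^bsub>T\<^esub> pure_tensor R L L y y)"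

text \<open>
  The first condition says that \<open>Spec R\<close> is a scheme over \<open>\<int>[1/2q]\<close>; the structure map is then
  unique.
\<close>

definition root_objects ::
    "('r, 'u) ring_scheme \<Rightarrow> int \<Rightarrow> int \<Rightarrow> int \<Rightarrow> ('r, 'm) root_object set"
  where "root_objects R a b c = {P.
    [(2 * disc a b c)] \<cdot>\<^bsub>R\<^esub> \<one>\<^bsub>R\<^esub> \<in> Units R \<and>
    line_bundle R (o1_bundle P) \<and>
    sec_X P \<in> carrier (o1_bundle P) \<and> sec_Y P \<in> carrier (o1_bundle P) \<and>
    (\<forall>l\<in>carrier (o1_bundle P). \<exists>r\<in>carrier R. \<exists>s\<in>carrier R.
      l = r \<odot>\<^bsub>o1_bundle P\<^esub> sec_X P \<oplus>\<^bsub>o1_bundle P\<^esub> s \<odot>\<^bsub>o1_bundle P\<^esub> sec_Y P) \<and>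
    line_bundle R (root_bundle P) \<and>
    root_sec P \<in> carrier (root_bundle P) \<and>
    root_iso P \<in> module_isos R (tensor_square R (root_bundle P)) (tensor_square R (o1_bundle P)) \<and>
    root_iso P (pure_tensor R (root_bundle P) (root_bundle P) (root_sec P) (root_sec P))
      = pulled_back_form R a b c (o1_bundle P) (sec_X P) (sec_Y P)}"

text \<open>
  Two objects are isomorphic if they lie over the same morphism \<open>h\<close>, i.e. there is a (unique)
  isomorphism \<open>\<alpha>\<close> of the bundles \<open>h\<^sup>* \<O>(1)\<close> matching the generating sections, and there is an
  isomorphism \<open>\<beta>\<close> of the root bundles matching the sections and the squaring isomorphisms.
  Here \<open>\<gamma>\<close> is \<open>\<alpha> \<otimes> \<alpha>\<close>.
\<close>

definition root_object_iso ::
    "('r, 'u) ring_scheme \<Rightarrow> int \<Rightarrow> int \<Rightarrow> int \<Rightarrow> ('r, 'm) root_object rel"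
  where "root_object_iso R a b c =
    {(P, P'). P \<in> root_objects R a b c \<and> P' \<in> root_objects R a b c \<and>
      (\<exists>\<alpha>\<in>module_isos R (o1_bundle P) (o1_bundle P').
       \<exists>\<beta>\<in>module_isos R (root_bundle P) (root_bundle P').
       \<exists>\<gamma>\<in>module_isos R (tensor_square R (o1_bundle P)) (tensor_square R (o1_bundle P')).
        \<alpha> (sec_X P) = sec_X P' \<and> \<alpha> (sec_Y P) = sec_Y P' \<and> \<beta> (root_sec P) = root_sec P' \<and>
        (\<forall>l\<in>carrier (o1_bundle P). \<forall>l'\<in>carrier (o1_bundle P).
          \<gamma> (pure_tensor R (o1_bundle P) (o1_bundle P) l l')
            = pure_tensor R (o1_bundle P') (o1_bundle P') (\<alpha> l) (\<alpha> l')) \<and>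
        (\<forall>m\<in>carrier (root_bundle P). \<forall>m'\<in>carrier (root_bundle P).
          root_iso P' (pure_tensor R (root_bundle P') (root_bundle P') (\<beta> m) (\<beta> m'))
            = \<gamma> (root_iso P (pure_tensor R (root_bundle P) (root_bundle P) m m'))))}"

text \<open>
  The set \<open>\<X>(R)\<close>. A line bundle is a finitely generated module, hence isomorphic to a quotient of
  some \<open>R\<^sup>n\<close>, whose elements are sets of lists over \<open>R\<close>. So the element type chosen for the modules
  is large enough for every isomorphism class to occur.
\<close>

definition root_stack_points ::
    "('r, 'u) ring_scheme \<Rightarrow> int \<Rightarrow> int \<Rightarrow> int \<Rightarrow> ('r, 'r list set) root_object set set"
  where "root_stack_points R a b c = root_objects R a b c // root_object_iso R a b c"

section \<open>The base rings\<close>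

definition localized_integers :: "int \<Rightarrow> rat ring"
  where "localized_integers m = (ring_of_type_algebra :: rat ring)
    \<lparr>carrier := {of_int z / of_int m ^ n | (z :: int) (n :: nat). True}\<rparr>"

definition real_field :: "real ring"
  where "real_field = ring_of_type_algebra"

definition padic_abs :: "nat \<Rightarrow> rat \<Rightarrow> real"
  where "padic_abs p r = (if r = 0 then 0 else
    (let (k, l) = quotient_of r in
      real p powi (int (multiplicity (int p) l) - int (multiplicity (int p) k))))"

definition padic_cauchy_ring :: "nat \<Rightarrow> (nat \<Rightarrow> rat) ring"
  where "padic_cauchy_ring p = \<lparr>
    carrier = {x. \<forall>e>0. \<exists>N. \<forall>m\<ge>N. \<forall>n\<ge>N. padic_abs p (x m - x n) < e},
    monoid.mult = (\<lambda>x y n. x n * y n),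
    monoid.one = (\<lambda>_. 1),
    zero = (\<lambda>_. 0),
    add = (\<lambda>x y n. x n + y n)\<rparr>"

definition padic_null :: "nat \<Rightarrow> (nat \<Rightarrow> rat) set"
  where "padic_null p = {x. (\<lambda>n. padic_abs p (x n)) \<longlonglongrightarrow> 0}"

definition padic_field :: "nat \<Rightarrow> (nat \<Rightarrow> rat) set ring"
  where "padic_field p = padic_cauchy_ring p Quot padic_null p"

text \<open>
  The closed unit ball: an element of absolute value at most 1 has a representative all of whose
  terms have absolute value at most 1, since the absolute values of the terms of a Cauchy sequence
  that is not null are eventually constant.
\<close>

definition padic_integers :: "nat \<Rightarrow> (nat \<Rightarrow> rat) set ring"
  where "padic_integers p = (padic_field p)
    \<lparr>carrier := {\<xi> \<in> carrier (padic_field p). \<exists>x\<in>\<xi>. \<forall>n. padic_abs p (x n) \<le> 1}\<rparr>"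

section \<open>Places, square classes and Hilbert symbols\<close>

datatype place = Real_Place | Prime_Place nat

definition places_dividing :: "int \<Rightarrow> place set"
  where "places_dividing m = insert Real_Place {Prime_Place p | p. Factorial_Ring.prime p \<and> int p dvd m}"

definition of_rat_field :: "('k, 'u) ring_scheme \<Rightarrow> rat \<Rightarrow> 'k"
  where "of_rat_field K r = (let (k, l) = quotient_of r in
    ([k] \<cdot>\<^bsub>K\<^esub> \<one>\<^bsub>K\<^esub>) \<otimes>\<^bsub>K\<^esub> inv\<^bsub>K\<^esub> ([l] \<cdot>\<^bsub>K\<^esub> \<one>\<^bsub>K\<^esub>))"

text \<open>The integers whose image in \<open>K\<close> lies in \<open>m K\<^sup>\<times>\<^sup>2\<close>.\<close>

definition square_class :: "('k, 'u) ring_scheme \<Rightarrow> int \<Rightarrow> int set"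
  where "square_class K m = {d. \<exists>y\<in>Units K.
    [d] \<cdot>\<^bsub>K\<^esub> \<one>\<^bsub>K\<^esub> = ([m] \<cdot>\<^bsub>K\<^esub> \<one>\<^bsub>K\<^esub>) \<otimes>\<^bsub>K\<^esub> (y \<otimes>\<^bsub>K\<^esub> y)}"

definition hilbert_symbol :: "('k, 'u) ring_scheme \<Rightarrow> 'k \<Rightarrow> 'k \<Rightarrow> int"
  where "hilbert_symbol K a b =
    (if \<exists>x\<in>carrier K. \<exists>y\<in>carrier K. \<exists>z\<in>carrier K. (x, y, z) \<noteq> (\<zero>\<^bsub>K\<^esub>, \<zero>\<^bsub>K\<^esub>, \<zero>\<^bsub>K\<^esub>) \<and>
        z \<otimes>\<^bsub>K\<^esub> z \<ominus>\<^bsub>K\<^esub> a \<otimes>\<^bsub>K\<^esub> (x \<otimes>\<^bsub>K\<^esub> x) \<ominus>\<^bsub>K\<^esub> b \<otimes>\<^bsub>K\<^esub> (y \<otimes>\<^bsub>K\<^esub> y) = \<zero>\<^bsub>K\<^esub>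
     then 1 else - 1)"

text \<open>
  The completions at the real and the \<open>p\<close>-adic places have different types, hence the case
  distinctions.
\<close>

definition local_square_class :: "place \<Rightarrow> int \<Rightarrow> int set"
  where "local_square_class v m = (case v of
    Real_Place \<Rightarrow> square_class real_field m
  | Prime_Place p \<Rightarrow> square_class (padic_field p) m)"

definition local_hilbert :: "place \<Rightarrow> rat \<Rightarrow> rat \<Rightarrow> int"
  where "local_hilbert v r s = (case v of
    Real_Place \<Rightarrow> hilbert_symbol real_field (of_rat_field real_field r) (of_rat_field real_field s)
  | Prime_Place p \<Rightarrow>
      hilbert_symbol (padic_field p) (of_rat_field (padic_field p) r) (of_rat_field (padic_field p) s))"

definition has_local_point :: "place \<Rightarrow> int \<Rightarrow> int \<Rightarrow> int \<Rightarrow> bool"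
  where "has_local_point v a b c = (case v of
    Real_Place \<Rightarrow> root_stack_points real_field a b c \<noteq> {}
  | Prime_Place p \<Rightarrow> root_stack_points (padic_field p) a b c \<noteq> {})"

definition form_value :: "rat \<Rightarrow> rat \<Rightarrow> rat \<Rightarrow> rat \<Rightarrow> rat \<Rightarrow> rat"
  where "form_value a b c x y = a * x\<^sup>2 + b * x * y + c * y\<^sup>2"

definition diagonalizes :: "int \<Rightarrow> int \<Rightarrow> int \<Rightarrow> rat \<Rightarrow> rat \<Rightarrow> bool"
  where "diagonalizes a b c a1 a2 \<longleftrightarrow> (\<exists>s t u w :: rat. s * w - t * u \<noteq> 0 \<and>
    (\<forall>x y. form_value (of_int a) (of_int b) (of_int c) (s * x + t * y) (u * x + w * y)
      = form_value a1 0 a2 x y))"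

text \<open>
  For nonzero discriminant a diagonalization exists, and the symbol does not depend on its choice.
\<close>

definition epsilon_invariant :: "place \<Rightarrow> int \<Rightarrow> int \<Rightarrow> int \<Rightarrow> int"
  where "epsilon_invariant v a b c =
    (THE \<epsilon>. \<exists>a1 a2. a1 \<noteq> 0 \<and> a2 \<noteq> 0 \<and> diagonalizes a b c a1 a2 \<and> \<epsilon> = local_hilbert v a1 a2)"

end

theory Submission
  imports Defs "HOL-Number_Theory.Number_Theory"
begin

text \<open>
  Over \<open>\<rat>\<close> the form \<open>f\<close> is equivalent to \<open>n x\<^sup>2 - n q y\<^sup>2\<close> for a nonzero coefficient \<open>n\<close> of \<open>f\<close>, so
  \<open>\<epsilon>\<^sub>v = (n, q)\<^sub>v\<close>. A point of the root stack over \<open>\<int>[1/2q]\<close> amounts to a nonzero rational solution of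
  \<open>f(x, y) = d t\<^sup>2\<close> with \<open>d\<close> a unit, because the discrepancy between the trivialisations of the two line
  bundles has even valuation at all primes of the base. By the Hasse-Minkowski theorem this means
  \<open>(d, q)\<^sub>v = \<epsilon>\<^sub>v\<close> at all places \<open>v\<close> dividing \<open>2q\<infinity>\<close>. If no \<open>d\<close> satisfies this, some set \<open>T\<close> of these
  places has \<open>\<Prod>\<^sub>T (d, q)\<^sub>v = 1\<close> for all \<open>d\<close> but \<open>\<Prod>\<^sub>T \<epsilon>\<^sub>v = - 1\<close>. Then \<open>q\<close> on \<open>T\<close> and \<open>1\<close> off \<open>T\<close> is
  orthogonal to all units, hence is locally the class of a unit \<open>e\<close>, which can only be the part
  of \<open>q\<close> supported on \<open>T\<close>. Conversely, for \<open>e\<close> as in the theorem the product formula for \<open>(d, e)\<close> excludes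
  a solution \<open>d\<close>.
\<close>

text \<open>Hilbert symbols occur in two guises. The theorem defines them by solubility in the
  completions, where even bilinearity is far from obvious. \<open>symbol\<close> is therefore
  defined on integers by the explicit formulas: bilinearity is then a computation, the product
  formula is quadratic reciprocity on generators, and local solubility enters in the form of
  congruences. The two notions are matched once, in \<open>soluble_iff_symbol\<close>.

  The set T is not unique and may contain places where q is already a square. At such a place
  \<epsilon>_v = 1, so the places where e is not a square, although possibly fewer than those of T,
  still give the product -1. The second product in condition (2) follows: the \<epsilon>_v over all
  v dividing 2q\<infinity> multiply to 1, since (n, q)_v is trivial at the other places.

  Only square classes matter, so units of \<int>[1/2q] are represented by nonzero integers whose
  primes divide 2q.\<close>

abbreviation (input) prim :: "'a::normalization_semidom \<Rightarrow> bool" where "prim \<equiv> Factorial_Ring.prime"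

section \<open>Hilbert symbols of integers and the product formula\<close>

definition unit_part :: "nat \<Rightarrow> int \<Rightarrow> int"
  where "unit_part p a = a div int p ^ multiplicity (int p) a"

lemma unit_part_decomp: "a = int p ^ multiplicity (int p) a * unit_part p a"
  unfolding unit_part_def by (simp add: multiplicity_dvd)

lemma unit_part_nonzero: "a \<noteq> 0 \<Longrightarrow> unit_part p a \<noteq> 0"
  using unit_part_decomp[of a p] by auto

lemma not_dvd_unit_part:
  assumes "prim p" "a \<noteq> 0" shows "\<not> int p dvd unit_part p a"
  unfolding unit_part_def using assms
  by (intro multiplicity_decompose) (auto dest: prime_gt_1_nat)

lemma unit_part_eqI:
  assumes "prim p" "a = int p ^ k * u" "\<not> int p dvd u"
  shows "multiplicity (int p) a = k" "unit_part p a = u"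
proof -
  show *: "multiplicity (int p) a = k"
    using assms by (intro multiplicity_eqI) auto
  show "unit_part p a = u"
    unfolding unit_part_def * using assms by (auto dest: prime_gt_0_nat)
qed

lemma unit_part_mult:
  assumes "prim p" "a \<noteq> 0" "b \<noteq> 0"
  shows "multiplicity (int p) (a * b) = multiplicity (int p) a + multiplicity (int p) b"
    "unit_part p (a * b) = unit_part p a * unit_part p b"
proof -
  have "a * b = int p ^ (multiplicity (int p) a + multiplicity (int p) b) * (unit_part p a * unit_part p b)"
    by (subst (1) unit_part_decomp[of a p], subst (1) unit_part_decomp[of b p]) (simp only: power_add mult_ac)
  moreover have "\<not> int p dvd unit_part p a * unit_part p b"
    using assms not_dvd_unit_part[of p] by (auto simp: prime_dvd_mult_iff)
  ultimately show "multiplicity (int p) (a * b) = multiplicity (int p) a + multiplicity (int p) b"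
    "unit_part p (a * b) = unit_part p a * unit_part p b"
    using unit_part_eqI assms(1) by blast+
qed

lemma unit_part_uminus: "unit_part p (- a) = - unit_part p a"
proof -
  have "int p ^ multiplicity (int p) a dvd a" by (rule multiplicity_dvd)
  then show ?thesis unfolding unit_part_def by (simp add: dvd_neg_div)
qed

lemma unit_part_not_dvd: "prim p \<Longrightarrow> \<not> int p dvd a \<Longrightarrow> multiplicity (int p) a = 0 \<and> unit_part p a = a"
  using unit_part_eqI[of p a 0 a] by auto

text \<open>Euler's criterion gives the equality modulo p. Both sides lie in {-1, 0, 1}, so they
  differ by at most 2, which is less than p.\<close>

lemma Legendre_mult:
  assumes "prim p" "p \<noteq> 2"
  shows "Legendre (a * b) (int p) = Legendre a (int p) * Legendre b (int p)"
proof -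
  have p: "2 < p" using assms prime_ge_2_nat[of p] by auto
  have "[Legendre (a * b) p = Legendre a p * Legendre b p] (mod p)"
    using cong_trans[OF euler_criterion[OF assms(1) p, of "a * b"]
        cong_sym[OF cong_mult[OF euler_criterion[OF assms(1) p, of a] euler_criterion[OF assms(1) p, of b]],
          folded power_mult_distrib]] .
  moreover have "Legendre (a * b) p \<in> {-1, 0, 1}" "Legendre a p * Legendre b p \<in> {-1, 0, 1}"
    by (auto simp: Legendre_def)
  ultimately have "int p dvd Legendre (a * b) p - Legendre a p * Legendre b p"
    "\<bar>Legendre (a * b) p - Legendre a p * Legendre b p\<bar> < int p"
    using p by (auto simp: cong_iff_dvd_diff)
  then show ?thesis using zdvd_imp_le[of "int p" "\<bar>Legendre (a * b) p - Legendre a p * Legendre b p\<bar>"] by force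
qed

lemma Legendre_pm: "\<not> p dvd a \<Longrightarrow> Legendre a p = 1 \<or> Legendre a p = - 1"
  by (auto simp: Legendre_def cong_0_iff)

lemma Legendre_1: "prim p \<Longrightarrow> Legendre 1 (int p) = 1"
  unfolding Legendre_def QuadRes_def using cong_refl[of "1::int"] prime_gt_1_nat[of p]
  by (auto simp: cong_0_iff intro!: exI[of _ 1])

text \<open>For odd u and w this is -1 to the power (u - 1)/2 times (w - 1)/2, the symbol at 2 of
  two odd integers. Comparing residues makes the laws below finite checks.\<close>

definition chi4 :: "int \<Rightarrow> int \<Rightarrow> int"
  where "chi4 u w = (if u mod 4 = 3 \<and> w mod 4 = 3 then - 1 else 1)"

text \<open>For odd u this is -1 to the power (u^2 - 1)/8, the symbol (u, 2) at the place 2.\<close>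

definition chi8 :: "int \<Rightarrow> int"
  where "chi8 u = (if u mod 8 = 1 \<or> u mod 8 = 7 then 1 else - 1)"

lemma chi4_mult:
  assumes "odd w" "odd w'" shows "chi4 u (w * w') = chi4 u w * chi4 u w'"
proof -
  define r s where "r = w mod 4" and "s = w' mod 4"
  have "r = 1 \<or> r = 3" "s = 1 \<or> s = 3" using assms unfolding r_def s_def by presburger+
  moreover have "(w * w') mod 4 = (r * s) mod 4" by (simp add: r_def s_def mod_mult_eq)
  ultimately show ?thesis
    unfolding chi4_def r_def[symmetric] s_def[symmetric] by (elim disjE) simp_all
qed

lemma chi8_mult:
  assumes "odd w" "odd w'" shows "chi8 (w * w') = chi8 w * chi8 w'"
proof -
  define r s where "r = w mod 8" and "s = w' mod 8"
  have "r = 1 \<or> r = 3 \<or> r = 5 \<or> r = 7" "s = 1 \<or> s = 3 \<or> s = 5 \<or> s = 7"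
    using assms unfolding r_def s_def by presburger+
  moreover have "(w * w') mod 8 = (r * s) mod 8" by (simp add: r_def s_def mod_mult_eq)
  ultimately show ?thesis
    unfolding chi8_def r_def[symmetric] s_def[symmetric] by (elim disjE) simp_all
qed

text \<open>The classical formulas for the Hilbert symbol of p^\<alpha> u and p^\<beta> w, taken
  here as the definition. The factor \<open>Legendre (- 1) p\<close> carries the usual sign with
  exponent \<alpha> \<beta> (p - 1)/2.\<close>

definition prime_symbol :: "nat \<Rightarrow> int \<Rightarrow> int \<Rightarrow> int"
  where "prime_symbol p a b =
    (let \<alpha> = multiplicity (int p) a; \<beta> = multiplicity (int p) b; u = unit_part p a; w = unit_part p b in
      if p = 2 then chi4 u w * chi8 u ^ \<beta> * chi8 w ^ \<alpha>
      else Legendre (- 1) p ^ (\<alpha> * \<beta>) * Legendre u p ^ \<beta> * Legendre w p ^ \<alpha>)"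

definition symbol :: "place \<Rightarrow> int \<Rightarrow> int \<Rightarrow> int"
  where "symbol v a b = (case v of
    Real_Place \<Rightarrow> if a < 0 \<and> b < 0 then - 1 else 1
  | Prime_Place p \<Rightarrow> prime_symbol p a b)"

text \<open>\<open>Prime_Place\<close> also accepts numbers that are not prime, for which the
  formulas have no meaning; hence the restriction to this set.\<close>

definition places :: "place set"
  where "places = insert Real_Place {Prime_Place p | p. prim p}"

lemma chi4_commute: "chi4 u w = chi4 w u" by (auto simp: chi4_def)

lemma symbol_commute: "symbol v a b = symbol v b a"
  by (auto simp: symbol_def prime_symbol_def Let_def chi4_commute mult_ac split: place.split)

lemma prime_symbol_mult_right:
  assumes p: "prim p" and nz: "c \<noteq> 0" "a \<noteq> 0" "b \<noteq> 0"
  shows "prime_symbol p c (a * b) = prime_symbol p c a * prime_symbol p c b"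
proof (cases "p = 2")
  case True
  have "odd (unit_part 2 a)" "odd (unit_part 2 b)" "odd (unit_part 2 c)"
    using not_dvd_unit_part[OF p] nz True by auto
  then show ?thesis using unit_part_mult[OF p nz(2,3)] True
    by (simp add: prime_symbol_def Let_def chi4_mult chi8_mult power_add power_mult_distrib mult_ac)
next
  case False
  show ?thesis using unit_part_mult[OF p nz(2,3)] False
    by (simp add: prime_symbol_def Let_def Legendre_mult[OF p] power_add power_mult_distrib mult_ac distrib_left)
qed

lemma symbol_mult_right:
  assumes "v \<in> places" "c \<noteq> 0" "a \<noteq> 0" "b \<noteq> 0"
  shows "symbol v c (a * b) = symbol v c a * symbol v c b"
  using assms prime_symbol_mult_right unfolding places_def symbol_def
  by (auto simp: zero_less_mult_iff mult_less_0_iff split: place.splits)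

lemma symbol_mult_left:
  assumes "v \<in> places" "c \<noteq> 0" "a \<noteq> 0" "b \<noteq> 0"
  shows "symbol v (a * b) c = symbol v a c * symbol v b c"
  using symbol_mult_right[OF assms] by (simp add: symbol_commute)

lemma symbol_pm:
  assumes "v \<in> places" "a \<noteq> 0" "b \<noteq> 0"
  shows "symbol v a b = 1 \<or> symbol v a b = - 1"
proof (cases v)
  case (Prime_Place p)
  then have p: "prim p" using assms by (auto simp: places_def)
  have "x ^ n = 1 \<or> x ^ n = - 1" if "x = 1 \<or> x = - 1" for x :: int and n
    using that by (cases "even n") auto
  moreover have "Legendre (unit_part p a) p = 1 \<or> Legendre (unit_part p a) p = -1"
     "Legendre (unit_part p b) p = 1 \<or> Legendre (unit_part p b) p = -1"
     "Legendre (- 1) p = 1 \<or> Legendre (- 1) p = -1"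
    using not_dvd_unit_part[OF p] assms prime_gt_1_nat[OF p] by (auto intro!: Legendre_pm)
  moreover have "x * y = 1 \<or> x * y = - 1" if "x = 1 \<or> x = - 1" "y = 1 \<or> y = - 1" for x y :: int
    using that by auto
  moreover have "chi4 x y = 1 \<or> chi4 x y = -1" "chi8 x = 1 \<or> chi8 x = - 1" for x y
    by (auto simp: chi4_def chi8_def)
  ultimately show ?thesis unfolding Prime_Place symbol_def prime_symbol_def Let_def
    by (auto split: if_splits)
qed (auto simp: symbol_def)

lemma symbol_square:
  assumes "v \<in> places" "a \<noteq> 0" "b \<noteq> 0"
  shows "symbol v a b * symbol v a b = 1"
  using symbol_pm[OF assms] by auto

lemma symbol_square_right:
  assumes "v \<in> places" "a \<noteq> 0" "b \<noteq> 0" "s \<noteq> 0"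
  shows "symbol v a (b * s\<^sup>2) = symbol v a b"
  using assms symbol_square[of v a s] by (simp add: power2_eq_square symbol_mult_right)

text \<open>The explicit counterpart of the solution x = y = 1, z = 0 of z^2 = a x^2 - a y^2. At odd
  p the formula leaves \<open>Legendre (- 1) p\<close> to the power n^2 + n, an even number.
  Together with bilinearity this turns (a, a) into (a, -1) and (a, -ab) into (a, b).\<close>

lemma symbol_neg_self:
  assumes "v \<in> places" "a \<noteq> 0"
  shows "symbol v a (- a) = 1"
proof (cases v)
  case (Prime_Place p)
  then have p: "prim p" using assms by (auto simp: places_def)
  note nd = not_dvd_unit_part[OF p assms(2)]
  show ?thesis
  proof (cases "p = 2")
    case True
    let ?u = "unit_part 2 a"
    have "odd ?u" using nd True by auto
    moreover have "chi8 (- ?u) = chi8 ?u" unfolding chi8_def by presburger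
    moreover have "chi4 ?u (- ?u) = 1" unfolding chi4_def using \<open>odd ?u\<close> by presburger
    moreover have "chi8 ?u * chi8 ?u = 1" by (simp add: chi8_def)
    ultimately show ?thesis using True
      by (simp add: Prime_Place symbol_def prime_symbol_def unit_part_uminus flip: power_mult_distrib)
  next
    case False
    let ?u = "unit_part p a" and ?n = "multiplicity (int p) a"
    have "Legendre (- ?u) p = Legendre (- 1) p * Legendre ?u p"
      using Legendre_mult[OF p False, of "-1" ?u] by simp
    moreover have "\<not> int p dvd - 1" using prime_gt_1_nat[OF p] by auto
    then have "Legendre (- 1) p * Legendre (- 1) p = 1" using Legendre_pm[of p "-1"] by auto
    moreover have "Legendre ?u p * Legendre ?u p = 1" using Legendre_pm[OF nd] by auto
    moreover have "x ^ (n * n) * x ^ n = 1" if "x * x = 1" for x :: int and n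
    proof -
      have "x = 1 \<or> x = -1" using that by (simp add: square_eq_1_iff)
      moreover have "even (n * n + n)" by simp
      ultimately show ?thesis by (auto simp flip: power_add)
    qed
    moreover have "symbol v a (- a) = Legendre (- 1) p ^ (?n * ?n) * Legendre (- 1) p ^ ?n * (Legendre ?u p * Legendre ?u p) ^ ?n"
      unfolding Prime_Place symbol_def prime_symbol_def Let_def place.case unit_part_uminus calculation(1)
      using False by (simp add: power_mult_distrib mult_ac)
    ultimately show ?thesis by simp
  qed
qed (auto simp: symbol_def)

lemma symbol_unramified:
  assumes "prim p" "p \<noteq> 2" "\<not> int p dvd a" "\<not> int p dvd b"
  shows "symbol (Prime_Place p) a b = 1"
  using assms unit_part_not_dvd[of p] by (simp add: symbol_def prime_symbol_def)

section \<open>Quadratic reciprocity and its two supplements\<close>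

lemma odd_prime_ge_3: "prim p \<Longrightarrow> p \<noteq> 2 \<Longrightarrow> 2 < (p::nat)"
  using prime_ge_2_nat[of p] by auto

lemma cong_pm_imp_eq:
  fixes x y :: int
  assumes "[x = y] (mod int p)" "2 < p" "x = 1 \<or> x = - 1" "y = 1 \<or> y = - 1"
  shows "x = y"
  using assms zdvd_imp_le[of "int p" 2] by (auto simp: cong_iff_dvd_diff)

lemma Legendre_minus_one:
  assumes "prim p" "p \<noteq> 2"
  shows "Legendre (- 1) (int p) = (- 1) ^ ((p - 1) div 2)"
proof -
  have p: "2 < p" using odd_prime_ge_3 assms .
  have "\<not> int p dvd - 1" using p by simp
  then have "Legendre (- 1) (int p) = 1 \<or> Legendre (- 1) (int p) = - 1" by (rule Legendre_pm)
  moreover have "(- 1) ^ ((p - 1) div 2) = (1::int) \<or> (- 1) ^ ((p - 1) div 2) = (-1::int)"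
    by (cases "even ((p - 1) div 2)") auto
  ultimately show ?thesis
    using cong_pm_imp_eq[OF euler_criterion[OF assms(1) p, of "-1"] p] by blast
qed

lemma chi4_minus_one:
  assumes "odd (p::nat)" shows "chi4 (- 1) (int p) = (- 1) ^ ((p - 1) div 2)"
proof -
  have "int p mod 4 = 1 \<and> even ((p - 1) div 2) \<or> int p mod 4 = 3 \<and> odd ((p - 1) div 2)"
    using assms by presburger
  then show ?thesis by (auto simp: chi4_def)
qed

text \<open>In Gauss's lemma for \<open>a = 2\<close>, the residues \<open>2, 4, \<dots>, p - 1\<close> need no reduction modulo \<open>p\<close>.\<close>

lemma Legendre_two:
  assumes "prim p" "p \<noteq> 2"
  shows "Legendre 2 (int p) = chi8 (int p)"
proof -
  have p: "2 < p" using odd_prime_ge_3 assms .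
  have op: "odd p" using assms p prime_odd_nat by auto
  have "[2 \<noteq> 0] (mod int p)" using p zdvd_imp_le[of "int p" 2] by (auto simp: cong_0_iff)
  then interpret G: GAUSS p 2 by unfold_locales (use assms p in auto)
  define h where "h = (int p - 1) div 2"
  have h: "int p = 2 * h + 1" using op unfolding h_def by presburger
  have "G.C = (\<lambda>x. x * 2) ` {0<..h}"
    unfolding G.C_def G.B_def G.A_def image_image h_def[symmetric]
    by (rule image_cong[OF refl], rule mod_pos_pos_trivial) (use h in auto)
  then have "G.E = (\<lambda>x. x * 2) ` {h div 2<..h}"
    unfolding G.E_def h_def[symmetric] by (auto simp: image_iff Bex_def)
  then have "card G.E = nat (h - h div 2)"
    by (simp add: card_image inj_on_def)
  then have "Legendre 2 (int p) = (- 1) ^ nat (h - h div 2)"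
    using G.gauss_lemma by simp
  moreover have "chi8 (int p) = (- 1) ^ nat (h - h div 2)"
  proof -
    have h0: "h - h div 2 \<ge> 0" using h p by linarith
    have "even (nat (h - h div 2)) \<longleftrightarrow> even (h - h div 2)" using h0 by (simp add: even_nat_iff)
    moreover have "even (h - h div 2) \<longleftrightarrow> int p mod 8 = 1 \<or> int p mod 8 = 7"
      unfolding h by presburger
    ultimately show ?thesis unfolding chi8_def by auto
  qed
  ultimately show ?thesis by simp
qed

lemma Legendre_reciprocity:
  assumes "prim p" "prim r" "p \<noteq> 2" "r \<noteq> 2" "p \<noteq> r"
  shows "Legendre (int p) (int r) * Legendre (int r) (int p) = chi4 (int p) (int r)"
proof -
  have p: "2 < p" "2 < r" using odd_prime_ge_3 assms by auto
  have "odd p" "odd r" using assms p prime_odd_nat by auto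
  then have "int p mod 4 = 1 \<and> even ((p - 1) div 2) \<or> int p mod 4 = 3 \<and> odd ((p - 1) div 2)"
     "int r mod 4 = 1 \<and> even ((r - 1) div 2) \<or> int r mod 4 = 3 \<and> odd ((r - 1) div 2)"
    by presburger+
  then have "chi4 (int p) (int r) = (- 1) ^ ((p - 1) div 2 * ((r - 1) div 2))"
    unfolding chi4_def by auto
  then show ?thesis using Quadratic_Reciprocity[OF assms(1) p(1) assms(2) p(2) assms(5)] by simp
qed

text \<open>The nonzero integers that become units once the primes in \<open>S\<close> are inverted.
  Modulo squares they represent all units of that ring.\<close>

definition supported :: "place set \<Rightarrow> int \<Rightarrow> bool"
  where "supported S a \<longleftrightarrow> a \<noteq> 0 \<and> (\<forall>p. prim p \<and> int p dvd a \<longrightarrow> Prime_Place p \<in> S)"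

lemma supported_mult: "supported S a \<Longrightarrow> supported S b \<Longrightarrow> supported S (a * b)"
  by (auto simp: supported_def prime_dvd_mult_iff)

lemma supported_nonzero: "supported S a \<Longrightarrow> a \<noteq> 0" by (simp add: supported_def)

lemma int_prime_cases:
  assumes "prim (x::int)" obtains p where "x = int p" "prim p"
  using assms by (metis prime_ge_0_int prime_int_nat_transfer nat_0_le)

text \<open>Up to products, -1 and the primes in \<open>S\<close> give all supported integers, so a
  bilinear identity has to be checked on these generators only.\<close>

lemma supported_induct [consumes 1, case_names minus_one prime mult]:
  assumes "supported S a" "P (- 1)" "\<And>p. prim p \<Longrightarrow> Prime_Place p \<in> S \<Longrightarrow> P (int p)"
    "\<And>a b. supported S a \<Longrightarrow> supported S b \<Longrightarrow> P a \<Longrightarrow> P b \<Longrightarrow> P (a * b)"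
  shows "P a"
  using assms(1)
proof (induction a rule: prime_divisors_induct)
  case (factor p x)
  then obtain r where r: "p = int r" "prim r" using int_prime_cases by blast
  have "Prime_Place r \<in> S" "supported S x" using factor r by (auto simp: supported_def)
  moreover have "supported S p"
    using \<open>Prime_Place r \<in> S\<close> r by (auto simp: supported_def dest: primes_dvd_imp_eq prime_gt_0_nat)
  ultimately show ?case using assms(3)[of r] assms(4)[of p x] factor r by auto
next
  case (unit x)
  have "supported S (-1)" by (auto simp: supported_def)
  then have "P 1" using assms(4)[of "-1" "-1"] assms(2) by simp
  then show ?case using unit assms(2) zdvd1_eq[of x] by (metis abs_1 abs_eq_iff)
qed (simp add: supported_def)

section \<open>Symbols of generators and the product formula\<close>

lemma symbol_Real: "symbol Real_Place a b = (if a < 0 \<and> b < 0 then - 1 else 1)"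
  by (simp add: symbol_def)

lemma symbol_two_units:
  "odd a \<Longrightarrow> odd b \<Longrightarrow> symbol (Prime_Place 2) a b = chi4 a b"
  using unit_part_not_dvd[of 2 a] unit_part_not_dvd[of 2 b]
  by (simp add: symbol_def prime_symbol_def)

lemma symbol_prime_unit:
  assumes "prim p" "p \<noteq> 2" "\<not> int p dvd b"
  shows "symbol (Prime_Place p) b (int p) = Legendre b (int p)"
  using assms unit_part_not_dvd[of p b] unit_part_eqI[of p "int p" 1 1] prime_gt_1_nat[of p]
  by (simp add: symbol_def prime_symbol_def Legendre_1)

lemma symbol_two_unit:
  assumes "odd b" shows "symbol (Prime_Place 2) b 2 = chi8 b"
  using assms unit_part_not_dvd[of 2 b] unit_part_eqI[of 2 2 1 1]
  by (simp add: symbol_def prime_symbol_def chi4_def)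

lemma prod_eq_subset:
  assumes "finite S" "A \<subseteq> S" "\<And>v. v \<in> S - A \<Longrightarrow> f v = (1::int)"
  shows "prod f S = prod f A"
  using assms by (intro prod.mono_neutral_right) auto

context
  fixes S :: "place set"
  assumes S: "finite S" "Real_Place \<in> S" "Prime_Place 2 \<in> S" "S \<subseteq> places"
begin

text \<open>At an odd prime where both arguments are units the symbol is 1, so any set
  \<open>A\<close> containing the real place, 2 and the primes dividing an argument carries the
  whole product.\<close>

lemma prod_subset_odd:
  assumes A: "A \<subseteq> S" "Real_Place \<in> A" "Prime_Place 2 \<in> A"
    and un: "\<And>p. prim p \<Longrightarrow> p \<noteq> 2 \<Longrightarrow> Prime_Place p \<notin> A \<Longrightarrow> \<not> int p dvd a \<and> \<not> int p dvd b"
  shows "(\<Prod>v\<in>S. symbol v a b) = (\<Prod>v\<in>A. symbol v a b)"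
proof (rule prod_eq_subset[OF S(1) A(1)])
  fix v assume v: "v \<in> S - A"
  then obtain p where p: "v = Prime_Place p" "prim p" using S(4) A(2) unfolding places_def by auto
  then show "symbol v a b = 1" using un[of p] v A(3) symbol_unramified[of p a b] by auto
qed

text \<open>For p = 2 every factor is 1. For odd p the factors at 2 and at p are both (-1)^((p -
  1)/2) by the first supplement, and they cancel.\<close>

lemma prod_minus_one_prime:
  assumes "prim p" "Prime_Place p \<in> S"
  shows "(\<Prod>v\<in>S. symbol v (- 1) (int p)) = 1"
proof -
  have "(\<Prod>v\<in>S. symbol v (- 1) (int p)) = (\<Prod>v\<in>{Real_Place, Prime_Place 2, Prime_Place p}. symbol v (- 1) (int p))"
    by (rule prod_subset_odd) (use S assms in \<open>auto simp: primes_dvd_imp_eq dest: prime_gt_1_nat\<close>)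
  also have "\<dots> = 1"
  proof (cases "p = 2")
    case True
    then show ?thesis using symbol_two_unit[of "-1"] by (simp add: symbol_Real chi8_def)
  next
    case False
    then have "odd p" using assms prime_odd_nat[of p] odd_prime_ge_3 by auto
    moreover have "\<not> int p dvd - 1" using prime_gt_1_nat assms by auto
    moreover have "(- 1) ^ n * (- 1) ^ n = (1::int)" for n :: nat by (simp flip: power_mult_distrib)
    ultimately show ?thesis
      using False assms symbol_prime_unit[of p "-1"] symbol_two_units[of "-1" "int p"]
        chi4_minus_one[of p] Legendre_minus_one[of p]
      by (simp add: symbol_Real)
  qed
  finally show ?thesis .
qed

text \<open>The factors at the real place and at 2 are both -1.\<close>

lemma prod_minus_one_minus_one: "(\<Prod>v\<in>S. symbol v (- 1) (- 1)) = 1"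
proof -
  have "(\<Prod>v\<in>S. symbol v (- 1) (- 1)) = (\<Prod>v\<in>{Real_Place, Prime_Place 2}. symbol v (- 1) (- 1))"
    by (rule prod_subset_odd) (use S in \<open>auto dest: prime_gt_1_nat\<close>)
  then show ?thesis using symbol_two_units[of "-1" "-1"] by (simp add: symbol_Real chi4_def)
qed

text \<open>For equal primes (p, -p) = 1 replaces one p by -1. For distinct odd primes the factors
  at p, r and 2 are the three terms of the reciprocity law.\<close>

lemma prod_prime_prime:
  assumes p: "prim p" "Prime_Place p \<in> S" and r: "prim r" "Prime_Place r \<in> S"
  shows "(\<Prod>v\<in>S. symbol v (int p) (int r)) = 1"
proof (cases "p = r")
  case True
  have "symbol v (int p) (int p) = symbol v (- 1) (int p)" if "v \<in> S" for v
  proof -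
    have v: "v \<in> places" and p0: "int p \<noteq> 0" using S(4) that p by auto
    have "symbol v (int p) (-1 * int p) = 1" using symbol_neg_self[OF v p0] by simp
    then have "symbol v (int p) (-1) * symbol v (int p) (int p) = 1"
      using symbol_mult_right[OF v p0, of "-1" "int p"] p0 by simp
    then show ?thesis
      using symbol_pm[OF v p0, of "-1"] symbol_commute[of v "-1" "int p"] by auto
  qed
  then show ?thesis using prod_minus_one_prime[OF p] True by simp
next
  case False
  have "(\<Prod>v\<in>S. symbol v (int p) (int r)) =
      (\<Prod>v\<in>{Real_Place, Prime_Place 2, Prime_Place p, Prime_Place r}. symbol v (int p) (int r))"
    by (rule prod_subset_odd) (use S p r in \<open>auto simp: primes_dvd_imp_eq\<close>)
  also have "\<dots> = 1"
  proof -
    \<comment> \<open>If one prime is 2, only the places 2 and t contribute. Both factors equal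
      \<open>chi8\<close> of t, the one at t by the second supplement.\<close>
    have two: "symbol (Prime_Place 2) 2 (int t) * symbol (Prime_Place t) 2 (int t) = 1"
      if t: "prim t" "t \<noteq> 2" for t
    proof -
      have "odd t" using t prime_odd_nat[of t] odd_prime_ge_3 by auto
      then have "symbol (Prime_Place 2) 2 (int t) = chi8 (int t)"
        using symbol_two_unit[of "int t"] symbol_commute by auto
      moreover have "\<not> int t dvd 2" using odd_prime_ge_3[OF t] zdvd_imp_le[of "int t" 2] by auto
      then have "symbol (Prime_Place t) 2 (int t) = chi8 (int t)"
        using symbol_prime_unit[OF t] Legendre_two[OF t] by simp
      ultimately show ?thesis by (simp add: chi8_def)
    qed
    consider "p = 2" "r \<noteq> 2" | "r = 2" "p \<noteq> 2" | "p \<noteq> 2" "r \<noteq> 2" using False by auto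
    then show ?thesis
    proof cases
      case 1
      then show ?thesis using two[of r] r False by (simp add: symbol_Real)
    next
      case 2
      then show ?thesis using two[of p] p False
        by (simp add: symbol_Real symbol_commute[of _ "int p" 2] insert_commute mult.commute)
    next
      case 3
      have nd: "\<not> int p dvd int r" "\<not> int r dvd int p" "odd p" "odd r"
        using p r False 3 primes_dvd_imp_eq[of p r] primes_dvd_imp_eq[of r p]
          prime_odd_nat[of p] prime_odd_nat[of r] odd_prime_ge_3[of p] odd_prime_ge_3[of r] by auto
      then have "symbol (Prime_Place 2) (int p) (int r) = chi4 (int p) (int r)"
        by (simp add: symbol_two_units)
      moreover have "symbol (Prime_Place p) (int p) (int r) = Legendre (int r) (int p)"
        using symbol_prime_unit[of p "int r"] p 3 nd symbol_commute by metis
      moreover have "symbol (Prime_Place r) (int p) (int r) = Legendre (int p) (int r)"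
        using symbol_prime_unit[of r "int p"] r 3 nd by simp
      moreover have "chi4 (int p) (int r) * chi4 (int p) (int r) = 1" by (simp add: chi4_def)
      ultimately show ?thesis using 3 False Legendre_reciprocity[of p r] p r
        by (simp add: symbol_Real mult_ac)
    qed
  qed
  finally show ?thesis .
qed

text \<open>The product is multiplicative in each argument, so induction over the generators applies
  to one argument after the other.\<close>

theorem symbol_product_formula:
  assumes "supported S a" "supported S b"
  shows "(\<Prod>v\<in>S. symbol v a b) = 1"
proof -
  have minus_one: "(\<Prod>v\<in>S. symbol v (- 1) b) = 1" using assms(2)
  proof (induction b rule: supported_induct)
    case (mult a b)
    have "(\<Prod>v\<in>S. symbol v (- 1) (a * b)) = (\<Prod>v\<in>S. symbol v (- 1) a * symbol v (- 1) b)"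
      by (rule prod.cong[OF refl], rule symbol_mult_right) (use mult S(4) supported_nonzero in auto)
    then show ?case using mult by (simp add: prod.distrib)
  qed (simp_all add: prod_minus_one_minus_one prod_minus_one_prime)
  have pr: "(\<Prod>v\<in>S. symbol v (int p) b) = 1" if p: "prim p" "Prime_Place p \<in> S" for p
    using assms(2)
  proof (induction b rule: supported_induct)
    case minus_one
    then show ?case using prod_minus_one_prime[OF p] by (simp add: symbol_commute)
  next
    case (mult a b)
    have "(\<Prod>v\<in>S. symbol v (int p) (a * b)) = (\<Prod>v\<in>S. symbol v (int p) a * symbol v (int p) b)"
      by (rule prod.cong[OF refl], rule symbol_mult_right) (use mult S(4) supported_nonzero p in auto)
    then show ?case using mult by (simp add: prod.distrib)
  qed (simp_all add: prod_prime_prime p)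
  show ?thesis using assms(1)
  proof (induction a rule: supported_induct)
    case (mult a a')
    have "(\<Prod>v\<in>S. symbol v (a * a') b) = (\<Prod>v\<in>S. symbol v a b * symbol v a' b)"
      by (rule prod.cong[OF refl], rule symbol_mult_left) (use mult S(4) supported_nonzero assms(2) in auto)
    then show ?case using mult by (simp add: prod.distrib)
  qed (simp_all add: minus_one pr)
qed

end

section \<open>Ternary forms: local conditions and the Hasse-Minkowski theorem\<close>

text \<open>Solubility over the p-adic numbers, expressed by congruences: approximate solutions to
  every precision whose divisibility by p stays bounded. The bound k is left free so that the
  variables may be rescaled; \<open>locally_soluble_primitive\<close> brings it down to 1.\<close>

definition locally_soluble :: "nat \<Rightarrow> int \<Rightarrow> int \<Rightarrow> bool"
  where "locally_soluble p a b \<longleftrightarrow> (\<exists>k. \<forall>n. \<exists>x y z.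
    \<not> (int p ^ k dvd x \<and> int p ^ k dvd y \<and> int p ^ k dvd z) \<and> int p ^ n dvd z\<^sup>2 - a * x\<^sup>2 - b * y\<^sup>2)"

lemma locally_soluble_commute:
  assumes "locally_soluble p a b" shows "locally_soluble p b a"
proof -
  obtain k where k: "\<And>n. \<exists>x y z. \<not> (int p ^ k dvd x \<and> int p ^ k dvd y \<and> int p ^ k dvd z) \<and> int p ^ n dvd z\<^sup>2 - a * x\<^sup>2 - b * y\<^sup>2"
    using assms unfolding locally_soluble_def by blast
  show ?thesis unfolding locally_soluble_def
  proof (intro exI[of _ k] allI)
    fix n
    obtain x y z where "\<not> (int p ^ k dvd x \<and> int p ^ k dvd y \<and> int p ^ k dvd z)" "int p ^ n dvd z\<^sup>2 - a * x\<^sup>2 - b * y\<^sup>2"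
      using k by blast
    then show "\<exists>x y z. \<not> (int p ^ k dvd x \<and> int p ^ k dvd y \<and> int p ^ k dvd z) \<and> int p ^ n dvd z\<^sup>2 - b * x\<^sup>2 - a * y\<^sup>2"
      by (intro exI[of _ y] exI[of _ x] exI[of _ z]) (auto simp: algebra_simps)
  qed
qed

lemma locally_soluble_if_globally_soluble:
  assumes p: "prim p" and nz: "(x, y, z) \<noteq> (0, 0, 0)" and eq: "z\<^sup>2 = a * x\<^sup>2 + b * y\<^sup>2"
  shows "locally_soluble p a b"
proof -
  have "\<exists>k. \<not> int p ^ k dvd w" if "w \<noteq> 0" for w :: int
  proof -
    have "finite {k. int p ^ k dvd w}"
      using that p prime_gt_1_nat[of p] by (intro finite_divisor_powers) auto
    then show ?thesis by (metis (mono_tags) UNIV_I ex_new_if_finite infinite_UNIV_nat mem_Collect_eq)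
  qed
  then obtain k where "\<not> (int p ^ k dvd x \<and> int p ^ k dvd y \<and> int p ^ k dvd z)" using nz by blast
  then show ?thesis unfolding locally_soluble_def using eq
    by (intro exI[of _ k] allI exI[of _ x] exI[of _ y] exI[of _ z]) auto
qed

lemma prime_power_dvd_cancel:
  assumes p: "prim p" and "s \<noteq> 0" "int p ^ (k + multiplicity (int p) s) dvd s * x"
  shows "int p ^ k dvd x"
proof -
  let ?P = "int p ^ multiplicity (int p) s"
  have eq: "s * x = ?P * (unit_part p s * x)"
    by (subst (1) unit_part_decomp[of s p]) (simp add: mult_ac)
  have "?P * int p ^ k dvd ?P * (unit_part p s * x)"
    using assms(3) unfolding eq power_add by (simp only: mult.commute[of "int p ^ k"])
  then have "int p ^ k dvd unit_part p s * x" using prime_gt_0_nat[OF p] by simp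
  moreover have "coprime (int p ^ k) (unit_part p s)"
    using not_dvd_unit_part[OF p assms(2)] p by (auto simp: prime_imp_coprime)
  ultimately show ?thesis by (simp add: coprime_dvd_mult_right_iff)
qed

text \<open>The factor s is absorbed into y, at the price of raising the bound k by the valuation of
  s.\<close>

lemma locally_soluble_square:
  assumes p: "prim p" and s: "s \<noteq> 0" and sol: "locally_soluble p a (b * s\<^sup>2)"
  shows "locally_soluble p a b"
proof -
  obtain k where k: "\<And>n. \<exists>x y z. \<not> (int p ^ k dvd x \<and> int p ^ k dvd y \<and> int p ^ k dvd z) \<and> int p ^ n dvd z\<^sup>2 - a * x\<^sup>2 - b * s\<^sup>2 * y\<^sup>2"
    using sol unfolding locally_soluble_def by blast
  let ?m = "multiplicity (int p) s"
  show ?thesis unfolding locally_soluble_def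
  proof (intro exI[of _ "k + ?m"] allI)
    fix n
    obtain x y z where xyz: "\<not> (int p ^ k dvd x \<and> int p ^ k dvd y \<and> int p ^ k dvd z)"
      "int p ^ n dvd z\<^sup>2 - a * x\<^sup>2 - b * s\<^sup>2 * y\<^sup>2" using k by blast
    have "\<not> (int p ^ (k + ?m) dvd x \<and> int p ^ (k + ?m) dvd s * y \<and> int p ^ (k + ?m) dvd z)"
      using xyz(1) prime_power_dvd_cancel[OF p s, of k y] by (auto simp: power_add dest: dvd_mult_left)
    then show "\<exists>x y z. \<not> (int p ^ (k + ?m) dvd x \<and> int p ^ (k + ?m) dvd y \<and> int p ^ (k + ?m) dvd z) \<and>
        int p ^ n dvd z\<^sup>2 - a * x\<^sup>2 - b * y\<^sup>2"
      using xyz(2) by (intro exI[of _ x] exI[of _ "s * y"] exI[of _ z]) (auto simp: power_mult_distrib mult_ac)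
  qed
qed

text \<open>Multiplying z^2 - a x^2 - b y^2 by -a gives (a x)^2 - a z^2 + a b y^2. Hence x and z
  exchange roles, and the factor a in front of x raises the bound k by its valuation.\<close>

lemma locally_soluble_twist:
  assumes p: "prim p" and a: "a \<noteq> 0" and sol: "locally_soluble p a b"
  shows "locally_soluble p a (- a * b)"
proof -
  obtain k where k: "\<And>n. \<exists>x y z. \<not> (int p ^ k dvd x \<and> int p ^ k dvd y \<and> int p ^ k dvd z) \<and> int p ^ n dvd z\<^sup>2 - a * x\<^sup>2 - b * y\<^sup>2"
    using sol unfolding locally_soluble_def by blast
  let ?m = "multiplicity (int p) a"
  show ?thesis unfolding locally_soluble_def
  proof (intro exI[of _ "k + ?m"] allI)
    fix n
    obtain x y z where xyz: "\<not> (int p ^ k dvd x \<and> int p ^ k dvd y \<and> int p ^ k dvd z)"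
      "int p ^ n dvd z\<^sup>2 - a * x\<^sup>2 - b * y\<^sup>2" using k by blast
    have "\<not> (int p ^ (k + ?m) dvd z \<and> int p ^ (k + ?m) dvd y \<and> int p ^ (k + ?m) dvd a * x)"
      using xyz(1) prime_power_dvd_cancel[OF p a, of k x] by (auto simp: power_add dest: dvd_mult_left)
    moreover have "(a * x)\<^sup>2 - a * z\<^sup>2 - - a * b * y\<^sup>2 = (z\<^sup>2 - a * x\<^sup>2 - b * y\<^sup>2) * (- a)"
      by (simp add: algebra_simps power2_eq_square)
    ultimately show "\<exists>x y z. \<not> (int p ^ (k + ?m) dvd x \<and> int p ^ (k + ?m) dvd y \<and> int p ^ (k + ?m) dvd z) \<and>
        int p ^ n dvd z\<^sup>2 - a * x\<^sup>2 - - a * b * y\<^sup>2"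
      using dvd_mult2[OF xyz(2), of "- a"] by metis
  qed
qed

text \<open>Common factors p are divided out one at a time, fewer than k of them. Each costs p^2 of
  the modulus, so precision n + 2k at the start leaves precision n.\<close>

lemma locally_soluble_primitive:
  assumes p: "prim p" and sol: "locally_soluble p a b"
  obtains x y z where "\<not> (int p dvd x \<and> int p dvd y \<and> int p dvd z)" "int p ^ n dvd z\<^sup>2 - a * x\<^sup>2 - b * y\<^sup>2"
proof -
  have "\<exists>x y z. \<not> (int p dvd x \<and> int p dvd y \<and> int p dvd z) \<and> int p ^ n dvd z\<^sup>2 - a * x\<^sup>2 - b * y\<^sup>2"
    if "\<not> (int p ^ k dvd x \<and> int p ^ k dvd y \<and> int p ^ k dvd z)" "int p ^ (n + 2 * k) dvd z\<^sup>2 - a * x\<^sup>2 - b * y\<^sup>2"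
    for k x y z
    using that
  proof (induction k arbitrary: x y z)
    case (Suc k)
    show ?case
    proof (cases "int p dvd x \<and> int p dvd y \<and> int p dvd z")
      case True
      then obtain x' y' z' where eq: "x = int p * x'" "y = int p * y'" "z = int p * z'" by (auto simp: dvd_def)
      have p0: "int p \<noteq> 0" using p by auto
      have "\<not> (int p ^ k dvd x' \<and> int p ^ k dvd y' \<and> int p ^ k dvd z')"
        using Suc.prems(1) unfolding eq by auto
      moreover have "int p ^ 2 * int p ^ (n + 2 * k) dvd int p ^ 2 * (z'\<^sup>2 - a * x'\<^sup>2 - b * y'\<^sup>2)"
        using Suc.prems(2) unfolding eq by (simp add: power_add algebra_simps power2_eq_square)
      then have "int p ^ (n + 2 * k) dvd z'\<^sup>2 - a * x'\<^sup>2 - b * y'\<^sup>2" using p0 by simp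
      ultimately show ?thesis using Suc.IH by blast
    next
      case False
      then show ?thesis using Suc.prems(2) by (meson dvd_trans le_add1 le_imp_power_dvd)
    qed
  qed simp
  then show ?thesis using sol that unfolding locally_soluble_def by blast
qed

section \<open>From local solubility to the symbol\<close>

lemma square_mod_8: "odd (x::int) \<Longrightarrow> x\<^sup>2 mod 8 = 1"
proof -
  assume "odd x"
  then obtain k where k: "x = 2 * k + 1" by (auto elim: oddE)
  have "even (k * (k + 1))" by simp
  then obtain j where "k * (k + 1) = 2 * j" by (elim evenE)
  then have "x\<^sup>2 = 8 * j + 1" unfolding k by (simp add: power2_eq_square algebra_simps)
  then show ?thesis by simp
qed

lemma odd_square_minus_one: "odd (x::int) \<Longrightarrow> 8 dvd x\<^sup>2 - 1"
  using square_mod_8[of x] mod_eq_dvd_iff[of "x\<^sup>2" 8 1] by simp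

text \<open>A primitive solution modulo \<open>p\<^sup>2\<close> (modulo 8 if \<open>p = 2\<close>) suffices.\<close>

lemma symbol_if_soluble_unit_left:
  assumes p: "prim p" and a: "\<not> int p dvd a" and b: "b \<noteq> 0" "multiplicity (int p) b \<le> 1"
    and sol: "locally_soluble p a b"
  shows "prime_symbol p a b = 1"
proof -
  obtain w where w: "unit_part p b = w" by simp
  have a': "multiplicity (int p) a = 0" "unit_part p a = a" using unit_part_not_dvd[OF p a] by auto
  have pw: "\<not> int p dvd w" using not_dvd_unit_part[OF p b(1)] w by simp
  have pi: "Factorial_Ring.prime_elem (int p)" using p by simp
  consider "multiplicity (int p) b = 0" | "multiplicity (int p) b = 1" using b(2) by linarith
  then show ?thesis
  proof cases
    case 1
    then have b': "b = w" using unit_part_decomp[of b p] w by simp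
    show ?thesis
    proof (cases "p = 2")
      case True
      obtain x y z where xyz: "\<not> (int p dvd x \<and> int p dvd y \<and> int p dvd z)"
        "int p ^ 2 dvd z\<^sup>2 - a * x\<^sup>2 - b * y\<^sup>2"
        using locally_soluble_primitive[OF p sol] by metis
      \<comment> \<open>If a and b are both -1 modulo 4, the congruence reads x^2 + y^2 + z^2 = 0
        modulo 4, which makes x, y and z all even.\<close>
      have "\<not> (a mod 4 = 3 \<and> b mod 4 = 3)"
      proof
        assume "a mod 4 = 3 \<and> b mod 4 = 3"
        then have ab: "4 dvd a + 1" "4 dvd b + 1" by presburger+
        have "4 dvd (z\<^sup>2 - a * x\<^sup>2 - b * y\<^sup>2) + ((a + 1) * x\<^sup>2 + (b + 1) * y\<^sup>2)"
          using xyz(2) True ab by (intro dvd_add) auto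
        then have d: "4 dvd x\<^sup>2 + y\<^sup>2 + z\<^sup>2" by (simp add: algebra_simps)
        have sq: "t\<^sup>2 mod 4 = (if even t then 0 else 1)" for t :: int
          using square_mod_8[of t] by (auto elim!: evenE simp: power2_eq_square) presburger
        have "x\<^sup>2 + y\<^sup>2 + z\<^sup>2 = 4 * ((x\<^sup>2) div 4 + (y\<^sup>2) div 4 + (z\<^sup>2) div 4) + ((x\<^sup>2) mod 4 + (y\<^sup>2) mod 4 + (z\<^sup>2) mod 4)"
          by simp
        then have "4 dvd (x\<^sup>2) mod 4 + (y\<^sup>2) mod 4 + (z\<^sup>2) mod 4" using d by (metis dvd_add_right_iff dvd_triv_left)
        then show False using xyz(1) True unfolding sq by (auto split: if_splits)
      qed
      then show ?thesis using True a' 1 b' w by (simp add: prime_symbol_def chi4_def)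
    next
      case False
      then show ?thesis using a' 1 b' w by (simp add: prime_symbol_def)
    qed
  next
    case 2
    then have b': "b = int p * w" using unit_part_decomp[of b p] w by simp
    show ?thesis
    proof (cases "p = 2")
      case True
      obtain x y z where xyz: "\<not> (int p dvd x \<and> int p dvd y \<and> int p dvd z)"
        "int p ^ 3 dvd z\<^sup>2 - a * x\<^sup>2 - b * y\<^sup>2"
        using locally_soluble_primitive[OF p sol] by metis
      have d8: "8 dvd z\<^sup>2 - a * x\<^sup>2 - 2 * w * y\<^sup>2" using xyz(2) True b' by simp
      have oa: "odd a" "odd w" using a pw True by auto
      have xz: "even x \<longleftrightarrow> even z"
      proof -
        have "even (z\<^sup>2 - a * x\<^sup>2 - 2 * w * y\<^sup>2)" using d8 by (meson dvd_trans even_numeral)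
        then show ?thesis using oa by simp
      qed
      \<comment> \<open>If x is even then so is z, hence 4 divides 2 w y^2 and y is even too,
        against primitivity.\<close>
      have ox: "odd x"
      proof
        assume "even x"
        then obtain x' z' where x': "x = 2 * x'" "z = 2 * z'" using xz by (auto elim!: evenE)
        have "4 dvd z\<^sup>2 - a * x\<^sup>2 - 2 * w * y\<^sup>2" using d8 by (rule dvd_trans[rotated]) simp
        then have "4 dvd 4 * (z'\<^sup>2 - a * x'\<^sup>2) - 2 * (w * y\<^sup>2)"
          unfolding x' by (simp add: algebra_simps power2_eq_square)
        moreover have "even m" if "4 dvd 4 * l - 2 * m" for l m :: int using that by presburger
        ultimately have "even (w * y\<^sup>2)" by blast
        then show False using oa xyz(1) True \<open>even x\<close> xz by simp
      qed
      then have oz: "odd z" using xz by simp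
      define r s where "r = a mod 8" and "s = w mod 4"
      have "r = 1 \<or> r = 3 \<or> r = 5 \<or> r = 7" "s = 1 \<or> s = 3" using oa unfolding r_def s_def by presburger+
      \<comment> \<open>Odd squares are 1 modulo 8, which leaves 1 - a - 2 w y^2 = 0 modulo 8; the
        last term is 0 or 2 w according to the parity of y.\<close>
      moreover have "8 dvd 1 - a \<or> 8 dvd 1 - a - 2 * w"
      proof -
        have zx: "8 dvd z\<^sup>2 - 1" "8 dvd x\<^sup>2 - 1"
          using odd_square_minus_one[OF oz] odd_square_minus_one[OF ox] .
        have e1: "8 dvd 1 - a - 2 * w * y\<^sup>2"
        proof -
          have "8 dvd (z\<^sup>2 - a * x\<^sup>2 - 2 * w * y\<^sup>2) - (z\<^sup>2 - 1) + a * (x\<^sup>2 - 1)"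
            by (rule dvd_add[OF dvd_diff[OF d8 zx(1)] dvd_mult[OF zx(2)]])
          then show ?thesis by (simp add: algebra_simps)
        qed
        show ?thesis
        proof (cases "even y")
          case True
          then obtain y' where "y = 2 * y'" by (auto elim: evenE)
          then have "8 dvd 2 * w * y\<^sup>2" by (auto simp: power2_eq_square)
          from dvd_add[OF e1 this] show ?thesis by simp
        next
          case False
          then have "8 dvd y\<^sup>2 - 1" by (rule odd_square_minus_one)
          then have "8 dvd (1 - a - 2 * w * y\<^sup>2) + 2 * w * (y\<^sup>2 - 1)" by (intro dvd_add[OF e1] dvd_mult)
          then show ?thesis by (simp add: algebra_simps)
        qed
      qed
      then have "r = 1 \<or> 8 dvd 1 - r - 2 * s" unfolding r_def s_def by presburger
      moreover have "chi4 a w = (if r mod 4 = 3 \<and> s = 3 then - 1 else 1)"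
        unfolding chi4_def r_def s_def by (simp add: mod_mod_cancel)
      moreover have "chi8 a = (if r = 1 \<or> r = 7 then 1 else - 1)" unfolding chi8_def r_def by simp
      ultimately have "chi4 a w * chi8 a = 1" by auto
      then show ?thesis using True a' 2 w by (simp add: prime_symbol_def)
    next
      case False
      obtain x y z where xyz: "\<not> (int p dvd x \<and> int p dvd y \<and> int p dvd z)"
        "int p ^ 2 dvd z\<^sup>2 - a * x\<^sup>2 - b * y\<^sup>2"
        using locally_soluble_primitive[OF p sol] by metis
      have "int p dvd z\<^sup>2 - a * x\<^sup>2 - int p * w * y\<^sup>2"
        using xyz(2) b' by (metis dvd_trans dvd_triv_left power2_eq_square)
      then have d1: "int p dvd z\<^sup>2 - a * x\<^sup>2" by (metis dvd_diff_left_iff dvd_mult2 dvd_triv_left mult.assoc)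
      \<comment> \<open>If p divides x it divides z, so p^2 divides b y^2. As b contains p only
        once, p divides y as well.\<close>
      have px: "\<not> int p dvd x"
      proof
        assume x: "int p dvd x"
        then have "int p dvd a * x\<^sup>2" by (simp add: power2_eq_square)
        then have "int p dvd z\<^sup>2" using d1 by (metis dvd_diff_right_iff dvd_diff_left_iff)
        then have z: "int p dvd z" using pi prime_elem_dvd_power by blast
        have "int p ^ 2 dvd z\<^sup>2" "int p ^ 2 dvd a * x\<^sup>2" using x z by (auto intro: dvd_power_same)
        then have "int p ^ 2 dvd b * y\<^sup>2" using xyz(2)
          by (metis dvd_diff dvd_diff_right_iff)
        then have "int p dvd w * y\<^sup>2" using p unfolding b' by (auto simp: power2_eq_square mult.assoc)
        then have "int p dvd y" using pw pi by (metis prime_elem_dvd_mult_iff prime_elem_dvd_power)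
        then show False using xyz(1) x z by simp
      qed
      \<comment> \<open>Dividing z^2 = a x^2 by x^2 modulo p exhibits a as a square.\<close>
      then have "coprime (int p) x" using p by (simp add: prime_imp_coprime)
      then obtain x' where x': "[x * x' = 1] (mod int p)"
        using cong_solve_coprime_int[of x "int p"] by (auto simp: coprime_commute)
      have "[z\<^sup>2 = a * x\<^sup>2] (mod int p)" using d1 by (simp add: cong_iff_dvd_diff)
      then have "[z\<^sup>2 * x'\<^sup>2 = a * (x * x')\<^sup>2] (mod int p)"
        using cong_scalar_right[of "z\<^sup>2" "a * x\<^sup>2" "int p" "x'\<^sup>2"] by (simp add: power_mult_distrib mult_ac)
      moreover have "[a * (x * x')\<^sup>2 = a * 1\<^sup>2] (mod int p)" using x' by (intro cong_scalar_left cong_pow)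
      ultimately have "[(z * x')\<^sup>2 = a] (mod int p)" by (metis cong_trans mult.right_neutral one_power2 power_mult_distrib)
      then have "Legendre a p = 1" using a by (auto simp: Legendre_def QuadRes_def cong_0_iff)
      then show ?thesis using False a' 2 by (simp add: prime_symbol_def)
    qed
  qed
qed

text \<open>Only an even power of p is split off; other square factors of a stay in a'.\<close>

lemma squarefree_at_prime:
  assumes p: "prim p" and a: "a \<noteq> 0"
  obtains a' s where "a = a' * s\<^sup>2" "a' \<noteq> 0" "s \<noteq> 0" "multiplicity (int p) a' \<le> 1"
    "multiplicity (int p) a' = multiplicity (int p) a mod 2"
proof
  let ?k = "multiplicity (int p) a"
  let ?a' = "int p ^ (?k mod 2) * unit_part p a"
  show "a = ?a' * (int p ^ (?k div 2))\<^sup>2"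
    by (subst (1) unit_part_decomp[of a p]) (simp add: mult_ac flip: power_mult power_add)
  have p0: "int p \<noteq> 0" using p by auto
  then show "?a' \<noteq> 0" "int p ^ (?k div 2) \<noteq> 0" using unit_part_nonzero[OF a] by auto
  show "multiplicity (int p) ?a' = ?k mod 2"
    using unit_part_eqI(1)[OF p refl not_dvd_unit_part[OF p a]] .
  then show "multiplicity (int p) ?a' \<le> 1" by simp
qed

lemma not_dvd_if_multiplicity_0: "prim p \<Longrightarrow> a \<noteq> 0 \<Longrightarrow> multiplicity (int p) a = 0 \<Longrightarrow> \<not> int p dvd a"
  by (metis multiplicity_eq_zero_iff not_dvd_unit_part unit_part_decomp mult_1 power_0)

text \<open>An argument of even valuation can be replaced by a p-unit, and p^2 can be removed from
  the other one. If both valuations are odd, (a, b) = (a, -ab) and -ab has even valuation.\<close>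

lemma symbol_if_locally_soluble:
  assumes p: "prim p" and nz: "a \<noteq> 0" "b \<noteq> 0" and sol: "locally_soluble p a b"
  shows "symbol (Prime_Place p) a b = 1"
proof -
  let ?v = "Prime_Place p"
  have v: "?v \<in> places" using p by (simp add: places_def)
  have left: "symbol ?v a b = 1" if A: "a \<noteq> 0" "b \<noteq> 0" "locally_soluble p a b" "multiplicity (int p) a = 0" for a b
  proof -
    obtain b' s where b': "b = b' * s\<^sup>2" "b' \<noteq> 0" "s \<noteq> 0" "multiplicity (int p) b' \<le> 1"
      using squarefree_at_prime[OF p A(2)] by metis
    have "locally_soluble p a b'" using locally_soluble_square[OF p b'(3)] A(3) b'(1) by simp
    moreover have "\<not> int p dvd a" using not_dvd_if_multiplicity_0 p A by blast
    ultimately have "symbol ?v a b' = 1" using symbol_if_soluble_unit_left[OF p] b' by (simp add: symbol_def)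
    then show ?thesis using symbol_square_right[OF v A(1) b'(2,3)] b'(1) by simp
  qed
  have even: "symbol ?v a b = 1" if A: "a \<noteq> 0" "b \<noteq> 0" "locally_soluble p a b" "even (multiplicity (int p) a)" for a b
  proof -
    obtain a' s where a': "a = a' * s\<^sup>2" "a' \<noteq> 0" "s \<noteq> 0" "multiplicity (int p) a' = 0"
      using squarefree_at_prime[OF p A(1)] A(4) by (metis even_iff_mod_2_eq_zero)
    have "locally_soluble p a' b"
      using locally_soluble_square[OF p a'(3)] A(3) a'(1) locally_soluble_commute by metis
    then have "symbol ?v a' b = 1" using left a' A by blast
    then show ?thesis using symbol_square_right[OF v A(2) a'(2,3)] a'(1) symbol_commute by metis
  qed
  consider "even (multiplicity (int p) a)" | "even (multiplicity (int p) b)"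
    | "odd (multiplicity (int p) a)" "odd (multiplicity (int p) b)" by blast
  then show ?thesis
  proof cases
    case 1 then show ?thesis using even assms by blast
  next
    case 2 then show ?thesis using even[of b a] assms locally_soluble_commute symbol_commute by metis
  next
    case 3
    have "multiplicity (int p) (- a * b) = multiplicity (int p) a + multiplicity (int p) b"
      using unit_part_mult(1)[OF p, of "- a" b] nz by simp
    then have "symbol ?v (- a * b) a = 1"
      using even[of "- a * b" a] 3 nz locally_soluble_commute[OF locally_soluble_twist[OF p nz(1) sol]] by simp
    moreover have "symbol ?v a (- a * b) = symbol ?v a (- a) * symbol ?v a b"
      using symbol_mult_right[OF v nz(1), of "- a" b] nz by simp
    ultimately show ?thesis using symbol_neg_self[OF v nz(1)] symbol_commute by simp
  qed
qed

lemma symbol_if_soluble: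
  assumes v: "v \<in> places" and nz: "a \<noteq> 0" "b \<noteq> 0" and xyz: "(x, y, z) \<noteq> (0, 0, 0)" "z\<^sup>2 = a * x\<^sup>2 + b * y\<^sup>2"
  shows "symbol v a b = 1"
proof (cases v)
  case Real_Place
  have "\<not> (a < 0 \<and> b < 0)"
  proof
    assume ab: "a < 0 \<and> b < 0"
    then have "a * x\<^sup>2 \<le> 0" "b * y\<^sup>2 \<le> 0" by (simp_all add: mult_nonpos_nonneg)
    then have "a * x\<^sup>2 = 0 \<and> b * y\<^sup>2 = 0 \<and> z\<^sup>2 = 0" using xyz(2) zero_le_power2[of z] by linarith
    then show False using xyz(1) ab by auto
  qed
  then show ?thesis using Real_Place by (simp add: symbol_Real)
next
  case (Prime_Place p)
  then have "prim p" using v by (auto simp: places_def)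
  then show ?thesis
    using symbol_if_locally_soluble locally_soluble_if_globally_soluble xyz nz Prime_Place by blast
qed

section \<open>Descent for ternary forms\<close>

lemma root_mod_squarefree:
  fixes a b :: int
  assumes "squarefree b" "\<And>p. prim p \<Longrightarrow> int p dvd b \<Longrightarrow> \<exists>t. int p dvd t\<^sup>2 - a"
  shows "\<exists>t. b dvd t\<^sup>2 - a"
  using assms
proof (induction b rule: prime_divisors_induct)
  case (factor p x)
  obtain r where r: "p = int r" "prim r" using factor int_prime_cases by blast
  have "\<not> p dvd x"
  proof
    assume "p dvd x"
    then have "p\<^sup>2 dvd p * x" by (simp add: power2_eq_square)
    then show False using factor.prems(1) factor.hyps unfolding squarefree_def by auto
  qed
  then have sf: "squarefree x" "coprime p x"
    using squarefree_multD(2)[OF factor.prems(1)] factor.hyps prime_imp_coprime by blast+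
  have "\<exists>t. int s dvd t\<^sup>2 - a" if "prim s" "int s dvd x" for s using that factor.prems(2) by simp
  then obtain t where t: "x dvd t\<^sup>2 - a" using factor.IH[OF sf(1)] by blast
  obtain t' where t': "p dvd t'\<^sup>2 - a" using factor.prems(2)[of r] r by auto
  obtain w where w: "[w = t'] (mod p)" "[w = t] (mod x)"
    using binary_chinese_remainder_int[OF sf(2)] by blast
  have "[w\<^sup>2 = a] (mod p)" using cong_trans[OF cong_pow[OF w(1)]] t' by (simp add: cong_iff_dvd_diff)
  moreover have "[w\<^sup>2 = a] (mod x)" using cong_trans[OF cong_pow[OF w(2)]] t by (simp add: cong_iff_dvd_diff)
  ultimately have "p * x dvd w\<^sup>2 - a" using sf(2) by (intro divides_mult) (auto simp: cong_iff_dvd_diff)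
  then show ?case by blast
next
  case (unit x)
  then show ?case using unit_imp_dvd by blast
qed simp

lemma small_representative:
  fixes b t :: int assumes "b \<noteq> 0"
  obtains t' where "b dvd t' - t" "2 * \<bar>t'\<bar> \<le> \<bar>b\<bar>"
proof -
  define r where "r = t mod \<bar>b\<bar>"
  have r: "0 \<le> r" "r < \<bar>b\<bar>" using assms unfolding r_def by simp_all
  have d: "b dvd r - t" unfolding r_def by (metis abs_dvd_iff dvd_minus_mod dvd_diff_commute)
  have bb: "b dvd \<bar>b\<bar>" by simp
  show ?thesis
  proof (cases "2 * r \<le> \<bar>b\<bar>")
    case True then show ?thesis using that[of r] d r by simp
  next
    case False
    have "b dvd (r - t) - \<bar>b\<bar>" by (rule dvd_diff[OF d bb])
    then show ?thesis using that[of "r - \<bar>b\<bar>"] False r by (simp add: algebra_simps)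
  qed
qed

text \<open>Legendre's descent, arranged so that b has the larger absolute value. For squarefree b
  the local conditions make a a square modulo b, so t^2 - a = b b' with b' smaller than b. As b b'
  is a norm from the extension by the square root of a, the symbols (a, b) and (a, b') agree, and a
  solution for b' yields one for b.\<close>

theorem Hasse_Minkowski_ternary:
  fixes a b :: int
  assumes "a \<noteq> 0" "b \<noteq> 0" "\<And>v. v \<in> places \<Longrightarrow> symbol v a b = 1"
  shows "\<exists>x y z. (x, y, z) \<noteq> (0, 0, 0) \<and> z\<^sup>2 = a * x\<^sup>2 + b * y\<^sup>2"
  using assms
proof (induction "nat (\<bar>a\<bar> + \<bar>b\<bar>)" arbitrary: a b rule: less_induct)
  case less
  define Q where "Q = (\<lambda>a b. \<exists>x y z::int. (x, y, z) \<noteq> (0, 0, 0) \<and> z\<^sup>2 = a * x\<^sup>2 + b * y\<^sup>2)"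
  have Q_commute: "Q b a" if H: "Q a b" for a b
  proof -
    obtain x y z where "(x, y, z) \<noteq> (0, 0, 0)" "z\<^sup>2 = a * x\<^sup>2 + b * y\<^sup>2" using H unfolding Q_def by blast
    then show ?thesis unfolding Q_def by (intro exI[of _ y] exI[of _ x] exI[of _ z]) auto
  qed
  have main: "Q a b" if ab: "\<bar>a\<bar> \<le> \<bar>b\<bar>" and nz: "a \<noteq> 0" "b \<noteq> 0"
    and loc: "\<And>v. v \<in> places \<Longrightarrow> symbol v a b = 1"
    and IH: "\<And>b'. \<bar>b'\<bar> < \<bar>b\<bar> \<Longrightarrow> b' \<noteq> 0 \<Longrightarrow> (\<And>v. v \<in> places \<Longrightarrow> symbol v a b' = 1) \<Longrightarrow> Q a b'"
    for a b
  proof (cases "\<bar>b\<bar> = 1")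
    case True
    then have "\<bar>a\<bar> = 1" using ab nz by linarith
    moreover have "\<not> (a < 0 \<and> b < 0)" using loc[of Real_Place] by (auto simp: symbol_Real places_def split: if_splits)
    ultimately have "a = 1 \<or> b = 1" using True by linarith
    moreover have "Q 1 b" "Q a 1" for a b unfolding Q_def
      by (rule exI[of _ 1], rule exI[of _ 0], rule exI[of _ 1], simp)
        (rule exI[of _ 0], rule exI[of _ 1], rule exI[of _ 1], simp)
    ultimately show ?thesis by blast
  next
    case False
    then have b2: "\<bar>b\<bar> \<ge> 2" using nz by linarith
    show ?thesis
    proof (cases "squarefree b")
      case False
      then obtain s where s: "s\<^sup>2 dvd b" "\<not> is_unit s" unfolding squarefree_def by blast
      then obtain b' where b': "b = b' * s\<^sup>2" by (auto simp: dvd_def mult.commute)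
      have nz': "b' \<noteq> 0" "s \<noteq> 0" using b' nz by auto
      have "\<bar>s\<bar> \<ge> 2" using s(2) nz'(2) zdvd1_eq[of s] by linarith
      then have "s\<^sup>2 \<ge> 2\<^sup>2" by (metis abs_le_square_iff abs_numeral)
      then have "\<bar>b'\<bar> * 2 \<le> \<bar>b'\<bar> * s\<^sup>2" by (intro mult_left_mono) auto
      then have "\<bar>b'\<bar> < \<bar>b\<bar>" using nz' unfolding b' abs_mult by simp
      moreover have "symbol v a b' = 1" if "v \<in> places" for v
        using symbol_square_right[OF that nz(1) nz'] loc[OF that] b' by simp
      ultimately obtain x y z where xyz: "(x, y, z) \<noteq> (0, 0, 0)" "z\<^sup>2 = a * x\<^sup>2 + b' * y\<^sup>2"
        using IH nz' unfolding Q_def by blast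
      have "(s * z)\<^sup>2 = a * (s * x)\<^sup>2 + b * y\<^sup>2" unfolding b' power_mult_distrib xyz(2) by (simp add: algebra_simps)
      moreover have "(s * x, y, s * z) \<noteq> (0, 0, 0)" using xyz(1) nz' by auto
      ultimately show ?thesis unfolding Q_def by blast
    next
      case sf: True
      have "\<exists>t. int p dvd t\<^sup>2 - a" if p: "prim p" "int p dvd b" for p
      proof (cases "p = 2 \<or> int p dvd a")
        case True
        then show ?thesis
        proof
          assume "p = 2" then show ?thesis by (intro exI[of _ a]) simp
        next
          assume "int p dvd a" then show ?thesis by (intro exI[of _ 0]) simp
        qed
      next
        case False
        \<comment> \<open>For an odd prime dividing b exactly once and not dividing a, the symbol is
          \<open>Legendre a p\<close>.\<close>
        have "multiplicity (int p) b = 1"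
        proof (rule multiplicity_eqI)
          show "\<not> int p ^ Suc 1 dvd b"
            using sf p prime_gt_1_nat[of p] by (auto simp: squarefree_def power2_eq_square[symmetric])
        qed (use p in simp)
        then have "Legendre a p = 1"
          using loc[of "Prime_Place p"] p False unit_part_not_dvd[of p a]
          by (simp add: places_def symbol_def prime_symbol_def)
        then obtain y where "[y\<^sup>2 = a] (mod int p)" by (auto simp: Legendre_def QuadRes_def split: if_splits)
        then show ?thesis by (auto simp: cong_iff_dvd_diff)
      qed
      then obtain t0 where t0: "b dvd t0\<^sup>2 - a" using root_mod_squarefree[OF sf] by blast
      obtain t where t: "b dvd t - t0" "2 * \<bar>t\<bar> \<le> \<bar>b\<bar>" using small_representative[OF nz(2)] by blast
      have "[t\<^sup>2 = a] (mod b)" using cong_trans[OF cong_pow[of t t0 b 2]] t(1) t0 by (simp add: cong_iff_dvd_diff)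
      then obtain b' where b': "t\<^sup>2 - a = b * b'" by (auto simp: cong_iff_dvd_diff)
      show ?thesis
      proof (cases "b' = 0")
        case True
        then show ?thesis unfolding Q_def using b' by (intro exI[of _ 1] exI[of _ 0] exI[of _ t]) simp
      next
        case nz': False
        have "symbol v a b' = 1" if v: "v \<in> places" for v
        proof -
          have "symbol v a (b * b') = 1"
            using b' nz nz' by (intro symbol_if_soluble[OF v, of _ _ 1 1 t]) auto
          then show ?thesis using symbol_mult_right[OF v nz(1,2) nz'] loc[OF v] by simp
        qed
        moreover have "\<bar>b'\<bar> < \<bar>b\<bar>"
        proof -
          \<comment> \<open>From |t| at most |b|/2 and |a| at most |b| follows 4 |b'| at most |b| +
            4, which is less than 4 |b| because |b| is at least 2.\<close>
          have "(2 * \<bar>t\<bar>)\<^sup>2 \<le> \<bar>b\<bar>\<^sup>2" using t(2) by (intro power_mono) auto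
          then have "4 * t\<^sup>2 \<le> \<bar>b\<bar> * \<bar>b\<bar>" unfolding power_mult_distrib by (simp add: power2_eq_square)
          moreover have "\<bar>b * b'\<bar> \<le> t\<^sup>2 + \<bar>a\<bar>" unfolding b'[symmetric]
            using abs_triangle_ineq4[of "t\<^sup>2" a] by simp
          ultimately have "4 * \<bar>b * b'\<bar> \<le> \<bar>b\<bar> * \<bar>b\<bar> + 4 * \<bar>b\<bar>" using ab by linarith
          then have "\<bar>b\<bar> * (4 * \<bar>b'\<bar>) \<le> \<bar>b\<bar> * (\<bar>b\<bar> + 4)" by (simp add: algebra_simps abs_mult)
          then have "4 * \<bar>b'\<bar> \<le> \<bar>b\<bar> + 4" using nz by (simp add: mult_le_cancel_left)
          then show ?thesis using b2 by linarith
        qed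
        ultimately obtain x y z where xyz: "(x, y, z) \<noteq> (0, 0, 0)" "z\<^sup>2 = a * x\<^sup>2 + b' * y\<^sup>2"
          using IH nz' unfolding Q_def by blast
        \<comment> \<open>Multiplicativity of the norm: with r a square root of a, (t + r)(z + x r)
          = (t z + a x) + (t x + z) r.\<close>
        have "(t * z + a * x)\<^sup>2 - a * (t * x + z)\<^sup>2 = (t\<^sup>2 - a) * (z\<^sup>2 - a * x\<^sup>2)"
          by (simp add: power2_eq_square algebra_simps)
        also have "\<dots> = b * (b' * y)\<^sup>2" unfolding xyz(2) b' by (simp add: power2_eq_square algebra_simps)
        finally have "(t * z + a * x)\<^sup>2 = a * (t * x + z)\<^sup>2 + b * (b' * y)\<^sup>2" by simp
        moreover have "(t * x + z, b' * y, t * z + a * x) \<noteq> (0, 0, 0)"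
        proof
          assume "(t * x + z, b' * y, t * z + a * x) = (0, 0, 0)"
          then have e: "z = - t * x" "y = 0" "t * z + a * x = 0" using nz' by auto
          then have "(t\<^sup>2 - a) * x = 0" by (auto simp: power2_eq_square algebra_simps)
          then have "x = 0" using b' nz nz' by auto
          then show False using e xyz(1) by simp
        qed
        ultimately show ?thesis unfolding Q_def by blast
      qed
    qed
  qed
  have "Q a b"
  proof (cases "\<bar>a\<bar> \<le> \<bar>b\<bar>")
    case True
    show ?thesis
      by (rule main[OF True less.prems(1,2)]) (use less.prems less.hyps in \<open>auto simp: Q_def\<close>)
  next
    case False
    have "Q b a"
    proof (rule main)
      fix c assume c: "\<bar>c\<bar> < \<bar>a\<bar>" "c \<noteq> 0" "\<And>v. v \<in> places \<Longrightarrow> symbol v b c = 1"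
      show "Q b c" unfolding Q_def by (rule less.hyps) (use c less.prems in auto)
    qed (use False less.prems symbol_commute in auto)
    then show ?thesis by (rule Q_commute)
  qed
  then show ?case unfolding Q_def .
qed

text \<open>A subgroup of \<open>{\<plusminus>1}\<^sup>S\<close> is an intersection of kernels of characters, and a character is a product of
  coordinates over a subset of \<open>S\<close>.\<close>

lemma separating_subset:
  fixes e :: "'v \<Rightarrow> int"
  assumes "finite S" "\<And>f v. f \<in> W \<Longrightarrow> v \<in> S \<Longrightarrow> f v = 1 \<or> f v = - 1" "\<And>v. v \<in> S \<Longrightarrow> e v = 1 \<or> e v = - 1"
    "(\<lambda>_. 1) \<in> W" "\<And>f g. f \<in> W \<Longrightarrow> g \<in> W \<Longrightarrow> (\<lambda>v. f v * g v) \<in> W" "\<not> (\<exists>f\<in>W. \<forall>v\<in>S. f v = e v)"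
  shows "\<exists>T\<subseteq>S. (\<forall>f\<in>W. (\<Prod>v\<in>T. f v) = 1) \<and> (\<Prod>v\<in>T. e v) = - 1"
  using assms
proof (induction S arbitrary: W e rule: finite_induct)
  case (insert s S)
  have pm: "f v * f v = 1" if "f \<in> W" "v \<in> insert s S" for f v
    using insert.prems(1)[OF that] by auto
  define W0 where "W0 = {f \<in> W. f s = 1}"
  show ?case
  proof (cases "W0 = W")
    case True
    show ?thesis
    proof (cases "e s = 1")
      case False
      then have "e s = - 1" using insert.prems(2) by blast
      then show ?thesis using True by (intro exI[of _ "{s}"]) (auto simp: W0_def)
    next
      case es: True
      have "\<exists>T\<subseteq>S. (\<forall>f\<in>W. (\<Prod>v\<in>T. f v) = 1) \<and> (\<Prod>v\<in>T. e v) = - 1"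
      proof (rule insert.IH)
        show "\<not> (\<exists>f\<in>W. \<forall>v\<in>S. f v = e v)" using insert.prems(5) es True by (auto simp: W0_def)
      qed (use insert.prems in auto)
      then show ?thesis by blast
    qed
  next
    case False
    then obtain w where w: "w \<in> W" "w s = - 1" using insert.prems(1) unfolding W0_def by auto
    \<comment> \<open>If e is -1 at s it is multiplied by w, an element of \<open>W\<close>. This
      makes its value at s equal to 1 and does not affect whether it lies in the group.\<close>
    define e' where "e' = (\<lambda>v. if e s = 1 then e v else e v * w v)"
    have e's: "e' s = 1" using insert.prems(2)[of s] w by (auto simp: e'_def)
    have not: "\<not> (\<exists>f\<in>W. \<forall>v\<in>insert s S. f v = e' v)"
    proof (cases "e s = 1")
      case True then show ?thesis using insert.prems(5) by (simp add: e'_def)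
    next
      case False
      show ?thesis
      proof
        assume "\<exists>f\<in>W. \<forall>v\<in>insert s S. f v = e' v"
        then obtain f where f: "f \<in> W" "\<forall>v\<in>insert s S. f v = e v * w v" using False by (auto simp: e'_def)
        then have "\<forall>v\<in>insert s S. f v * w v = e v" using pm[OF w(1)] by (simp add: mult.assoc)
        then show False using insert.prems(4)[OF f(1) w(1)] insert.prems(5) by (metis (no_types, lifting))
      qed
    qed
    have "\<exists>T\<subseteq>S. (\<forall>f\<in>W0. (\<Prod>v\<in>T. f v) = 1) \<and> (\<Prod>v\<in>T. e' v) = - 1"
    proof (rule insert.IH)
      show "\<not> (\<exists>f\<in>W0. \<forall>v\<in>S. f v = e' v)" using not e's by (auto simp: W0_def)
      show "e' v = 1 \<or> e' v = - 1" if "v \<in> S" for v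
        using insert.prems(2)[of v] insert.prems(1)[OF w(1), of v] that by (auto simp: e'_def)
    qed (use insert.prems in \<open>auto simp: W0_def\<close>)
    then obtain T0 where T0: "T0 \<subseteq> S" "\<forall>f\<in>W0. (\<Prod>v\<in>T0. f v) = 1" "(\<Prod>v\<in>T0. e' v) = - 1" by blast
    have fin: "finite T0" "s \<notin> T0" using T0(1) insert.hyps finite_subset by auto
    have pmT: "(\<Prod>v\<in>T0. w v) = 1 \<or> (\<Prod>v\<in>T0. w v) = - 1"
    proof -
      have "(\<Prod>v\<in>T0. w v) * (\<Prod>v\<in>T0. w v) = (\<Prod>v\<in>T0. w v * w v)" by (simp add: prod.distrib)
      also have "\<dots> = 1" using pm[OF w(1)] T0(1) by (intro prod.neutral) auto
      finally show ?thesis by (simp add: square_eq_1_iff)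
    qed
    \<comment> \<open>The coordinate s is added precisely when the product of w over
      \<open>T0\<close> is -1. Since w is -1 at s, its product over \<open>T\<close> becomes 1,
      while elements of \<open>W0\<close> are unaffected.\<close>
    define T where "T = (if (\<Prod>v\<in>T0. w v) = 1 then T0 else insert s T0)"
    have T: "(\<Prod>v\<in>T. f v) = (\<Prod>v\<in>T0. f v) * (if (\<Prod>v\<in>T0. w v) = 1 then 1 else f s)" for f :: "'v \<Rightarrow> int"
      using fin by (simp add: T_def)
    have Tw: "(\<Prod>v\<in>T. w v) = 1" unfolding T using pmT w(2) by auto
    have TW: "(\<Prod>v\<in>T. f v) = 1" if f: "f \<in> W" for f
    proof (cases "f s = 1")
      case True
      then have "f \<in> W0" using f by (simp add: W0_def)
      then show ?thesis unfolding T using T0(2) True by simp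
    next
      case False
      then have "(\<lambda>v. f v * w v) \<in> W0" using f w insert.prems(1)[OF f] insert.prems(4) by (auto simp: W0_def)
      then have "(\<Prod>v\<in>T. f v * w v) = 1" unfolding T using T0(2) False insert.prems(1)[OF f] w(2) by fastforce
      then show ?thesis using Tw by (simp add: prod.distrib)
    qed
    have "(\<Prod>v\<in>T. e' v) = - 1" unfolding T using T0(3) e's by simp
    then have "(\<Prod>v\<in>T. e v) = - 1" using Tw by (cases "e s = 1") (simp_all add: e'_def prod.distrib)
    moreover have "T \<subseteq> insert s S" using T0(1) by (auto simp: T_def)
    ultimately show ?thesis using TW by blast
  qed
qed auto

text \<open>An additive map on the integers is determined by its value at 1. This identifies the
  image of an integer in each base ring.\<close>

lemma (in abelian_group) add_pow_int_additive:
  fixes h :: "int \<Rightarrow> 'a"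
  assumes closed: "\<And>k. h k \<in> carrier G" and add: "\<And>k l. h (k + l) = h k \<oplus> h l"
  shows "[k] \<cdot> h 1 = h k"
proof (induction k rule: int_induct[of _ 0])
  case base
  have "h 0 \<oplus> h 0 = h 0" using add[of 0 0] by simp
  then have "h 0 = \<zero>" using closed[of 0] by (metis add.l_cancel_one')
  then show ?case by (simp add: add_pow_int_ge)
next
  case (step1 i)
  have "[(i + 1)] \<cdot> h 1 = [i] \<cdot> h 1 \<oplus> h 1" using add.int_pow_mult[of "h 1" i 1] closed by simp
  then show ?case using step1 add by simp
next
  case (step2 i)
  have "[(i - 1 + 1)] \<cdot> h 1 = [(i - 1)] \<cdot> h 1 \<oplus> h 1" using add.int_pow_mult[of "h 1" "i - 1" 1] closed by simp
  then have "[(i - 1)] \<cdot> h 1 \<oplus> h 1 = h (i - 1) \<oplus> h 1" using step2 add[of "i - 1" 1] by simp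
  then show ?case using closed by (simp add: add.int_pow_closed)
qed

lemma (in ring) add_pow_int_eqI:
  fixes h :: "int \<Rightarrow> 'a"
  assumes "\<And>k. h k \<in> carrier R" "h 1 = \<one>" "\<And>k l. h (k + l) = h k \<oplus> h l"
  shows "[k] \<cdot> \<one> = h k"
  using add_pow_int_additive[of h k] assms by simp

section \<open>The field of \<open>p\<close>-adic numbers\<close>

locale padic =
  fixes p :: nat
  assumes prime: "prim p"
begin

abbreviation "absp \<equiv> padic_abs p"

section \<open>The p-adic absolute value on the rationals\<close>

lemma p_gt_1: "1 < real p" using prime_gt_1_nat[OF prime] by simp

text \<open>\<open>padic_abs\<close> is defined on lowest terms. Any other fraction gives the same
  difference of valuations, by cross-multiplication.\<close>

lemma absp_frac:
  assumes "k \<noteq> 0" "l \<noteq> 0"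
  shows "absp (of_int k / of_int l) = real p powi (int (multiplicity (int p) l) - int (multiplicity (int p) k))"
proof -
  obtain k' l' where q: "quotient_of (of_int k / of_int l) = (k', l')" by (cases "quotient_of (of_int k / of_int l)")
  have l': "l' \<noteq> 0" using quotient_of_denom_pos[OF q] by simp
  have "(of_int k / of_int l :: rat) = of_int k' / of_int l'" using quotient_of_div[OF q] .
  then have "(of_int (k * l') :: rat) = of_int (k' * l)" using assms l' by (simp add: field_simps)
  then have eq: "k * l' = k' * l" by (simp only: of_int_eq_iff)
  have k': "k' \<noteq> 0" using eq assms l' by auto
  have "multiplicity (int p) k + multiplicity (int p) l' = multiplicity (int p) k' + multiplicity (int p) l"
    using arg_cong[OF eq, of "multiplicity (int p)"] assms l' k' by (simp add: unit_part_mult(1)[OF prime])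
  then have "int (multiplicity (int p) l') - int (multiplicity (int p) k') = int (multiplicity (int p) l) - int (multiplicity (int p) k)"
    by linarith
  then show ?thesis using q assms by (simp add: padic_abs_def)
qed

lemma absp_0 [simp]: "absp 0 = 0" by (simp add: padic_abs_def)

lemma rat_frac: obtains k l :: int where "(r::rat) = of_int k / of_int l" "l \<noteq> 0"
proof -
  obtain k l where q: "quotient_of r = (k, l)" by (cases "quotient_of r")
  show ?thesis using quotient_of_div[OF q] quotient_of_denom_pos[OF q] by (intro that[of k l]) auto
qed

lemma absp_pos: "r \<noteq> 0 \<Longrightarrow> 0 < absp r"
proof -
  assume r: "r \<noteq> 0"
  obtain k l where kl: "r = of_int k / of_int l" "l \<noteq> 0" using rat_frac .
  then have "k \<noteq> 0" using r by auto
  then show ?thesis unfolding kl(1) absp_frac[OF \<open>k \<noteq> 0\<close> kl(2)] using p_gt_1 by (intro zero_less_power_int) simp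
qed

lemma absp_nonneg [simp]: "0 \<le> absp r" using absp_pos[of r] by (cases "r = 0") auto

lemma absp_eq_0 [simp]: "absp r = 0 \<longleftrightarrow> r = 0" by (metis absp_0 absp_pos less_irrefl)

lemma absp_mult: "absp (r * s) = absp r * absp s"
proof (cases "r = 0 \<or> s = 0")
  case False
  obtain k l where kl: "r = of_int k / of_int l" "l \<noteq> 0" using rat_frac .
  obtain k' l' where kl': "s = of_int k' / of_int l'" "l' \<noteq> 0" using rat_frac .
  have nz: "k \<noteq> 0" "k' \<noteq> 0" using False kl(1) kl'(1) by auto
  have "r * s = of_int (k * k') / of_int (l * l')" using kl(1) kl'(1) by simp
  then have "absp (r * s) = real p powi (int (multiplicity (int p) (l * l')) - int (multiplicity (int p) (k * k')))"
    using nz kl(2) kl'(2) by (simp only: absp_frac mult_eq_0_iff simp_thms)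
  also have "\<dots> = real p powi ((int (multiplicity (int p) l) - int (multiplicity (int p) k)) +
      (int (multiplicity (int p) l') - int (multiplicity (int p) k')))"
    using nz kl(2) kl'(2) by (simp add: unit_part_mult(1)[OF prime] algebra_simps)
  also have "\<dots> = absp r * absp s"
    unfolding kl(1) kl'(1) absp_frac[OF nz(1) kl(2)] absp_frac[OF nz(2) kl'(2)]
    using p_gt_1 by (intro power_int_add) simp
  finally show ?thesis .
qed auto

lemma absp_power: "absp (r ^ n) = absp r ^ n"
proof (induction n)
  case 0
  have "absp 1 * absp 1 = absp 1" using absp_mult[of 1 1] by simp
  then show ?case by simp
qed (simp add: absp_mult)

lemma absp_1 [simp]: "absp 1 = 1" using absp_power[of 1 0] by simp

lemma absp_minus [simp]: "absp (- r) = absp r"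
proof -
  have "absp (-1) ^ 2 = 1" using absp_power[of "-1" 2] by simp
  then have "absp (-1) = 1" using absp_nonneg[of "-1"] by (simp add: power2_eq_1_iff)
  then show ?thesis using absp_mult[of "-1" r] by simp
qed

lemma absp_inverse: "absp (1 / r) = 1 / absp r"
proof (cases "r = 0")
  case False
  then have "absp (1 / r) * absp r = 1" by (simp flip: absp_mult)
  then show ?thesis using False by (simp add: field_simps)
qed simp

lemma absp_divide: "absp (r / s) = absp r / absp s"
  using absp_mult[of r "1 / s"] absp_inverse[of s] by simp

lemma absp_int:
  assumes "k \<noteq> 0" shows "absp (of_int k) = (1 / real p) ^ multiplicity (int p) k"
proof -
  have "absp (of_int k) = absp (of_int k / of_int 1)" by simp
  also have "\<dots> = real p powi (int (multiplicity (int p) 1) - int (multiplicity (int p) k))"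
    using assms by (intro absp_frac) auto
  also have "\<dots> = inverse (real p powi int (multiplicity (int p) k))"
    by (simp only: multiplicity_one of_nat_0 diff_0 power_int_minus)
  also have "\<dots> = (1 / real p) ^ multiplicity (int p) k"
    by (simp only: power_int_of_nat inverse_eq_divide power_one_over)
  finally show ?thesis .
qed

text \<open>The dictionary between congruences and sizes; for k = 0 both sides hold.\<close>

lemma absp_int_le_iff: "absp (of_int k) \<le> (1 / real p) ^ n \<longleftrightarrow> int p ^ n dvd k"
proof (cases "k = 0")
  case False
  have "absp (of_int k) \<le> (1 / real p) ^ n \<longleftrightarrow> n \<le> multiplicity (int p) k"
    unfolding absp_int[OF False] using p_gt_1 by (intro power_decreasing_iff) auto
  also have "\<dots> \<longleftrightarrow> int p ^ n dvd k"
    using power_dvd_iff_le_multiplicity[of k "int p" n] False prime_gt_1_nat[OF prime] by auto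
  finally show ?thesis .
qed (use p_gt_1 in simp)

lemma absp_int_le_1: "absp (of_int k) \<le> 1" using absp_int_le_iff[of k 0] by simp

lemma absp_int_eq_1: "\<not> int p dvd k \<Longrightarrow> absp (of_int k) = 1"
  using absp_int[of k] unit_part_not_dvd[OF prime, of k] by (cases "k = 0") auto

lemma absp_int_add_le: "absp (of_int (k + l)) \<le> max (absp (of_int k)) (absp (of_int l))"
proof (cases "k = 0 \<or> l = 0")
  case False
  have "absp (of_int (k + l)) \<le> (1 / real p) ^ min (multiplicity (int p) k) (multiplicity (int p) l)"
    unfolding absp_int_le_iff by (intro dvd_add; rule multiplicity_dvd') simp_all
  also have "\<dots> = max (absp (of_int k)) (absp (of_int l))"
    using False p_gt_1 by (auto simp: absp_int min_def max_def power_decreasing_iff)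
  finally show ?thesis .
qed auto

lemma absp_add_le_max: "absp (r + s) \<le> max (absp r) (absp s)"
proof -
  obtain k l where kl: "r = of_int k / of_int l" "l \<noteq> 0" using rat_frac .
  obtain k' l' where kl': "s = of_int k' / of_int l'" "l' \<noteq> 0" using rat_frac .
  have e: "r + s = of_int (k * l' + k' * l) / of_int (l * l')" "r = of_int (k * l') / of_int (l * l')"
    "s = of_int (k' * l) / of_int (l * l')" using kl kl' by (simp_all add: field_simps)
  let ?D = "absp (of_int (l * l'))"
  have "absp (of_int (k * l' + k' * l)) / ?D \<le> max (absp (of_int (k * l'))) (absp (of_int (k' * l))) / ?D"
    by (rule divide_right_mono[OF absp_int_add_le absp_nonneg])
  also have "\<dots> = max (absp (of_int (k * l')) / ?D) (absp (of_int (k' * l)) / ?D)"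
    by (simp only: max_divide_distrib_right absp_nonneg if_True)
  finally show ?thesis unfolding absp_divide[symmetric] e(1)[symmetric] e(2)[symmetric] e(3)[symmetric] .
qed

lemma absp_add_le: "absp r \<le> e \<Longrightarrow> absp s \<le> e \<Longrightarrow> absp (r + s) \<le> e"
  using absp_add_le_max[of r s] by linarith

lemma absp_add_less: "absp r < e \<Longrightarrow> absp s < e \<Longrightarrow> absp (r + s) < e"
  using absp_add_le_max[of r s] by linarith

lemma absp_diff_less: "absp r < e \<Longrightarrow> absp s < e \<Longrightarrow> absp (r - s) < e"
  using absp_add_less[of r e "- s"] by simp

section \<open>Cauchy sequences and null sequences\<close>

definition cauchy :: "(nat \<Rightarrow> rat) \<Rightarrow> bool"
  where "cauchy x \<longleftrightarrow> (\<forall>e>0. \<exists>N. \<forall>m\<ge>N. \<forall>n\<ge>N. absp (x m - x n) < e)"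

definition null :: "(nat \<Rightarrow> rat) \<Rightarrow> bool"
  where "null x \<longleftrightarrow> (\<lambda>n. absp (x n)) \<longlonglongrightarrow> 0"

lemma cauchy_const: "cauchy (\<lambda>_. r)" by (simp add: cauchy_def)

lemma null_def': "null x \<longleftrightarrow> (\<forall>e>0. \<exists>N. \<forall>n\<ge>N. absp (x n) < e)"
  unfolding null_def LIMSEQ_iff by simp

lemma null_const: "null (\<lambda>_. r) \<longleftrightarrow> r = 0"
  unfolding null_def by (simp add: LIMSEQ_const_iff)

lemma cauchy_bounded:
  assumes "cauchy x" obtains B where "B > 0" "\<And>n. absp (x n) \<le> B"
proof -
  obtain N where N: "\<forall>m\<ge>N. \<forall>n\<ge>N. absp (x m - x n) < 1" using assms unfolding cauchy_def by (metis zero_less_one)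
  define B where "B = Max ((\<lambda>n. absp (x n)) ` {..N}) + 1"
  have b: "absp (x n) \<le> Max ((\<lambda>n. absp (x n)) ` {..N})" if "n \<le> N" for n
    using that by (intro Max_ge) auto
  have M0: "0 \<le> Max ((\<lambda>n. absp (x n)) ` {..N})" using order_trans[OF absp_nonneg b[of 0]] by simp
  have "absp (x n) \<le> B" for n
  proof (cases "n \<le> N")
    case True then show ?thesis using b[OF True] unfolding B_def by linarith
  next
    case False
    then have "absp (x n - x N) < 1" using N by simp
    then have "absp ((x n - x N) + x N) \<le> B"
      using b[of N] M0 unfolding B_def by (intro absp_add_le) linarith+
    then show ?thesis by simp
  qed
  then show ?thesis using that[of B] M0 B_def by auto
qed

lemma null_imp_cauchy: "null x \<Longrightarrow> cauchy x"
  unfolding null_def' cauchy_def by (meson absp_diff_less)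

lemma null_add: "null x \<Longrightarrow> null y \<Longrightarrow> null (\<lambda>n. x n + y n)"
  unfolding null_def'
proof (intro allI impI)
  fix e :: real assume e: "\<forall>e>0. \<exists>N. \<forall>n\<ge>N. absp (x n) < e" "\<forall>e>0. \<exists>N. \<forall>n\<ge>N. absp (y n) < e" "e > 0"
  then obtain N M where "\<forall>n\<ge>N. absp (x n) < e" "\<forall>n\<ge>M. absp (y n) < e" by metis
  then show "\<exists>N. \<forall>n\<ge>N. absp (x n + y n) < e" by (intro exI[of _ "max N M"]) (auto intro: absp_add_less)
qed

lemma null_uminus: "null (\<lambda>n. - x n) \<longleftrightarrow> null x" by (simp add: null_def)

lemma null_diff: "null x \<Longrightarrow> null y \<Longrightarrow> null (\<lambda>n. x n - y n)"
  using null_add[of x "\<lambda>n. - y n"] by (simp add: null_uminus)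

lemma cauchy_add: "cauchy x \<Longrightarrow> cauchy y \<Longrightarrow> cauchy (\<lambda>n. x n + y n)"
  unfolding cauchy_def
proof (intro allI impI)
  fix e :: real assume e: "\<forall>e>0. \<exists>N. \<forall>m\<ge>N. \<forall>n\<ge>N. absp (x m - x n) < e" "\<forall>e>0. \<exists>N. \<forall>m\<ge>N. \<forall>n\<ge>N. absp (y m - y n) < e" "e > 0"
  then obtain N M where NM: "\<forall>m\<ge>N. \<forall>n\<ge>N. absp (x m - x n) < e" "\<forall>m\<ge>M. \<forall>n\<ge>M. absp (y m - y n) < e" by metis
  have "absp (x m + y m - (x n + y n)) < e" if "m \<ge> max N M" "n \<ge> max N M" for m n
    using absp_add_less[of "x m - x n" e "y m - y n"] NM that by (simp add: algebra_simps)
  then show "\<exists>N. \<forall>m\<ge>N. \<forall>n\<ge>N. absp (x m + y m - (x n + y n)) < e" by blast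
qed

lemma cauchy_uminus: "cauchy x \<Longrightarrow> cauchy (\<lambda>n. - x n)"
proof -
  have "absp (- x m - - x n) = absp (x m - x n)" for m n
    using absp_minus[of "x m - x n"] by (simp add: algebra_simps)
  then show "cauchy x \<Longrightarrow> cauchy (\<lambda>n. - x n)" unfolding cauchy_def by presburger
qed

lemma cauchy_mult: assumes "cauchy x" "cauchy y" shows "cauchy (\<lambda>n. x n * y n)"
  unfolding cauchy_def
proof (intro allI impI)
  fix e :: real assume e: "e > 0"
  obtain A where A: "A > 0" "\<And>n. absp (x n) \<le> A" using cauchy_bounded[OF assms(1)] by blast
  obtain B where B: "B > 0" "\<And>n. absp (y n) \<le> B" using cauchy_bounded[OF assms(2)] by blast
  obtain N where N: "\<forall>m\<ge>N. \<forall>n\<ge>N. absp (x m - x n) < e / B"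
    using assms(1) divide_pos_pos[OF e B(1)] unfolding cauchy_def by blast
  obtain M where M: "\<forall>m\<ge>M. \<forall>n\<ge>M. absp (y m - y n) < e / A"
    using assms(2) divide_pos_pos[OF e A(1)] unfolding cauchy_def by blast
  have "absp (x m * y m - x n * y n) < e" if "m \<ge> max N M" "n \<ge> max N M" for m n
  proof -
    have "absp (x m) * absp (y m - y n) \<le> A * absp (y m - y n)" using A by (intro mult_right_mono) auto
    also have "\<dots> < A * (e / A)" using M that A by (intro mult_strict_left_mono) auto
    finally have 1: "absp (x m * (y m - y n)) < e" using A by (simp add: absp_mult)
    have "absp (x m - x n) * absp (y n) \<le> absp (x m - x n) * B" using B by (intro mult_left_mono) auto
    also have "\<dots> < (e / B) * B" using N that B by (intro mult_strict_right_mono) auto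
    finally have 2: "absp ((x m - x n) * y n) < e" using B by (simp add: absp_mult)
    show ?thesis using absp_add_less[OF 1 2] by (simp add: algebra_simps)
  qed
  then show "\<exists>N. \<forall>m\<ge>N. \<forall>n\<ge>N. absp (x m * y m - x n * y n) < e" by blast
qed

lemma null_mult: assumes "cauchy x" "null y" shows "null (\<lambda>n. x n * y n)"
proof -
  obtain A where A: "A > 0" "\<And>n. absp (x n) \<le> A" using cauchy_bounded[OF assms(1)] by blast
  have lim: "(\<lambda>n. A * absp (y n)) \<longlonglongrightarrow> 0"
    using assms(2) unfolding null_def by (rule tendsto_mult_right_zero)
  show ?thesis unfolding null_def
  proof (rule tendsto_sandwich[OF _ _ tendsto_const])
    have "absp (x n * y n) \<le> A * absp (y n)" for n
      unfolding absp_mult by (rule mult_right_mono[OF A(2) absp_nonneg])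
    then show "\<forall>\<^sub>F n in sequentially. absp (x n * y n) \<le> A * absp (y n)" by (intro always_eventually allI)
  qed (use lim in simp_all)
qed

lemma null_mult': "null x \<Longrightarrow> cauchy y \<Longrightarrow> null (\<lambda>n. x n * y n)"
  using null_mult[of y x] by (simp add: mult.commute)

lemma cauchy_null_close:
  assumes "cauchy x" "null (\<lambda>n. y n - x n)" shows "cauchy y"
  using cauchy_add[OF assms(1) null_imp_cauchy[OF assms(2)]] by simp

section \<open>The quotient ring of p-adic numbers\<close>

abbreviation "C \<equiv> padic_cauchy_ring p"
abbreviation "I \<equiv> padic_null p"
abbreviation "Q \<equiv> padic_field p"

lemma carrier_C: "x \<in> carrier C \<longleftrightarrow> cauchy x" by (simp add: padic_cauchy_ring_def cauchy_def)

lemma C_simps [simp]: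
  "x \<otimes>\<^bsub>C\<^esub> y = (\<lambda>n. x n * y n)" "x \<oplus>\<^bsub>C\<^esub> y = (\<lambda>n. x n + y n)" "\<one>\<^bsub>C\<^esub> = (\<lambda>_. 1)" "\<zero>\<^bsub>C\<^esub> = (\<lambda>_. 0)"
  by (simp_all add: padic_cauchy_ring_def)

lemma mem_I: "x \<in> I \<longleftrightarrow> null x" by (simp add: padic_null_def null_def)

lemma cring_C: "cring C"
proof (rule cringI)
  show "abelian_group C"
  proof (rule abelian_groupI)
    fix x assume x: "x \<in> carrier C"
    show "\<exists>y\<in>carrier C. y \<oplus>\<^bsub>C\<^esub> x = \<zero>\<^bsub>C\<^esub>"
      by (rule bexI[of _ "\<lambda>n. - x n"]) (use x in \<open>auto simp: carrier_C cauchy_uminus\<close>)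
  qed (auto simp: carrier_C cauchy_add cauchy_const algebra_simps)
  show "Group.comm_monoid C"
    by (rule comm_monoidI) (auto simp: carrier_C cauchy_mult cauchy_const algebra_simps)
qed (auto simp: algebra_simps)

sublocale C: cring C by (rule cring_C)

lemma ideal_I: "ideal I C"
proof (rule idealI)
  show "subgroup I (add_monoid C)"
  proof (rule group.subgroupI[OF C.a_group])
    show "I \<subseteq> carrier (add_monoid C)" by (auto simp: mem_I carrier_C null_imp_cauchy)
    show "I \<noteq> {}" using null_const[of 0] mem_I by blast
  next
    fix x assume x: "x \<in> I"
    have "inv\<^bsub>add_monoid C\<^esub> x = (\<lambda>n. - x n)"
      by (rule group.inv_equality[OF C.a_group]) (use x in \<open>auto simp: mem_I carrier_C cauchy_uminus null_imp_cauchy\<close>)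
    then show "inv\<^bsub>add_monoid C\<^esub> x \<in> I" using x by (simp add: mem_I null_uminus)
  qed (auto simp: mem_I null_add)
qed (auto simp: mem_I carrier_C null_mult null_mult' cring_C C.ring_axioms)

sublocale I: ideal I C by (rule ideal_I)

lemma cring_Q: "cring Q" unfolding padic_field_def by (rule I.quotient_is_cring[OF cring_C])

sublocale Q: cring Q by (rule cring_Q)

definition cls :: "(nat \<Rightarrow> rat) \<Rightarrow> (nat \<Rightarrow> rat) set" where "cls x = I +>\<^bsub>C\<^esub> x"

lemma cls_hom: "ring_hom_ring C Q cls"
  using I.rcos_ring_hom_ring unfolding padic_field_def cls_def[abs_def] by simp

sublocale H: ring_hom_ring C Q cls by (rule cls_hom)

lemma carrier_Q: "carrier Q = cls ` {x. cauchy x}"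
  unfolding padic_field_def FactRing_def A_RCOSETS_def' cls_def by (auto simp: carrier_C)

lemma mem_cls: "y \<in> cls x \<longleftrightarrow> null (\<lambda>n. y n - x n)"
proof -
  have "y \<in> cls x \<longleftrightarrow> (\<exists>h. null h \<and> y = (\<lambda>n. h n + x n))"
    unfolding cls_def a_r_coset_def' by (simp only: UN_iff singleton_iff mem_I Bex_def C_simps)
  also have "\<dots> \<longleftrightarrow> null (\<lambda>n. y n - x n)"
  proof
    assume "null (\<lambda>n. y n - x n)"
    then show "\<exists>h. null h \<and> y = (\<lambda>n. h n + x n)" by (intro exI[of _ "\<lambda>n. y n - x n"]) simp
  next
    assume "\<exists>h. null h \<and> y = (\<lambda>n. h n + x n)"
    then obtain h where "null h" "\<And>n. y n - x n = h n" by (metis add_diff_cancel_right')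
    then show "null (\<lambda>n. y n - x n)" by simp
  qed
  finally show ?thesis .
qed

lemma cls_eq_iff: "cauchy x \<Longrightarrow> cauchy y \<Longrightarrow> cls x = cls y \<longleftrightarrow> null (\<lambda>n. x n - y n)"
proof -
  assume xy: "cauchy x" "cauchy y"
  have "null (\<lambda>n. x n - y n)" if "cls x = cls y"
    using mem_cls[of x x] mem_cls[of x y] that null_const[of 0] by simp
  moreover have "cls x = cls y" if "null (\<lambda>n. x n - y n)"
  proof (rule Set.set_eqI)
    fix z
    show "z \<in> cls x \<longleftrightarrow> z \<in> cls y"
      unfolding mem_cls
      using null_add[OF _ that, of "\<lambda>n. z n - x n"] null_diff[OF _ that, of "\<lambda>n. z n - y n"] by auto
  qed
  ultimately show ?thesis by blast
qed

lemma cls_mult: "cauchy x \<Longrightarrow> cauchy y \<Longrightarrow> cls x \<otimes>\<^bsub>Q\<^esub> cls y = cls (\<lambda>n. x n * y n)"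
  using H.hom_mult[of x y] by (simp add: carrier_C)

lemma cls_add: "cauchy x \<Longrightarrow> cauchy y \<Longrightarrow> cls x \<oplus>\<^bsub>Q\<^esub> cls y = cls (\<lambda>n. x n + y n)"
  using H.hom_add[of x y] by (simp add: carrier_C)

lemma cls_one: "\<one>\<^bsub>Q\<^esub> = cls (\<lambda>_. 1)" and cls_zero: "\<zero>\<^bsub>Q\<^esub> = cls (\<lambda>_. 0)"
  using H.hom_one H.hom_zero by simp_all

lemma cls_closed: "cauchy x \<Longrightarrow> cls x \<in> carrier Q" by (auto simp: carrier_Q)

lemma cls_uminus: "cauchy x \<Longrightarrow> \<ominus>\<^bsub>Q\<^esub> cls x = cls (\<lambda>n. - x n)"
  by (rule Q.minus_equality) (auto simp: cls_closed cauchy_uminus cls_add cls_zero)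

lemma cls_minus: "cauchy x \<Longrightarrow> cauchy y \<Longrightarrow> cls x \<ominus>\<^bsub>Q\<^esub> cls y = cls (\<lambda>n. x n - y n)"
  unfolding a_minus_def by (simp add: cls_uminus cls_add cauchy_uminus)

end

text \<open>Hensel's criterion for a nonzero square of the completion. It only involves a parity, a
  sign and residues, which values of \<open>symbol\<close> can detect.\<close>

definition local_square :: "place \<Rightarrow> int \<Rightarrow> bool"
  where "local_square v w \<longleftrightarrow> w \<noteq> 0 \<and> (case v of
    Real_Place \<Rightarrow> 0 < w
  | Prime_Place p \<Rightarrow> even (multiplicity (int p) w) \<and>
      (if p = 2 then unit_part p w mod 8 = 1 else QuadRes p (unit_part p w)))"

lemma local_square_unit:
  assumes "prim p" "\<not> int p dvd w"
  shows "local_square (Prime_Place p) w \<longleftrightarrow> (if p = 2 then w mod 8 = 1 else QuadRes p w)"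
  using unit_part_not_dvd[OF assms] assms by (auto simp: local_square_def)

text \<open>Hensel lifting carried out with integers. The second property makes the approximations a
  Cauchy sequence.\<close>

lemma sqrt_approximations:
  fixes u :: int
  assumes p: "prim p" and nd: "\<not> int p dvd u" and sq: "if p = 2 then u mod 8 = 1 else QuadRes p u"
  shows "\<exists>s::nat \<Rightarrow> int. \<forall>n. int p ^ n dvd (s n)\<^sup>2 - u \<and> int p ^ n dvd s (Suc n) - s n"
proof (cases "p = 2")
  case True
  \<comment> \<open>At 2 the derivative 2 s loses a factor 2. With error 2^(n+3) c, adding 2^(n+2) c
    to s changes the square by 2^(n+3) s c up to higher order, and c + s c is even because s is
    odd.\<close>
  have "\<exists>s::nat \<Rightarrow> int. \<forall>n. 2 ^ (n + 3) dvd (s n)\<^sup>2 - u \<and> 2 ^ n dvd s (Suc n) - s n"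
  proof (rule dependent_nat_choice)
    have "8 dvd u - 1" using sq True mod_eq_dvd_iff[of u 8 1] by simp
    then have "8 dvd 1 - u" by presburger
    then show "\<exists>x::int. 2 ^ (0 + 3) dvd x\<^sup>2 - u" by (intro exI[of _ 1]) simp
  next
    fix s :: int and n assume s: "2 ^ (n + 3) dvd s\<^sup>2 - u"
    then obtain c where c: "s\<^sup>2 - u = 2 ^ (n + 3) * c" by (auto simp: dvd_def)
    have "even (s\<^sup>2 - u)" using s by (rule dvd_trans[rotated]) simp
    then have "odd s" using nd True by simp
    then have "even (c + s * c)" by simp
    then obtain j where j: "c + s * c = 2 * j" by (elim evenE)
    have "(s + 2 ^ (n + 2) * c)\<^sup>2 - u = (s\<^sup>2 - u) + 2 ^ (n + 3) * (s * c) + 2 ^ (n + 4) * (2 ^ n * c\<^sup>2)"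
      by (simp add: power2_eq_square power_add algebra_simps)
    also have "\<dots> = 2 ^ (n + 3) * (c + s * c) + 2 ^ (n + 4) * (2 ^ n * c\<^sup>2)" unfolding c by (simp add: algebra_simps)
    also have "\<dots> = 2 ^ (n + 4) * (j + 2 ^ n * c\<^sup>2)" unfolding j by (simp add: power_add algebra_simps)
    finally have "2 ^ (Suc n + 3) dvd (s + 2 ^ (n + 2) * c)\<^sup>2 - u" by (simp add: numeral_eq_Suc)
    moreover have "2 ^ n dvd (s + 2 ^ (n + 2) * c) - s" by (simp add: power_add)
    ultimately show "\<exists>y. 2 ^ (Suc n + 3) dvd y\<^sup>2 - u \<and> 2 ^ n dvd y - s" by blast
  qed
  then show ?thesis using True by (auto simp: power_add intro: dvd_mult_left)
next
  case False
  have p2: "\<not> int p dvd 2" using p False odd_prime_ge_3[of p] zdvd_imp_le[of "int p" 2] by auto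
  have "\<exists>s::nat \<Rightarrow> int. \<forall>n. int p ^ Suc n dvd (s n)\<^sup>2 - u \<and> int p ^ n dvd s (Suc n) - s n"
  proof (rule dependent_nat_choice)
    show "\<exists>x::int. int p ^ Suc 0 dvd x\<^sup>2 - u"
      using sq False by (auto simp: QuadRes_def cong_iff_dvd_diff)
  next
    fix s :: int and n assume s: "int p ^ Suc n dvd s\<^sup>2 - u"
    then obtain c where c: "s\<^sup>2 - u = int p ^ Suc n * c" by (auto simp: dvd_def)
    have "int p dvd s\<^sup>2 - u" using s by (rule dvd_trans[rotated]) simp
    then have "\<not> int p dvd s" using nd by (metis dvd_diff_right_iff dvd_power zero_less_numeral dvd_trans)
    then have "\<not> int p dvd 2 * s" using p p2 by (simp add: prime_dvd_mult_iff)
    then have "coprime (2 * s) (int p)" using p by (metis prime_imp_coprime coprime_commute prime_nat_int_transfer)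
    then obtain t' where t': "[2 * s * t' = 1] (mod int p)" using cong_solve_coprime_int by blast
    have "[c + 2 * s * t' * (- c) = c + 1 * (- c)] (mod int p)" by (intro cong_add cong_refl cong_scalar_right t')
    \<comment> \<open>The Newton step: t = - t' c solves c + 2 s t = 0 modulo p, where t' inverts 2
      s.\<close>
    then obtain j where j: "c + 2 * s * (t' * (- c)) = int p * j" by (auto simp: cong_0_iff dvd_def mult.assoc)
    define t where "t = t' * (- c)"
    have "(s + int p ^ Suc n * t)\<^sup>2 - u = (s\<^sup>2 - u) + int p ^ Suc n * (2 * s * t) + int p ^ Suc (Suc n) * (int p ^ n * t\<^sup>2)"
      by (simp add: power2_eq_square algebra_simps)
    also have "\<dots> = int p ^ Suc n * (c + 2 * s * t) + int p ^ Suc (Suc n) * (int p ^ n * t\<^sup>2)"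
      unfolding c by (simp add: algebra_simps)
    also have "\<dots> = int p ^ Suc (Suc n) * (j + int p ^ n * t\<^sup>2)" unfolding j[folded t_def] by (simp add: algebra_simps)
    finally have "int p ^ Suc (Suc n) dvd (s + int p ^ Suc n * t)\<^sup>2 - u" by simp
    moreover have "int p ^ n dvd (s + int p ^ Suc n * t) - s" by simp
    ultimately show "\<exists>y. int p ^ Suc (Suc n) dvd y\<^sup>2 - u \<and> int p ^ n dvd y - s" by blast
  qed
  then show ?thesis by (auto intro: dvd_mult_right)
qed

text \<open>For two non-residues \<open>a\<close>, \<open>b\<close> and the least non-residue \<open>m\<close>, the residue class of \<open>a m = a + a (m - 1)\<close>
  is a square, and so is that of \<open>b a (m - 1)\<close>.\<close>

lemma represents_square_mod_prime:
  assumes p: "prim p" "p \<noteq> 2" and a: "\<not> int p dvd a" and b: "\<not> int p dvd b"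
  obtains x y where "local_square (Prime_Place p) (a * x\<^sup>2 + b * y\<^sup>2)"
proof -
  have res: "local_square (Prime_Place p) w" if "Legendre w p = 1" for w
    using that local_square_unit[OF p(1), of w] p(2) by (auto simp: Legendre_def cong_0_iff split: if_splits)
  consider "Legendre a p = 1" | "Legendre b p = 1" | "Legendre a p = - 1" "Legendre b p = - 1"
    using Legendre_pm a b by blast
  then show ?thesis
  proof cases
    case 1 then show ?thesis using that[of 1 0] res by simp
  next
    case 2 then show ?thesis using that[of 0 1] res by simp
  next
    case 3
    have cong: "Legendre x p = Legendre y p" if "[x = y] (mod int p)" for x y
    proof -
      have "[x = 0] (mod int p) \<longleftrightarrow> [y = 0] (mod int p)" using that by (metis cong_sym cong_trans)
      moreover have "QuadRes p x \<longleftrightarrow> QuadRes p y" using that unfolding QuadRes_def by (metis cong_sym cong_trans)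
      ultimately show ?thesis by (simp add: Legendre_def)
    qed
    have p0: "int p > 0" using prime_gt_0_nat[OF p(1)] by simp
    define P where "P = (\<lambda>m::nat. Legendre (int m) p = - 1)"
    \<comment> \<open>The residue of a is itself a non-residue, so the least one lies below
      p.\<close>
    have "P (nat (a mod p))" using 3(1) cong[of "a mod p" a] p0 by (simp add: P_def)
    then have m: "P (LEAST m. P m)" and le: "(LEAST m. P m) \<le> nat (a mod p)" by (auto intro: LeastI Least_le)
    define m where "m = (LEAST m. P m)"
    have "int m < int p" using le p0 pos_mod_bound[OF p0, of a] unfolding m_def by linarith
    have "P m" using m unfolding m_def .
    moreover have "Legendre (int 0) p = 0" "Legendre (int 1) p = 1"
      using Legendre_1[OF p(1)] by (simp_all add: Legendre_def)
    then have "\<not> P 0" "\<not> P 1" unfolding P_def by linarith+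
    ultimately have "m \<noteq> 0" "m \<noteq> 1" by (metis, metis)
    then have m2: "m \<ge> 2" by linarith
    \<comment> \<open>By minimality m - 1 is not a non-residue, and as it lies strictly between 0
      and p it is a nonzero square modulo p.\<close>
    have "\<not> P (m - 1)" using m2 not_less_Least[of "m - 1" P] unfolding m_def by simp
    moreover have "\<not> int p dvd int (m - 1)" using m2 \<open>int m < int p\<close> zdvd_imp_le[of "int p" "int (m - 1)"] by auto
    ultimately have "Legendre (int (m - 1)) p = 1" using Legendre_pm unfolding P_def by blast
    then obtain c where c: "[c\<^sup>2 = int m - 1] (mod int p)"
      using m2 by (auto simp: Legendre_def QuadRes_def of_nat_diff split: if_splits)
    have "Legendre (a * b) p = 1" using 3 Legendre_mult[OF p] by simp
    then obtain r where r: "[r\<^sup>2 = a * b] (mod int p)" by (auto simp: Legendre_def QuadRes_def split: if_splits)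
    have "coprime b (int p)" using p b by (metis prime_imp_coprime coprime_commute prime_nat_int_transfer)
    then obtain b' where b': "[b * b' = 1] (mod int p)" using cong_solve_coprime_int by blast
    \<comment> \<open>With c^2 = m - 1, r^2 = a b and b' inverse to b, the value b (c r b')^2 is a
      (m - 1). Adding a gives a m, a product of two non-residues.\<close>
    have "[b * (c * r * b')\<^sup>2 = (b * b') * (b' * (c\<^sup>2 * r\<^sup>2))] (mod int p)" by (simp add: power2_eq_square mult_ac)
    also have "[(b * b') * (b' * (c\<^sup>2 * r\<^sup>2)) = 1 * (b' * (c\<^sup>2 * (a * b)))] (mod int p)"
      by (intro cong_mult b' r cong_refl)
    also have "[1 * (b' * (c\<^sup>2 * (a * b))) = (b * b') * (c\<^sup>2 * a)] (mod int p)" by (simp add: mult_ac)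
    also have "[(b * b') * (c\<^sup>2 * a) = 1 * ((int m - 1) * a)] (mod int p)" by (intro cong_mult b' c cong_refl)
    finally have "[a * 1\<^sup>2 + b * (c * r * b')\<^sup>2 = a * 1\<^sup>2 + 1 * ((int m - 1) * a)] (mod int p)"
      by (intro cong_add cong_refl)
    then have "[a * 1\<^sup>2 + b * (c * r * b')\<^sup>2 = a * int m] (mod int p)" by (simp add: algebra_simps)
    then have "Legendre (a * 1\<^sup>2 + b * (c * r * b')\<^sup>2) p = Legendre a p * Legendre (int m) p"
      using cong Legendre_mult[OF p] by simp
    also have "\<dots> = 1" using 3 m by (simp add: P_def m_def)
    finally show ?thesis using that res by blast
  qed
qed

text \<open>For units \<open>local_square\<close> depends only on the residue modulo p or 8, so
  small x and y suffice. If p divides b, the symbol being 1 makes a itself a residue for odd p, and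
  makes a or a + b congruent to 1 modulo 8 for p = 2.\<close>

lemma represents_square_if_symbol:
  assumes p: "prim p" and a: "\<not> int p dvd a" and b: "b \<noteq> 0" "multiplicity (int p) b \<le> 1"
    and sym: "prime_symbol p a b = 1"
  obtains x y where "local_square (Prime_Place p) (a * x\<^sup>2 + b * y\<^sup>2)"
proof -
  define w where "w = unit_part p b"
  have a': "multiplicity (int p) a = 0" "unit_part p a = a" using unit_part_not_dvd[OF p a] by auto
  have pw: "\<not> int p dvd w" using not_dvd_unit_part[OF p b(1)] w_def by simp
  have sq: "local_square (Prime_Place 2) k" if "k mod 8 = 1" for k
  proof -
    have "odd k" using that by presburger
    then show ?thesis using local_square_unit[of 2 k] that by simp
  qed
  consider "multiplicity (int p) b = 0" | "multiplicity (int p) b = 1" using b(2) by linarith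
  then show ?thesis
  proof cases
    case 1
    then have b': "b = w" using unit_part_decomp[of b p] unfolding w_def by simp
    show ?thesis
    proof (cases "p = 2")
      case True
      have odd: "odd a" "odd b" using a pw b' True by auto
      have "\<not> (a mod 4 = 3 \<and> b mod 4 = 3)" using sym a' 1 b' True unit_part_not_dvd[OF p pw]
        by (simp add: prime_symbol_def Let_def w_def[symmetric] chi4_def split: if_splits)
      moreover define r s where "r = a mod 8" and "s = b mod 8"
      ultimately have "\<not> (r mod 4 = 3 \<and> s mod 4 = 3)" by (simp add: mod_mod_cancel)
      moreover have "r = 1 \<or> r = 3 \<or> r = 5 \<or> r = 7" "s = 1 \<or> s = 3 \<or> s = 5 \<or> s = 7"
        using odd unfolding r_def s_def by presburger+
      \<comment> \<open>A check over odd residues modulo 8: unless both are 3 modulo 4, one of a, b,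
        a + 4 b, 4 a + b is 1 modulo 8.\<close>
      ultimately have "r = 1 \<or> s = 1 \<or> (r + s * 4) mod 8 = 1 \<or> (r * 4 + s) mod 8 = 1" by auto
      moreover have "(a + b * 4) mod 8 = (r + s * 4) mod 8" "(a * 4 + b) mod 8 = (r * 4 + s) mod 8"
        by (intro mod_add_cong mod_mult_cong; simp add: r_def s_def)+
      ultimately have "a mod 8 = 1 \<or> b mod 8 = 1 \<or> (a + b * 4) mod 8 = 1 \<or> (a * 4 + b) mod 8 = 1"
        unfolding r_def s_def by (simp only:)
      then show ?thesis
        using that[of 1 0] that[of 0 1] that[of 1 2] that[of 2 1] True sq by auto
    next
      case False
      then show ?thesis using represents_square_mod_prime[OF p False a] pw b' that by blast
    qed
  next
    case 2
    then have b': "b = int p * w" using unit_part_decomp[of b p] unfolding w_def by simp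
    show ?thesis
    proof (cases "p = 2")
      case True
      have odd: "odd a" "odd w" using a pw True by auto
      have "unit_part 2 b = w" using True by (simp add: w_def)
      then have "chi4 a w * chi8 a = 1" using sym a' 2 True by (simp add: prime_symbol_def)
      then have "a mod 8 = 1 \<or> (a + 2 * w) mod 8 = 1"
      proof -
        define r s where "r = a mod 8" and "s = w mod 4"
        have "chi4 a w = (if r mod 4 = 3 \<and> s = 3 then - 1 else 1)"
          unfolding chi4_def r_def s_def by (simp add: mod_mod_cancel)
        moreover have "chi8 a = (if r = 1 \<or> r = 7 then 1 else - 1)" unfolding chi8_def r_def by simp
        moreover have "r = 1 \<or> r = 3 \<or> r = 5 \<or> r = 7" "s = 1 \<or> s = 3"
          using odd unfolding r_def s_def by presburger+
        moreover assume "chi4 a w * chi8 a = 1"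
        ultimately have "r = 1 \<or> (r + 2 * s) mod 8 = 1" by (auto split: if_splits)
        moreover have "2 * s = (2 * w) mod 8" unfolding s_def using mult_mod_right[of 2 w 4] by simp
        then have "(a + 2 * w) mod 8 = (r + 2 * s) mod 8" unfolding r_def by (simp only: mod_add_eq)
        ultimately show ?thesis unfolding r_def by simp
      qed
      then show ?thesis using that[of 1 0] that[of 1 1] sq True b' by auto
    next
      case False
      then have "Legendre a p = 1" using sym a' 2 by (simp add: prime_symbol_def)
      then show ?thesis using that[of 1 0] local_square_unit[OF p a] False
        by (auto simp: Legendre_def split: if_splits)
    qed
  qed
qed

context padic
begin

section \<open>Solubility over the field of p-adic numbers\<close>

definition cst :: "rat \<Rightarrow> (nat \<Rightarrow> rat) set" where "cst r = cls (\<lambda>_. r)"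

lemma cst_closed [simp]: "cst r \<in> carrier Q"
  by (simp add: cst_def cls_closed cauchy_const)

lemma cst_mult: "cst r \<otimes>\<^bsub>Q\<^esub> cst s = cst (r * s)"
  by (simp add: cst_def cls_mult cauchy_const)

lemma cst_add: "cst r \<oplus>\<^bsub>Q\<^esub> cst s = cst (r + s)"
  by (simp add: cst_def cls_add cauchy_const)

lemma cst_1: "cst 1 = \<one>\<^bsub>Q\<^esub>" by (simp add: cst_def cls_one)

lemma add_pow_Q: "[k] \<cdot>\<^bsub>Q\<^esub> \<one>\<^bsub>Q\<^esub> = cst (of_int k)"
  by (rule Q.add_pow_int_eqI) (simp_all add: cst_1 cst_add)

lemma cst_inverse: "r \<noteq> 0 \<Longrightarrow> cst r \<otimes>\<^bsub>Q\<^esub> cst (1 / r) = \<one>\<^bsub>Q\<^esub>"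
  by (simp add: cst_mult cst_1)

lemma cst_Units: "r \<noteq> 0 \<Longrightarrow> cst r \<in> Units Q"
  using cst_inverse[of r] Q.m_comm[of "cst r" "cst (1 / r)"]
  by (auto simp: Units_def intro!: bexI[of _ "cst (1 / r)"])

lemma of_rat_field_Q: "of_rat_field Q r = cst r"
proof -
  obtain k l where q: "quotient_of r = (k, l)" by (cases "quotient_of r")
  have l: "of_int l \<noteq> (0::rat)" using quotient_of_denom_pos[OF q] by simp
  have "inv\<^bsub>Q\<^esub> (cst (of_int l)) = cst (1 / of_int l)"
    by (rule Q.comm_inv_char[OF cst_closed cst_closed cst_inverse[OF l]])
  then have "of_rat_field Q r = cst (of_int k * (1 / of_int l))"
    by (simp add: of_rat_field_def q add_pow_Q cst_mult)
  then show ?thesis using quotient_of_div[OF q] by simp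
qed

text \<open>The condition of the Hilbert symbol, unfolded to sequences: being nonzero becomes not
  being null, and equality becomes a null difference.\<close>

definition soluble :: "rat \<Rightarrow> rat \<Rightarrow> bool"
  where "soluble a b \<longleftrightarrow> (\<exists>x y z. cauchy x \<and> cauchy y \<and> cauchy z \<and> \<not> (null x \<and> null y \<and> null z) \<and>
    null (\<lambda>n. (z n)\<^sup>2 - a * (x n)\<^sup>2 - b * (y n)\<^sup>2))"

lemma solubleI:
  assumes "cauchy x" "cauchy y" "cauchy z" "\<not> (null x \<and> null y \<and> null z)"
    "null (\<lambda>n. (z n)\<^sup>2 - a * (x n)\<^sup>2 - b * (y n)\<^sup>2)"
  shows "soluble a b"
  using assms unfolding soluble_def by blast

lemma cauchy_cmult: "cauchy x \<Longrightarrow> cauchy (\<lambda>n. r * x n)"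
  using cauchy_mult[OF cauchy_const] .

lemma null_cmult: "null x \<Longrightarrow> null (\<lambda>n. r * x n)"
  using null_mult[OF cauchy_const] .

lemma null_cmult_cancel: "r \<noteq> 0 \<Longrightarrow> null (\<lambda>n. r * x n) \<Longrightarrow> null x"
  using null_cmult[of "\<lambda>n. r * x n" "1 / r"] by simp

lemma cauchy_diff: "cauchy x \<Longrightarrow> cauchy y \<Longrightarrow> cauchy (\<lambda>n. x n - y n)"
  using cauchy_add[of x "\<lambda>n. - y n"] cauchy_uminus[of y] by simp

lemma cls_null_iff: "cauchy x \<Longrightarrow> cls x = \<zero>\<^bsub>Q\<^esub> \<longleftrightarrow> null x"
  using cls_eq_iff[of x "\<lambda>_. 0"] by (simp add: cls_zero cauchy_const)

lemma hilbert_symbol_Q: "hilbert_symbol Q (cst a) (cst b) = (if soluble a b then 1 else - 1)"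
proof -
  have eq: "cls z \<otimes>\<^bsub>Q\<^esub> cls z \<ominus>\<^bsub>Q\<^esub> cst a \<otimes>\<^bsub>Q\<^esub> (cls x \<otimes>\<^bsub>Q\<^esub> cls x) \<ominus>\<^bsub>Q\<^esub> cst b \<otimes>\<^bsub>Q\<^esub> (cls y \<otimes>\<^bsub>Q\<^esub> cls y) = \<zero>\<^bsub>Q\<^esub>
      \<longleftrightarrow> null (\<lambda>n. (z n)\<^sup>2 - a * (x n)\<^sup>2 - b * (y n)\<^sup>2)"
    if "cauchy x" "cauchy y" "cauchy z" for x y z
    using that unfolding cst_def
    by (simp add: cls_mult cls_minus cls_null_iff cauchy_mult cauchy_const cauchy_diff power2_eq_square)
  have "(\<exists>x\<in>carrier Q. \<exists>y\<in>carrier Q. \<exists>z\<in>carrier Q. (x, y, z) \<noteq> (\<zero>\<^bsub>Q\<^esub>, \<zero>\<^bsub>Q\<^esub>, \<zero>\<^bsub>Q\<^esub>) \<and>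
      z \<otimes>\<^bsub>Q\<^esub> z \<ominus>\<^bsub>Q\<^esub> cst a \<otimes>\<^bsub>Q\<^esub> (x \<otimes>\<^bsub>Q\<^esub> x) \<ominus>\<^bsub>Q\<^esub> cst b \<otimes>\<^bsub>Q\<^esub> (y \<otimes>\<^bsub>Q\<^esub> y) = \<zero>\<^bsub>Q\<^esub>) \<longleftrightarrow> soluble a b" (is "?L \<longleftrightarrow> _")
  proof
    assume ?L
    then obtain x y z where xyz: "cauchy x" "cauchy y" "cauchy z" "\<not> (cls x = \<zero>\<^bsub>Q\<^esub> \<and> cls y = \<zero>\<^bsub>Q\<^esub> \<and> cls z = \<zero>\<^bsub>Q\<^esub>)"
      "cls z \<otimes>\<^bsub>Q\<^esub> cls z \<ominus>\<^bsub>Q\<^esub> cst a \<otimes>\<^bsub>Q\<^esub> (cls x \<otimes>\<^bsub>Q\<^esub> cls x) \<ominus>\<^bsub>Q\<^esub> cst b \<otimes>\<^bsub>Q\<^esub> (cls y \<otimes>\<^bsub>Q\<^esub> cls y) = \<zero>\<^bsub>Q\<^esub>"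
      unfolding carrier_Q by blast
    then show "soluble a b"
      unfolding eq[OF xyz(1-3)] using cls_null_iff by (intro solubleI[OF xyz(1-3)]) auto
  next
    assume "soluble a b"
    then obtain x y z where xyz: "cauchy x" "cauchy y" "cauchy z" "\<not> (null x \<and> null y \<and> null z)"
      "null (\<lambda>n. (z n)\<^sup>2 - a * (x n)\<^sup>2 - b * (y n)\<^sup>2)" unfolding soluble_def by blast
    have "(cls x, cls y, cls z) \<noteq> (\<zero>\<^bsub>Q\<^esub>, \<zero>\<^bsub>Q\<^esub>, \<zero>\<^bsub>Q\<^esub>)"
      using xyz(4) cls_null_iff xyz(1-3) by simp
    then show ?L using xyz(5) unfolding eq[OF xyz(1-3), symmetric]
      by (intro bexI[OF _ cls_closed[OF xyz(1)]] bexI[OF _ cls_closed[OF xyz(2)]] bexI[OF _ cls_closed[OF xyz(3)]] conjI)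
  qed
  then show ?thesis unfolding hilbert_symbol_def by simp
qed

lemma soluble_commute: "soluble a b \<Longrightarrow> soluble b a"
proof -
  assume "soluble a b"
  then obtain x y z where *: "cauchy x" "cauchy y" "cauchy z" "\<not> (null x \<and> null y \<and> null z)"
    "null (\<lambda>n. (z n)\<^sup>2 - a * (x n)\<^sup>2 - b * (y n)\<^sup>2)" unfolding soluble_def by blast
  show ?thesis by (rule solubleI[of y x z]) (use * in \<open>auto simp: algebra_simps\<close>)
qed

lemma soluble_square: assumes "s \<noteq> 0" "soluble a (b * s\<^sup>2)" shows "soluble a b"
proof -
  obtain x y z where *: "cauchy x" "cauchy y" "cauchy z" "\<not> (null x \<and> null y \<and> null z)"
    "null (\<lambda>n. (z n)\<^sup>2 - a * (x n)\<^sup>2 - b * s\<^sup>2 * (y n)\<^sup>2)" using assms(2) unfolding soluble_def by blast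
  show ?thesis
  proof (rule solubleI[of x "\<lambda>n. s * y n" z])
    show "\<not> (null x \<and> null (\<lambda>n. s * y n) \<and> null z)" using *(4) null_cmult_cancel[OF assms(1)] by blast
  qed (use * in \<open>simp_all add: cauchy_cmult power_mult_distrib mult.assoc\<close>)
qed

lemma soluble_square_iff: "s \<noteq> 0 \<Longrightarrow> soluble a (b * s\<^sup>2) \<longleftrightarrow> soluble a b"
  using soluble_square[of s a b] soluble_square[of "1 / s" a "b * s\<^sup>2"] by (auto simp: power_one_over)

text \<open>The substitution of \<open>locally_soluble_twist\<close>, applied term by term.\<close>

lemma soluble_twist: assumes "a \<noteq> 0" "soluble a b" shows "soluble a (- a * b)"
proof -
  obtain x y z where *: "cauchy x" "cauchy y" "cauchy z" "\<not> (null x \<and> null y \<and> null z)"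
    "null (\<lambda>n. (z n)\<^sup>2 - a * (x n)\<^sup>2 - b * (y n)\<^sup>2)" using assms(2) unfolding soluble_def by blast
  show ?thesis
  proof (rule solubleI[of z y "\<lambda>n. a * x n"])
    show "\<not> (null z \<and> null y \<and> null (\<lambda>n. a * x n))" using *(4) null_cmult_cancel[OF assms(1)] by blast
    have "(a * x n)\<^sup>2 - a * (z n)\<^sup>2 - - a * b * (y n)\<^sup>2 = (- a) * ((z n)\<^sup>2 - a * (x n)\<^sup>2 - b * (y n)\<^sup>2)" for n
      by (simp add: power2_eq_square algebra_simps)
    then show "null (\<lambda>n. (a * x n)\<^sup>2 - a * (z n)\<^sup>2 - - a * b * (y n)\<^sup>2)"
      using null_cmult[OF *(5), of "- a"] by simp
  qed (use * in \<open>simp_all add: cauchy_cmult\<close>)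
qed

text \<open>Twisting twice multiplies b by a^2, so one direction yields the other.\<close>

lemma soluble_twist_iff: assumes "a \<noteq> 0" shows "soluble a (- a * b) \<longleftrightarrow> soluble a b"
proof -
  have "soluble a b" if "soluble a (- a * b)"
    using soluble_twist[OF assms that] soluble_square[OF assms, of a b] by (simp add: power2_eq_square mult_ac)
  then show ?thesis using soluble_twist[OF assms] by blast
qed

lemma power_inverse_less: "0 < e \<Longrightarrow> \<exists>n. (1 / real p) ^ n < e"
  using real_arch_pow_inv[of e "1 / real p"] p_gt_1 by simp

lemma cauchy_int_sequence:
  assumes "\<And>n. int p ^ n dvd s (Suc n) - s n" shows "cauchy (\<lambda>n. of_int (s n))"
  unfolding cauchy_def
proof (intro allI impI)
  fix e :: real assume "e > 0"
  then obtain N where N: "(1 / real p) ^ N < e" using power_inverse_less by blast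
  have d: "int p ^ N dvd s m - s N" if "m \<ge> N" for m
    using that
  proof (induction m rule: dec_induct)
    case (step n)
    have "int p ^ N dvd s (Suc n) - s n" using assms[of n] step(1) by (meson dvd_trans le_imp_power_dvd)
    from dvd_add[OF this step.IH] show ?case by simp
  qed simp
  have "absp (of_int (s m) - of_int (s n)) < e" if mn: "m \<ge> N" "n \<ge> N" for m n
  proof -
    have "int p ^ N dvd (s m - s N) - (s n - s N)" using d[OF mn(1)] d[OF mn(2)] by (rule dvd_diff)
    then have "absp (of_int (s m - s n)) \<le> (1 / real p) ^ N" unfolding absp_int_le_iff by simp
    then show ?thesis using N by simp
  qed
  then show "\<exists>N. \<forall>m\<ge>N. \<forall>n\<ge>N. absp (of_int (s m) - of_int (s n)) < e" by blast
qed

lemma null_int_sequence: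
  assumes "\<And>n. int p ^ n dvd s n" shows "null (\<lambda>n. of_int (s n))"
  unfolding null_def'
proof (intro allI impI)
  fix e :: real assume "e > 0"
  then obtain N where N: "(1 / real p) ^ N < e" using power_inverse_less by blast
  have "absp (of_int (s n)) < e" if "n \<ge> N" for n
  proof -
    have "int p ^ N dvd s n" using assms[of n] that by (meson dvd_trans le_imp_power_dvd)
    then have "absp (of_int (s n)) \<le> (1 / real p) ^ N" unfolding absp_int_le_iff .
    then show ?thesis using N by simp
  qed
  then show "\<exists>N. \<forall>n\<ge>N. absp (of_int (s n)) < e" by blast
qed

lemma local_square_sqrt:
  assumes "local_square (Prime_Place p) w"
  obtains s where "cauchy s" "null (\<lambda>n. (s n)\<^sup>2 - of_int w)" "\<not> null s"
proof -
  let ?u = "unit_part p w" and ?k = "multiplicity (int p) w"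
  have w: "w \<noteq> 0" "even ?k" "if p = 2 then ?u mod 8 = 1 else QuadRes p ?u"
    using assms by (auto simp: local_square_def)
  obtain t :: "nat \<Rightarrow> int" where t: "\<And>n. int p ^ n dvd (t n)\<^sup>2 - ?u" "\<And>n. int p ^ n dvd t (Suc n) - t n"
    using sqrt_approximations[OF prime not_dvd_unit_part[OF prime w(1)] w(3)] by blast
  obtain j where j: "?k = 2 * j" using w(2) by blast
  let ?c = "of_nat p ^ j :: rat"
  have weq: "of_int w = ?c\<^sup>2 * (of_int ?u :: rat)"
    by (subst unit_part_decomp[of w p]) (simp add: j power_mult[symmetric] mult.commute)
  define s where "s = (\<lambda>n. ?c * of_int (t n))"
  have 1: "cauchy s" unfolding s_def by (intro cauchy_cmult cauchy_int_sequence t)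
  have "null (\<lambda>n. ?c\<^sup>2 * of_int ((t n)\<^sup>2 - ?u))" by (intro null_cmult null_int_sequence t)
  then have 2: "null (\<lambda>n. (s n)\<^sup>2 - of_int w)" unfolding weq s_def by (simp add: power_mult_distrib algebra_simps)
  \<comment> \<open>Otherwise s^2 would be null, and with it the nonzero constant w.\<close>
  have "\<not> null s"
  proof
    assume "null s"
    then have "null (\<lambda>n. s n * s n - ((s n)\<^sup>2 - of_int w))" by (intro null_diff null_mult 1 2)
    then show False using w(1) null_const[of "of_int w"] by (simp add: power2_eq_square)
  qed
  then show ?thesis using that 1 2 by blast
qed

lemma soluble_if_represents_square:
  assumes "local_square (Prime_Place p) (a * x\<^sup>2 + b * y\<^sup>2)"
  shows "soluble (of_int a) (of_int b)"
proof -
  obtain s where s: "cauchy s" "null (\<lambda>n. (s n)\<^sup>2 - of_int (a * x\<^sup>2 + b * y\<^sup>2))" "\<not> null s"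
    using local_square_sqrt[OF assms] .
  show ?thesis
    by (rule solubleI[of "\<lambda>_. of_int x" "\<lambda>_. of_int y" s])
      (use s in \<open>simp_all add: cauchy_const algebra_simps\<close>)
qed

lemma primitive_multiple:
  fixes x y z :: rat
  assumes "\<not> (x = 0 \<and> y = 0 \<and> z = 0)"
  obtains r x' y' z' where "of_int x' = r * x" "of_int y' = r * y" "of_int z' = r * z"
    "\<not> (int p dvd x' \<and> int p dvd y' \<and> int p dvd z')"
proof -
  obtain k1 l1 where 1: "x = of_int k1 / of_int l1" "l1 \<noteq> 0" using rat_frac .
  obtain k2 l2 where 2: "y = of_int k2 / of_int l2" "l2 \<noteq> 0" using rat_frac .
  obtain k3 l3 where 3: "z = of_int k3 / of_int l3" "l3 \<noteq> 0" using rat_frac .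
  let ?x' = "k1 * l2 * l3" and ?y' = "k2 * l1 * l3" and ?z' = "k3 * l1 * l2"
  define D :: rat where "D = of_int (l1 * l2 * l3)"
  define g where "g = gcd ?x' (gcd ?y' ?z')"
  have D: "of_int ?x' = D * x" "of_int ?y' = D * y" "of_int ?z' = D * z"
    using 1 2 3 by (simp_all add: D_def)
  have nz: "\<not> (?x' = 0 \<and> ?y' = 0 \<and> ?z' = 0)" using assms 1 2 3 by auto
  then have g: "g \<noteq> 0" unfolding g_def by auto
  obtain x' y' z' where XYZ: "?x' = g * x'" "?y' = g * y'" "?z' = g * z'"
    unfolding g_def by (meson dvd_def gcd_dvd1 gcd_dvd2 dvd_trans)
  have "\<not> (int p dvd x' \<and> int p dvd y' \<and> int p dvd z')"
  proof
    assume "int p dvd x' \<and> int p dvd y' \<and> int p dvd z'"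
    then have "g * int p dvd ?x'" "g * int p dvd ?y'" "g * int p dvd ?z'" unfolding XYZ by simp_all
    then have "g * int p dvd g" unfolding g_def by (metis gcd_greatest)
    then show False using g prime_gt_1_nat[OF prime] by (auto simp: dvd_mult_cancel1 zdvd1_eq)
  qed
  moreover have "of_int x' = (D / of_int g) * x" "of_int y' = (D / of_int g) * y" "of_int z' = (D / of_int g) * z"
    using D g unfolding XYZ by (simp_all add: field_simps)
  ultimately show ?thesis using that by blast
qed

text \<open>Since not all three sequences are null, entries of absolute value at least some c > 0
  occur arbitrarily late. There the triple is rescaled to primitive integers, and c bounds the
  scaling factor, so the error remains small.\<close>

lemma locally_soluble_if_soluble:
  assumes "soluble (of_int a) (of_int b)" shows "locally_soluble p a b"
proof -
  obtain x y z where xyz: "cauchy x" "cauchy y" "cauchy z" "\<not> (null x \<and> null y \<and> null z)"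
    "null (\<lambda>n. (z n)\<^sup>2 - of_int a * (x n)\<^sup>2 - of_int b * (y n)\<^sup>2)" using assms unfolding soluble_def by blast
  have "\<exists>c>0. \<forall>N. \<exists>n\<ge>N. c \<le> absp (x n) \<or> c \<le> absp (y n) \<or> c \<le> absp (z n)"
    using xyz(4) unfolding null_def' by (meson not_less)
  then obtain c where c: "c > 0" "\<And>N. \<exists>n\<ge>N. c \<le> absp (x n) \<or> c \<le> absp (y n) \<or> c \<le> absp (z n)" by blast
  have "\<exists>x' y' z'. \<not> (int p ^ 1 dvd x' \<and> int p ^ 1 dvd y' \<and> int p ^ 1 dvd z') \<and> int p ^ m dvd z'\<^sup>2 - a * x'\<^sup>2 - b * y'\<^sup>2" for m
  proof -
    have "c\<^sup>2 * (1 / real p) ^ m > 0" using c p_gt_1 by simp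
    then obtain N where N: "\<And>n. n \<ge> N \<Longrightarrow> absp ((z n)\<^sup>2 - of_int a * (x n)\<^sup>2 - of_int b * (y n)\<^sup>2) < c\<^sup>2 * (1 / real p) ^ m"
      using xyz(5) unfolding null_def' by meson
    obtain n where n: "n \<ge> N" "c \<le> absp (x n) \<or> c \<le> absp (y n) \<or> c \<le> absp (z n)" using c(2) by blast
    then have "\<not> (x n = 0 \<and> y n = 0 \<and> z n = 0)" using c(1) by auto
    then obtain r x' y' z' where r: "of_int x' = r * x n" "of_int y' = r * y n" "of_int z' = r * z n"
      "\<not> (int p dvd x' \<and> int p dvd y' \<and> int p dvd z')" by (rule primitive_multiple)
    \<comment> \<open>An entry of absolute value at least c becomes an integer after multiplication
      by r.\<close>
    have rc: "absp r * c \<le> 1"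
    proof -
      have "absp r * absp (x n) \<le> 1" "absp r * absp (y n) \<le> 1" "absp r * absp (z n) \<le> 1"
        using absp_int_le_1[of x'] absp_int_le_1[of y'] absp_int_le_1[of z'] unfolding r absp_mult by simp_all
      then show ?thesis using n(2) mult_left_mono[OF _ absp_nonneg, of c _ r] by (meson order_trans)
    qed
    have "absp (of_int (z'\<^sup>2 - a * x'\<^sup>2 - b * y'\<^sup>2)) = absp (r\<^sup>2 * ((z n)\<^sup>2 - of_int a * (x n)\<^sup>2 - of_int b * (y n)\<^sup>2))"
      by (simp add: r power_mult_distrib algebra_simps)
    also have "\<dots> = (absp r)\<^sup>2 * absp ((z n)\<^sup>2 - of_int a * (x n)\<^sup>2 - of_int b * (y n)\<^sup>2)" by (simp add: absp_mult absp_power)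
    also have "\<dots> \<le> (absp r)\<^sup>2 * (c\<^sup>2 * (1 / real p) ^ m)" using N[OF n(1)] by (intro mult_left_mono) auto
    also have "\<dots> = (absp r * c)\<^sup>2 * (1 / real p) ^ m" by (simp add: power_mult_distrib)
    also have "\<dots> \<le> 1\<^sup>2 * (1 / real p) ^ m" using rc c(1) by (intro mult_right_mono power_mono) auto
    finally have "int p ^ m dvd z'\<^sup>2 - a * x'\<^sup>2 - b * y'\<^sup>2" unfolding absp_int_le_iff[symmetric] by simp
    then show ?thesis using r(4) by auto
  qed
  then show ?thesis unfolding locally_soluble_def by blast
qed

text \<open>One direction passes through congruences. For the other, squares and the twist again
  reduce to a p-unit as first argument; then a x^2 + b y^2 takes a value with a p-adic square
  root.\<close>

theorem soluble_iff_symbol: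
  assumes nz: "a \<noteq> 0" "b \<noteq> 0"
  shows "soluble (of_int a) (of_int b) \<longleftrightarrow> symbol (Prime_Place p) a b = 1"
proof
  assume "soluble (of_int a) (of_int b)"
  then show "symbol (Prime_Place p) a b = 1"
    using locally_soluble_if_soluble symbol_if_locally_soluble[OF prime nz] by blast
next
  let ?v = "Prime_Place p"
  have v: "?v \<in> places" using prime by (simp add: places_def)
  have left: "soluble (of_int a) (of_int b)"
    if A: "a \<noteq> 0" "b \<noteq> 0" "symbol ?v a b = 1" "multiplicity (int p) a = 0" for a b
  proof -
    obtain b' s where b': "b = b' * s\<^sup>2" "b' \<noteq> 0" "s \<noteq> 0" "multiplicity (int p) b' \<le> 1"
      using squarefree_at_prime[OF prime A(2)] by metis
    have "symbol ?v a b' = 1" using symbol_square_right[OF v A(1) b'(2,3)] A(3) b'(1) by simp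
    moreover have "\<not> int p dvd a" using not_dvd_if_multiplicity_0 prime A by blast
    ultimately obtain x y where "local_square ?v (a * x\<^sup>2 + b' * y\<^sup>2)"
      using represents_square_if_symbol[OF prime _ b'(2,4)] unfolding symbol_def by auto
    then have "soluble (of_int a) (of_int b')" by (rule soluble_if_represents_square)
    then show ?thesis using soluble_square_iff[of "of_int s" "of_int a" "of_int b'"] b' by simp
  qed
  have even: "soluble (of_int a) (of_int b)"
    if A: "a \<noteq> 0" "b \<noteq> 0" "symbol ?v a b = 1" "even (multiplicity (int p) a)" for a b
  proof -
    obtain a' s where a': "a = a' * s\<^sup>2" "a' \<noteq> 0" "s \<noteq> 0" "multiplicity (int p) a' = 0"
      using squarefree_at_prime[OF prime A(1)] A(4) by (metis even_iff_mod_2_eq_zero)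
    have "symbol ?v a' b = 1"
      using symbol_square_right[OF v A(2) a'(2,3)] A(3) a'(1) symbol_commute by metis
    then have "soluble (of_int b) (of_int a')" using left[OF a'(2) A(2) _ a'(4)] soluble_commute by blast
    then have "soluble (of_int b) (of_int a)"
      using soluble_square_iff[of "of_int s" "of_int b" "of_int a'"] a' by simp
    then show ?thesis by (rule soluble_commute)
  qed
  assume sym: "symbol ?v a b = 1"
  consider "even (multiplicity (int p) a)" | "even (multiplicity (int p) b)"
    | "odd (multiplicity (int p) a)" "odd (multiplicity (int p) b)" by blast
  then show "soluble (of_int a) (of_int b)"
  proof cases
    case 1 then show ?thesis using even nz sym by blast
  next
    case 2
    then have "soluble (of_int b) (of_int a)" using even[of b a] nz sym symbol_commute by metis
    then show ?thesis by (rule soluble_commute)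
  next
    case 3
    have "multiplicity (int p) (- a * b) = multiplicity (int p) a + multiplicity (int p) b"
      using unit_part_mult(1)[OF prime, of "- a" b] nz by simp
    moreover have "symbol ?v a (- a * b) = 1"
      using symbol_mult_right[OF v nz(1), of "- a" b] nz sym symbol_neg_self[OF v nz(1)] by simp
    ultimately have "soluble (of_int (- a * b)) (of_int a)"
      using even[of "- a * b" a] 3 nz symbol_commute[of ?v "- a * b" a] by simp
    then have "soluble (of_int a) (- of_int a * of_int b)" using soluble_commute by simp
    then show ?thesis using soluble_twist_iff nz by simp
  qed
qed

end

section \<open>Tensor products and points over a ring\<close>

lemma (in module) add_pow_int_smult:
  fixes k :: int
  assumes "z \<in> carrier M" shows "[k] \<cdot>\<^bsub>M\<^esub> z = ([k] \<cdot> \<one>) \<odot>\<^bsub>M\<^esub> z"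
proof -
  define h where "h = (\<lambda>k::int. ([k] \<cdot> \<one>) \<odot>\<^bsub>M\<^esub> z)"
  have "[k] \<cdot>\<^bsub>M\<^esub> h 1 = h k"
    by (rule M.add_pow_int_additive)
      (use assms in \<open>simp_all add: h_def R.add.int_pow_closed smult_l_distr[symmetric] R.add.int_pow_mult\<close>)
  moreover have "h 1 = z" using assms by (simp add: h_def)
  ultimately show ?thesis by (simp add: h_def)
qed

text \<open>The construction inside \<open>tensor_product\<close>, stated for an arbitrary subset;
  \<open>T_eq\<close> identifies the two, so the module laws are proved for general
  submodules.\<close>

definition quotient_module ::
    "('r, 'u) ring_scheme \<Rightarrow> ('r, 'm, 'v) module_scheme \<Rightarrow> 'm set \<Rightarrow> ('r, 'm set) module"
  where "quotient_module R M H = \<lparr>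
    carrier = a_rcosets\<^bsub>M\<^esub> H,
    monoid.mult = undefined,
    monoid.one = undefined,
    zero = H,
    add = set_add M,
    module.smult = (\<lambda>r C. \<Union>c\<in>C. H +>\<^bsub>M\<^esub> (r \<odot>\<^bsub>M\<^esub> c))\<rparr>"

locale module_quotient = module R M for R (structure) and M (structure) +
  fixes H assumes sub: "submodule H R M"
begin

abbreviation "\<pi> m \<equiv> H +>\<^bsub>M\<^esub> m"
abbreviation "MQ \<equiv> quotient_module R M H"

lemma abelian_subgroup_H: "abelian_subgroup H M"
  using sub abelian_subgroupI3 additive_subgroup.intro submodule.axioms(1) M.abelian_group_axioms by blast

sublocale H: abelian_subgroup H M by (rule abelian_subgroup_H)

lemma H_closed: "h \<in> H \<Longrightarrow> h \<in> carrier M" by (rule H.a_Hcarr)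

lemma H_smult: "r \<in> carrier R \<Longrightarrow> h \<in> H \<Longrightarrow> r \<odot>\<^bsub>M\<^esub> h \<in> H"
  using submoduleE(4)[OF sub] by blast

lemma \<pi>_eqI: "h \<in> H \<Longrightarrow> m \<in> carrier M \<Longrightarrow> \<pi> (h \<oplus>\<^bsub>M\<^esub> m) = \<pi> m"
  by (rule H.a_repr_independence'[symmetric]) (auto simp: a_r_coset_def')

lemma \<pi>_eq_if_minus: "m \<in> carrier M \<Longrightarrow> n \<in> carrier M \<Longrightarrow> m \<ominus>\<^bsub>M\<^esub> n \<in> H \<Longrightarrow> \<pi> m = \<pi> n"
  using \<pi>_eqI[of "m \<ominus>\<^bsub>M\<^esub> n" n] by (simp add: a_minus_def M.a_assoc M.l_neg)

lemma \<pi>_eqD: "m \<in> carrier M \<Longrightarrow> \<pi> m = \<pi> n \<Longrightarrow> \<exists>h\<in>H. m = h \<oplus>\<^bsub>M\<^esub> n"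
  using H.a_rcos_self[of m] unfolding a_r_coset_def' by auto

lemma carrier_quotient: "carrier MQ = \<pi> ` carrier M"
  by (auto simp: quotient_module_def A_RCOSETS_def')

lemma quotient_add: "m \<in> carrier M \<Longrightarrow> n \<in> carrier M \<Longrightarrow> \<pi> m \<oplus>\<^bsub>MQ\<^esub> \<pi> n = \<pi> (m \<oplus>\<^bsub>M\<^esub> n)"
  by (simp add: quotient_module_def H.a_rcos_sum)

lemma quotient_zero: "\<zero>\<^bsub>MQ\<^esub> = \<pi> \<zero>\<^bsub>M\<^esub>"
  by (simp add: quotient_module_def H.a_subset)

text \<open>The scalar action is a union over all representatives of the coset. Each of them
  contributes the same coset.\<close>

lemma quotient_smult:
  assumes "r \<in> carrier R" "m \<in> carrier M" shows "r \<odot>\<^bsub>MQ\<^esub> \<pi> m = \<pi> (r \<odot>\<^bsub>M\<^esub> m)"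
proof -
  have "\<pi> (r \<odot>\<^bsub>M\<^esub> c) = \<pi> (r \<odot>\<^bsub>M\<^esub> m)" if c: "c \<in> \<pi> m" for c
  proof -
    obtain h where h: "h \<in> H" "c = h \<oplus>\<^bsub>M\<^esub> m" using c unfolding a_r_coset_def' by auto
    then show ?thesis using assms H_closed H_smult \<pi>_eqI by (simp add: smult_r_distr)
  qed
  then have "(\<Union>c\<in>\<pi> m. \<pi> (r \<odot>\<^bsub>M\<^esub> c)) = (\<Union>c\<in>\<pi> m. \<pi> (r \<odot>\<^bsub>M\<^esub> m))" by (rule SUP_cong[OF refl])
  also have "\<dots> = \<pi> (r \<odot>\<^bsub>M\<^esub> m)" using H.a_rcos_self[OF assms(2)] by (subst UN_constant) auto
  finally show ?thesis by (simp add: quotient_module_def)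
qed

lemma module_quotient: "module R MQ"
proof (rule moduleI)
  show "abelian_group MQ"
  proof (rule abelian_groupI)
    fix C assume "C \<in> carrier MQ"
    then obtain m where m: "m \<in> carrier M" "C = \<pi> m" by (auto simp: carrier_quotient)
    then show "\<exists>D\<in>carrier MQ. D \<oplus>\<^bsub>MQ\<^esub> C = \<zero>\<^bsub>MQ\<^esub>"
      by (intro bexI[of _ "\<pi> (\<ominus>\<^bsub>M\<^esub> m)"]) (auto simp: carrier_quotient quotient_add quotient_zero M.l_neg)
  qed (auto simp: carrier_quotient quotient_add quotient_zero M.a_ac)
qed (auto simp: carrier_quotient quotient_add quotient_smult R.cring_axioms
    smult_l_distr smult_r_distr smult_assoc1)

end

lemma carrier_free_module: "c \<in> carrier (free_module R S) \<longleftrightarrow>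
    (\<forall>x. c x \<in> carrier R) \<and> (\<forall>x. x \<notin> S \<longrightarrow> c x = \<zero>\<^bsub>R\<^esub>) \<and> finite {x. c x \<noteq> \<zero>\<^bsub>R\<^esub>}"
  by (simp add: free_module_def)

lemma free_module_simps:
  "\<zero>\<^bsub>free_module R S\<^esub> = (\<lambda>_. \<zero>\<^bsub>R\<^esub>)" "c \<oplus>\<^bsub>free_module R S\<^esub> d = (\<lambda>x. c x \<oplus>\<^bsub>R\<^esub> d x)"
  "r \<odot>\<^bsub>free_module R S\<^esub> c = (\<lambda>x. r \<otimes>\<^bsub>R\<^esub> c x)"
  by (simp_all add: free_module_def)

context cring
begin

lemma free_module_add_closed:
  assumes "c \<in> carrier (free_module R S)" "d \<in> carrier (free_module R S)"
  shows "(\<lambda>x. c x \<oplus> d x) \<in> carrier (free_module R S)"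
proof -
  have "finite {x. c x \<oplus> d x \<noteq> \<zero>}"
    by (rule finite_subset[of _ "{x. c x \<noteq> \<zero>} \<union> {x. d x \<noteq> \<zero>}"])
      (use assms in \<open>auto simp: carrier_free_module\<close>)
  then show ?thesis using assms by (auto simp: carrier_free_module)
qed

lemma free_module_smult_closed:
  assumes "c \<in> carrier (free_module R S)" "r \<in> carrier R"
  shows "(\<lambda>x. r \<otimes> c x) \<in> carrier (free_module R S)"
proof -
  have "finite {x. r \<otimes> c x \<noteq> \<zero>}"
    by (rule finite_subset[of _ "{x. c x \<noteq> \<zero>}"]) (use assms in \<open>auto simp: carrier_free_module\<close>)
  then show ?thesis using assms by (auto simp: carrier_free_module)
qed

lemma module_free_module: "module R (free_module R S)"
proof (rule moduleI)
  show "abelian_group (free_module R S)"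
  proof (rule abelian_groupI)
    fix c assume c: "c \<in> carrier (free_module R S)"
    have "(\<lambda>x. (\<ominus> \<one>) \<otimes> c x) \<in> carrier (free_module R S)" using free_module_smult_closed[OF c] by simp
    moreover have "(\<lambda>x. (\<ominus> \<one>) \<otimes> c x \<oplus> c x) = (\<lambda>_. \<zero>)"
      using c by (intro ext) (simp add: carrier_free_module l_minus l_neg)
    ultimately show "\<exists>d\<in>carrier (free_module R S). d \<oplus>\<^bsub>free_module R S\<^esub> c = \<zero>\<^bsub>free_module R S\<^esub>"
      by (intro bexI) (simp_all add: free_module_simps)
  next
    fix c d assume "c \<in> carrier (free_module R S)" "d \<in> carrier (free_module R S)"
    then show "c \<oplus>\<^bsub>free_module R S\<^esub> d \<in> carrier (free_module R S)"
      by (simp add: free_module_simps free_module_add_closed)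
  qed (auto simp: free_module_simps a_ac fun_eq_iff carrier_free_module)
next
  fix r c assume "r \<in> carrier R" "c \<in> carrier (free_module R S)"
  then show "r \<odot>\<^bsub>free_module R S\<^esub> c \<in> carrier (free_module R S)"
    by (simp add: free_module_simps free_module_smult_closed)
qed (auto simp: free_module_simps cring_axioms fun_eq_iff l_distr r_distr m_assoc carrier_free_module)

lemma free_gen_closed: "s \<in> S \<Longrightarrow> free_gen R s \<in> carrier (free_module R S)"
  using finite_subset[of "{x. free_gen R s x \<noteq> \<zero>}" "{s}"]
  by (auto simp: carrier_free_module free_gen_def)

lemma free_module_generated:
  assumes H: "submodule H R (free_module R S)" and gen: "\<And>s. s \<in> S \<Longrightarrow> free_gen R s \<in> H"
  shows "carrier (free_module R S) \<subseteq> H"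
proof
  interpret F: module R "free_module R S" by (rule module_free_module)
  note E = F.submoduleE[OF H]
  fix c assume c: "c \<in> carrier (free_module R S)"
  then have "finite {x. c x \<noteq> \<zero>}" by (simp add: carrier_free_module)
  then show "c \<in> H" using c
  proof (induction "{x. c x \<noteq> \<zero>}" arbitrary: c rule: finite_induct)
    case empty
    then have "c = \<zero>\<^bsub>free_module R S\<^esub>" by (auto simp: free_module_simps)
    moreover obtain h where "h \<in> H" using E(2) by blast
    then have "\<zero> \<odot>\<^bsub>free_module R S\<^esub> h \<in> H" "h \<in> carrier (free_module R S)" using E(1,4) by auto
    then have "\<zero>\<^bsub>free_module R S\<^esub> \<in> H" using F.smult_l_null by metis
    ultimately show ?case by simp
  next
    case (insert s A)
    have cs: "c s \<noteq> \<zero>" "s \<in> S" "\<And>x. c x \<in> carrier R" using insert by (auto simp: carrier_free_module)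
    define d where "d = (\<lambda>x. if x = s then \<zero> else c x)"
    have A: "A = {x. d x \<noteq> \<zero>}" using insert.hyps unfolding d_def by auto
    have "d \<in> carrier (free_module R S)"
      using insert.prems insert.hyps(1) A cs by (auto simp: carrier_free_module d_def)
    then have "d \<in> H" using insert.hyps(3)[OF A] by blast
    moreover have "c s \<odot>\<^bsub>free_module R S\<^esub> free_gen R s \<in> H" using E(4) cs gen by blast
    ultimately have "d \<oplus>\<^bsub>free_module R S\<^esub> (c s \<odot>\<^bsub>free_module R S\<^esub> free_gen R s) \<in> H" using E(5) by blast
    moreover have "d \<oplus>\<^bsub>free_module R S\<^esub> (c s \<odot>\<^bsub>free_module R S\<^esub> free_gen R s) = c"
      using cs by (auto simp: d_def free_gen_def fun_eq_iff free_module_simps)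
    ultimately show ?case by simp
  qed
qed

end

locale tensor = M?: module R M + N?: module R N for R (structure) and M (structure) and N (structure)
begin

abbreviation "F \<equiv> free_module R (carrier M \<times> carrier N)"
abbreviation "K \<equiv> tensor_kernel R M N"
abbreviation "T \<equiv> tensor_product R M N"
abbreviation "pure \<equiv> pure_tensor R M N"

sublocale F: module R F by (rule R.module_free_module)

lemma gen_closed: "m \<in> carrier M \<Longrightarrow> n \<in> carrier N \<Longrightarrow> free_gen R (m, n) \<in> carrier F"
  by (rule R.free_gen_closed) simp

lemma tensor_relations_closed: "tensor_relations R M N \<subseteq> carrier F"
  unfolding tensor_relations_def Let_def
  by (auto intro!: F.M.minus_closed F.M.a_closed F.smult_closed gen_closed)

lemma submodule_K: "submodule K R F"
proof (rule F.submoduleI)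
  let ?\<H> = "{H. submodule H R F \<and> tensor_relations R M N \<subseteq> H}"
  have mem: "carrier F \<in> ?\<H>" using F.carrier_is_submodule tensor_relations_closed by blast
  have E: "H \<in> ?\<H> \<Longrightarrow> submodule H R F" for H by simp
  show "K \<subseteq> carrier F" using mem unfolding tensor_kernel_def by blast
  show "\<zero>\<^bsub>F\<^esub> \<in> K" unfolding tensor_kernel_def
    using submodule.axioms(1)[OF E] subgroup.one_closed by fastforce
  show "\<ominus>\<^bsub>F\<^esub> a \<in> K" if "a \<in> K" for a
    using that F.submoduleE(3)[OF E] unfolding tensor_kernel_def by blast
  show "r \<odot>\<^bsub>F\<^esub> a \<in> K" if "r \<in> carrier R" "a \<in> K" for r a
    using that F.submoduleE(4)[OF E] unfolding tensor_kernel_def by blast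
  show "a \<oplus>\<^bsub>F\<^esub> b \<in> K" if "a \<in> K" "b \<in> K" for a b
    using that F.submoduleE(5)[OF E] unfolding tensor_kernel_def by blast
qed

lemma relations_K: "tensor_relations R M N \<subseteq> K" unfolding tensor_kernel_def by blast

sublocale Q: module_quotient R F K
  by (rule module_quotient.intro[OF F.module_axioms module_quotient_axioms.intro[OF submodule_K]])

lemma T_eq: "T = quotient_module R F K"
  by (simp add: tensor_product_def quotient_module_def Let_def)

sublocale T: module R T unfolding T_eq by (rule Q.module_quotient)

lemma pure_eq: "pure m n = Q.\<pi> (free_gen R (m, n))" by (simp add: pure_tensor_def)

lemma pure_closed [simp]: "m \<in> carrier M \<Longrightarrow> n \<in> carrier N \<Longrightarrow> pure m n \<in> carrier T"
  unfolding T_eq Q.carrier_quotient pure_eq using gen_closed by blast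

lemma pure_smult_left:
  assumes "r \<in> carrier R" "m \<in> carrier M" "n \<in> carrier N"
  shows "pure (r \<odot>\<^bsub>M\<^esub> m) n = r \<odot>\<^bsub>T\<^esub> pure m n"
proof -
  have "free_gen R (r \<odot>\<^bsub>M\<^esub> m, n) \<ominus>\<^bsub>F\<^esub> r \<odot>\<^bsub>F\<^esub> free_gen R (m, n) \<in> K"
    by (rule subsetD[OF relations_K]) (use assms in \<open>unfold tensor_relations_def Let_def, blast\<close>)
  then have "Q.\<pi> (free_gen R (r \<odot>\<^bsub>M\<^esub> m, n)) = Q.\<pi> (r \<odot>\<^bsub>F\<^esub> free_gen R (m, n))"
    using assms by (intro Q.\<pi>_eq_if_minus) (auto intro!: gen_closed F.M.a_closed F.smult_closed)
  then show ?thesis unfolding pure_eq T_eq using assms by (simp add: Q.quotient_smult gen_closed)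
qed

lemma pure_smult_right:
  assumes "r \<in> carrier R" "m \<in> carrier M" "n \<in> carrier N"
  shows "pure m (r \<odot>\<^bsub>N\<^esub> n) = r \<odot>\<^bsub>T\<^esub> pure m n"
proof -
  have "free_gen R (m, r \<odot>\<^bsub>N\<^esub> n) \<ominus>\<^bsub>F\<^esub> r \<odot>\<^bsub>F\<^esub> free_gen R (m, n) \<in> K"
    by (rule subsetD[OF relations_K]) (use assms in \<open>unfold tensor_relations_def Let_def, blast\<close>)
  then have "Q.\<pi> (free_gen R (m, r \<odot>\<^bsub>N\<^esub> n)) = Q.\<pi> (r \<odot>\<^bsub>F\<^esub> free_gen R (m, n))"
    using assms by (intro Q.\<pi>_eq_if_minus) (auto intro!: gen_closed F.M.a_closed F.smult_closed)
  then show ?thesis unfolding pure_eq T_eq using assms by (simp add: Q.quotient_smult gen_closed)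
qed

text \<open>The formal sums whose class satisfies \<open>P\<close> form a submodule of the free
  module that contains all generators.\<close>

lemma tensor_induct [consumes 1, case_names pure add smult]:
  assumes z: "z \<in> carrier T"
    and pure: "\<And>m n. m \<in> carrier M \<Longrightarrow> n \<in> carrier N \<Longrightarrow> P (pure m n)"
    and add: "\<And>x y. x \<in> carrier T \<Longrightarrow> y \<in> carrier T \<Longrightarrow> P x \<Longrightarrow> P y \<Longrightarrow> P (x \<oplus>\<^bsub>T\<^esub> y)"
    and smult: "\<And>r x. r \<in> carrier R \<Longrightarrow> x \<in> carrier T \<Longrightarrow> P x \<Longrightarrow> P (r \<odot>\<^bsub>T\<^esub> x)"
  shows "P z"
proof -
  define H where "H = {c \<in> carrier F. P (Q.\<pi> c)}"
  have closed: "Q.\<pi> c \<in> carrier T" if "c \<in> carrier F" for c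
    using that unfolding T_eq Q.carrier_quotient by blast
  have sm: "r \<odot>\<^bsub>F\<^esub> c \<in> H" if "r \<in> carrier R" "c \<in> H" for r c
    using that smult[of r "Q.\<pi> c"] closed[of c] Q.quotient_smult[of r c]
    unfolding H_def T_eq by (auto)
  have gen: "free_gen R (m, n) \<in> H" if "m \<in> carrier M" "n \<in> carrier N" for m n
    using that pure gen_closed unfolding H_def pure_eq by simp
  have "submodule H R F"
  proof (rule F.submoduleI)
    show "H \<subseteq> carrier F" by (auto simp: H_def)
    have "\<zero> \<odot>\<^bsub>F\<^esub> free_gen R (\<zero>\<^bsub>M\<^esub>, \<zero>\<^bsub>N\<^esub>) \<in> H" by (intro sm gen) simp_all
    then show "\<zero>\<^bsub>F\<^esub> \<in> H" using F.smult_l_null[OF gen_closed] by (metis M.M.zero_closed N.M.zero_closed)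
    show "\<ominus>\<^bsub>F\<^esub> c \<in> H" if "c \<in> H" for c
    proof -
      have "c \<in> carrier F" using that by (simp add: H_def)
      then have "(\<ominus> \<one>) \<odot>\<^bsub>F\<^esub> c = \<ominus>\<^bsub>F\<^esub> c" using F.smult_l_minus[OF R.one_closed] F.smult_one by metis
      then show ?thesis using sm[OF _ that, of "\<ominus> \<one>"] by (metis R.a_inv_closed R.one_closed)
    qed
    show "a \<oplus>\<^bsub>F\<^esub> b \<in> H" if "a \<in> H" "b \<in> H" for a b
      using that add[of "Q.\<pi> a" "Q.\<pi> b"] closed[of a] closed[of b] Q.quotient_add[of a b]
      unfolding H_def T_eq by (auto intro: F.M.a_closed)
  qed (rule sm)
  then have "carrier F \<subseteq> H" by (rule R.free_module_generated) (use gen in auto)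
  then show ?thesis using z unfolding T_eq Q.carrier_quotient H_def by blast
qed

end

lemma (in module) unit_smult_iso:
  assumes u: "u \<in> Units R" shows "(\<lambda>z. u \<odot>\<^bsub>M\<^esub> z) \<in> module_isos R M M"
proof -
  have uc: "u \<in> carrier R" "inv u \<in> carrier R" using u by (auto intro: R.Units_closed R.Units_inv_closed)
  have "bij_betw (\<lambda>z. u \<odot>\<^bsub>M\<^esub> z) (carrier M) (carrier M)"
  proof (rule bij_betwI[where g = "\<lambda>z. inv u \<odot>\<^bsub>M\<^esub> z"])
    show "inv u \<odot>\<^bsub>M\<^esub> (u \<odot>\<^bsub>M\<^esub> z) = z" if "z \<in> carrier M" for z
      using that uc smult_assoc1[of "inv u" u z] R.Units_l_inv[OF u] by simp
    show "u \<odot>\<^bsub>M\<^esub> (inv u \<odot>\<^bsub>M\<^esub> z) = z" if "z \<in> carrier M" for z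
      using that uc smult_assoc1[of u "inv u" z] R.Units_r_inv[OF u] by simp
  qed (use uc in auto)
  moreover have "u \<odot>\<^bsub>M\<^esub> (r \<odot>\<^bsub>M\<^esub> z) = r \<odot>\<^bsub>M\<^esub> (u \<odot>\<^bsub>M\<^esub> z)" if "r \<in> carrier R" "z \<in> carrier M" for r z
    using that uc by (simp flip: smult_assoc1 add: R.m_comm)
  ultimately show ?thesis using uc by (auto simp: module_isos_def iso_def hom_def smult_r_distr)
qed

text \<open>The free module of rank one, with elements encoded in the type prescribed for \<open>root_stack_points\<close>.\<close>

definition unit_module :: "('r, 'u) ring_scheme \<Rightarrow> ('r, 'r list set) module"
  where "unit_module R = \<lparr>
    carrier = (\<lambda>r. {[r]}) ` carrier R,
    monoid.mult = undefined,
    monoid.one = undefined,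
    zero = {[\<zero>\<^bsub>R\<^esub>]},
    add = (\<lambda>x y. {[hd (the_elem x) \<oplus>\<^bsub>R\<^esub> hd (the_elem y)]}),
    module.smult = (\<lambda>r x. {[r \<otimes>\<^bsub>R\<^esub> hd (the_elem x)]})\<rparr>"

lemma unit_module_simps [simp]:
  "carrier (unit_module R) = (\<lambda>r. {[r]}) ` carrier R"
  "{[r]} \<oplus>\<^bsub>unit_module R\<^esub> {[s]} = {[r \<oplus>\<^bsub>R\<^esub> s]}"
  "\<zero>\<^bsub>unit_module R\<^esub> = {[\<zero>\<^bsub>R\<^esub>]}"
  "r \<odot>\<^bsub>unit_module R\<^esub> {[s]} = {[r \<otimes>\<^bsub>R\<^esub> s]}"
  by (simp_all add: unit_module_def)

section \<open>Points with trivial bundles\<close>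

context cring
begin

lemma module_unit_module: "module R (unit_module R)"
proof (rule moduleI)
  show "abelian_group (unit_module R)"
  proof (rule abelian_groupI)
    fix x assume "x \<in> carrier (unit_module R)"
    then obtain r where r: "r \<in> carrier R" "x = {[r]}" by auto
    then show "\<exists>y\<in>carrier (unit_module R). y \<oplus>\<^bsub>unit_module R\<^esub> x = \<zero>\<^bsub>unit_module R\<^esub>"
      by (intro bexI[of _ "{[\<ominus> r]}"]) (auto simp: l_neg)
  qed (auto simp: a_ac)
qed (auto simp: cring_axioms l_distr r_distr m_assoc)

lemma line_bundle_unit_module: "line_bundle R (unit_module R)"
  unfolding line_bundle_def
proof (intro conjI exI[of _ "{\<one>}"] ballI bexI[of _ "{[\<one>]}"])
  show "genideal R {\<one>} = carrier R"
    using genideal_self'[of \<one>] genideal_ideal[of "{\<one>}"] by (intro ideal.one_imp_carrier) auto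
  fix x assume "x \<in> carrier (unit_module R)"
  then show "\<exists>n::nat. \<exists>r\<in>carrier R. (g [^] n) \<odot>\<^bsub>unit_module R\<^esub> x = r \<odot>\<^bsub>unit_module R\<^esub> {[\<one>]}" if "g \<in> {\<one>}" for g
    using that by (intro exI[of _ 0]) auto
next
  fix g r assume "g \<in> {\<one>}" "r \<in> carrier R"
  then show "r \<odot>\<^bsub>unit_module R\<^esub> {[\<one>]} = \<zero>\<^bsub>unit_module R\<^esub> \<longrightarrow> (\<exists>n::nat. (g [^] n) \<otimes> r = \<zero>)"
    by auto
qed (auto simp: module_unit_module)

text \<open>Both bundles are taken to be R, with sections x, y and t, and the isomorphism of tensor
  squares is multiplication by u. The relation \<open>unimodular\<close> says that x and y generate
  the bundle.\<close>

theorem root_stack_points_nonempty: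
  assumes disc: "[(2 * disc a b c)] \<cdot> \<one> \<in> Units R"
    and carr: "x \<in> carrier R" "y \<in> carrier R" "r \<in> carrier R" "s \<in> carrier R" "t \<in> carrier R"
    and unimodular: "r \<otimes> x \<oplus> s \<otimes> y = \<one>" and u: "u \<in> Units R"
    and eq: "([a] \<cdot> \<one>) \<otimes> (x \<otimes> x) \<oplus> ([b] \<cdot> \<one>) \<otimes> (x \<otimes> y) \<oplus> ([c] \<cdot> \<one>) \<otimes> (y \<otimes> y) = u \<otimes> (t \<otimes> t)"
  shows "root_stack_points R a b c \<noteq> {}"
proof -
  let ?L = "unit_module R"
  have uc: "u \<in> carrier R" using u by (rule Units_closed)
  have pow: "[k] \<cdot> \<one> \<in> carrier R" for k :: int by (rule add.int_pow_closed[OF one_closed])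
  interpret L: module R ?L by (rule module_unit_module)
  interpret tensor R ?L ?L ..
  have e: "{[\<one>]} \<in> carrier ?L" by simp
  define E where "E = pure {[\<one>]} {[\<one>]}"
  have E: "E \<in> carrier T" unfolding E_def by (rule pure_closed[OF e e])
  \<comment> \<open>The tensor square of R is spanned by \<open>E\<close>, so every identity reduces
    to one between scalars.\<close>
  have pure_E: "pure {[v]} {[w]} = (v \<otimes> w) \<odot>\<^bsub>T\<^esub> E" if "v \<in> carrier R" "w \<in> carrier R" for v w
  proof -
    have "pure {[v]} {[w]} = pure (v \<odot>\<^bsub>?L\<^esub> {[\<one>]}) (w \<odot>\<^bsub>?L\<^esub> {[\<one>]})" using that by simp
    also have "\<dots> = v \<odot>\<^bsub>T\<^esub> pure {[\<one>]} (w \<odot>\<^bsub>?L\<^esub> {[\<one>]})"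
      by (rule pure_smult_left[OF that(1) e L.smult_closed[OF that(2) e]])
    also have "\<dots> = v \<odot>\<^bsub>T\<^esub> (w \<odot>\<^bsub>T\<^esub> E)" unfolding E_def by (simp only: pure_smult_right[OF that(2) e e])
    finally show ?thesis using that E by (simp add: T.smult_assoc1)
  qed
  define P :: "('a, 'a list set) root_object" where
    "P = \<lparr>o1_bundle = ?L, sec_X = {[x]}, sec_Y = {[y]}, root_bundle = ?L, root_sec = {[t]}, root_iso = (\<lambda>z. u \<odot>\<^bsub>T\<^esub> z)\<rparr>"
  have add_pow: "[k] \<cdot>\<^bsub>T\<^esub> (v \<odot>\<^bsub>T\<^esub> E) = (([k] \<cdot> \<one>) \<otimes> v) \<odot>\<^bsub>T\<^esub> E" if "v \<in> carrier R" for k :: int and v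
    using that E by (simp add: T.add_pow_int_smult[of "v \<odot>\<^bsub>T\<^esub> E"] T.smult_assoc1 pow)
  have "P \<in> root_objects R a b c"
    unfolding root_objects_def P_def mem_Collect_eq root_object.simps
  proof (intro conjI ballI)
    fix l assume "l \<in> carrier ?L"
    then obtain v where v: "v \<in> carrier R" "l = {[v]}" by auto
    have "v \<otimes> r \<otimes> x \<oplus> v \<otimes> s \<otimes> y = v \<otimes> (r \<otimes> x \<oplus> s \<otimes> y)" using v carr by (simp add: r_distr m_assoc)
    then have "l = (v \<otimes> r) \<odot>\<^bsub>?L\<^esub> {[x]} \<oplus>\<^bsub>?L\<^esub> (v \<otimes> s) \<odot>\<^bsub>?L\<^esub> {[y]}" using v unimodular by simp
    then show "\<exists>r\<in>carrier R. \<exists>s\<in>carrier R. l = r \<odot>\<^bsub>?L\<^esub> {[x]} \<oplus>\<^bsub>?L\<^esub> s \<odot>\<^bsub>?L\<^esub> {[y]}"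
      using v carr by blast
  next
    show "(\<lambda>z. u \<odot>\<^bsub>T\<^esub> z) \<in> module_isos R (tensor_square R ?L) (tensor_square R ?L)"
      unfolding tensor_square_def by (rule T.unit_smult_iso[OF u])
    have "u \<odot>\<^bsub>T\<^esub> pure {[t]} {[t]} = (u \<otimes> (t \<otimes> t)) \<odot>\<^bsub>T\<^esub> E"
      using carr uc E by (simp add: pure_E T.smult_assoc1)
    also have "\<dots> = pulled_back_form R a b c ?L {[x]} {[y]}"
      unfolding pulled_back_form_def tensor_square_def Let_def eq[symmetric] using carr E
      by (simp add: pure_E add_pow T.smult_l_distr pow)
    finally show "u \<odot>\<^bsub>T\<^esub> pure {[t]} {[t]} = pulled_back_form R a b c ?L {[x]} {[y]}" .
  qed (use disc carr in \<open>auto simp: line_bundle_unit_module\<close>)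
  then show ?thesis unfolding root_stack_points_def quotient_def by blast
qed

end

lemma root_stack_points_empty_iff: "root_stack_points R a b c = {} \<longleftrightarrow> (root_objects R a b c :: ('r, 'r list set) root_object set) = {}"
  by (auto simp: root_stack_points_def quotient_def)

text \<open>The base ring may be any subring of the rationals, since only its operations are
  prescribed. Functionals can therefore take values in the fraction field.\<close>

locale rat_tensor = tensor R M N
  for R :: "(rat, 'u) ring_scheme" (structure) and M :: "(rat, 'm, 'v) module_scheme" (structure)
    and N :: "(rat, 'n, 'w) module_scheme" (structure) +
  assumes ops: "monoid.mult R = times" "ring.add R = (+)" "ring.zero R = 0" "monoid.one R = 1"
begin

definition lin :: "('m \<Rightarrow> 'n \<Rightarrow> rat) \<Rightarrow> ('m \<times> 'n \<Rightarrow> rat) \<Rightarrow> rat"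
  where "lin B c = (\<Sum>x | c x \<noteq> 0. c x * B (fst x) (snd x))"

lemma finite_support: "c \<in> carrier F \<Longrightarrow> finite {x. c x \<noteq> 0}"
  by (simp add: carrier_free_module ops)

lemma lin_eq: "finite A \<Longrightarrow> {x. c x \<noteq> 0} \<subseteq> A \<Longrightarrow> lin B c = (\<Sum>x\<in>A. c x * B (fst x) (snd x))"
  unfolding lin_def by (rule sum.mono_neutral_left) auto

lemma lin_add:
  assumes "c \<in> carrier F" "d \<in> carrier F" shows "lin B (c \<oplus>\<^bsub>F\<^esub> d) = lin B c + lin B d"
proof -
  let ?A = "{x. c x \<noteq> 0} \<union> {x. d x \<noteq> 0}"
  have A: "finite ?A" using assms finite_support by blast
  have "lin B (c \<oplus>\<^bsub>F\<^esub> d) = (\<Sum>x\<in>?A. (c x + d x) * B (fst x) (snd x))"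
    by (subst lin_eq[OF A]) (auto simp: free_module_simps ops)
  also have "\<dots> = lin B c + lin B d"
    by (subst (1 2) lin_eq[OF A]) (auto simp: distrib_right sum.distrib)
  finally show ?thesis .
qed

lemma lin_smult:
  assumes "c \<in> carrier F" shows "lin B (r \<odot>\<^bsub>F\<^esub> c) = r * lin B c"
proof -
  have A: "finite {x. c x \<noteq> 0}" using assms finite_support by blast
  have "lin B (r \<odot>\<^bsub>F\<^esub> c) = (\<Sum>x | c x \<noteq> 0. r * c x * B (fst x) (snd x))"
    by (subst lin_eq[OF A]) (auto simp: free_module_simps ops)
  then show ?thesis by (simp add: lin_def sum_distrib_left mult.assoc)
qed

lemma lin_gen: "lin B (free_gen R (m, n)) = B m n"
  by (subst lin_eq[of "{(m, n)}"]) (auto simp: free_gen_def ops)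

lemma lin_minus:
  assumes "c \<in> carrier F" "d \<in> carrier F" shows "lin B (c \<ominus>\<^bsub>F\<^esub> d) = lin B c - lin B d"
proof -
  have "lin B (c \<ominus>\<^bsub>F\<^esub> d \<oplus>\<^bsub>F\<^esub> d) = lin B (c \<ominus>\<^bsub>F\<^esub> d) + lin B d" using assms by (intro lin_add) auto
  moreover have "c \<ominus>\<^bsub>F\<^esub> d \<oplus>\<^bsub>F\<^esub> d = c"
    using assms unfolding a_minus_def by (simp add: F.M.a_assoc F.M.l_neg)
  ultimately show ?thesis by simp
qed

text \<open>The universal property for bilinear maps with rational values. The kernel of
  \<open>lin B\<close> is a submodule containing the bilinearity relations, hence contains
  \<open>K\<close>, so \<open>lin B\<close> is constant on cosets.\<close>

theorem tensor_functional:
  fixes B :: "'m \<Rightarrow> 'n \<Rightarrow> rat"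
  assumes "\<And>m m' n. m \<in> carrier M \<Longrightarrow> m' \<in> carrier M \<Longrightarrow> n \<in> carrier N \<Longrightarrow> B (m \<oplus>\<^bsub>M\<^esub> m') n = B m n + B m' n"
    "\<And>m n n'. m \<in> carrier M \<Longrightarrow> n \<in> carrier N \<Longrightarrow> n' \<in> carrier N \<Longrightarrow> B m (n \<oplus>\<^bsub>N\<^esub> n') = B m n + B m n'"
    "\<And>r m n. r \<in> carrier R \<Longrightarrow> m \<in> carrier M \<Longrightarrow> n \<in> carrier N \<Longrightarrow> B (r \<odot>\<^bsub>M\<^esub> m) n = r * B m n"
    "\<And>r m n. r \<in> carrier R \<Longrightarrow> m \<in> carrier M \<Longrightarrow> n \<in> carrier N \<Longrightarrow> B m (r \<odot>\<^bsub>N\<^esub> n) = r * B m n"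
  obtains \<Lambda> where "\<And>z w. z \<in> carrier T \<Longrightarrow> w \<in> carrier T \<Longrightarrow> \<Lambda> (z \<oplus>\<^bsub>T\<^esub> w) = \<Lambda> z + \<Lambda> w"
    "\<And>r z. r \<in> carrier R \<Longrightarrow> z \<in> carrier T \<Longrightarrow> \<Lambda> (r \<odot>\<^bsub>T\<^esub> z) = r * \<Lambda> z"
    "\<And>m n. m \<in> carrier M \<Longrightarrow> n \<in> carrier N \<Longrightarrow> \<Lambda> (pure m n) = B m n"
proof -
  define H where "H = {c \<in> carrier F. lin B c = 0}"
  have "submodule H R F"
  proof (rule F.submoduleI)
    have "lin B (0 \<odot>\<^bsub>F\<^esub> \<zero>\<^bsub>F\<^esub>) = 0" using lin_smult[OF F.M.zero_closed, of B 0] by simp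
    then show "\<zero>\<^bsub>F\<^esub> \<in> H" using F.smult_l_null[OF F.M.zero_closed] by (simp add: H_def ops)
    show "\<ominus>\<^bsub>F\<^esub> c \<in> H" if "c \<in> H" for c
    proof -
      have c: "c \<in> carrier F" "lin B c = 0" using that by (auto simp: H_def)
      have "lin B (c \<ominus>\<^bsub>F\<^esub> c \<ominus>\<^bsub>F\<^esub> c) = 0" using c lin_minus by (simp add: lin_minus)
      moreover have "c \<ominus>\<^bsub>F\<^esub> c \<ominus>\<^bsub>F\<^esub> c = \<ominus>\<^bsub>F\<^esub> c" using c unfolding a_minus_def by (simp add: F.M.r_neg)
      ultimately show ?thesis using c by (simp add: H_def)
    qed
  qed (auto simp: H_def lin_add lin_smult)
  moreover have "tensor_relations R M N \<subseteq> H"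
    unfolding tensor_relations_def Let_def H_def using assms
    by (auto simp: lin_minus lin_add lin_smult lin_gen gen_closed)
  ultimately have "K \<subseteq> H" unfolding tensor_kernel_def by blast
  then have K: "lin B h = 0" if "h \<in> K" for h using that by (auto simp: H_def)
  define \<Lambda> where "\<Lambda> z = lin B (SOME c. c \<in> carrier F \<and> z = Q.\<pi> c)" for z
  have \<Lambda>: "\<Lambda> (Q.\<pi> c) = lin B c" if c: "c \<in> carrier F" for c
  proof -
    let ?d = "SOME d. d \<in> carrier F \<and> Q.\<pi> c = Q.\<pi> d"
    have d: "?d \<in> carrier F" "Q.\<pi> c = Q.\<pi> ?d"
      using someI[of "\<lambda>d. d \<in> carrier F \<and> Q.\<pi> c = Q.\<pi> d" c] c by auto
    obtain h where h: "h \<in> K" "c = h \<oplus>\<^bsub>F\<^esub> ?d" using Q.\<pi>_eqD[OF c d(2)] by blast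
    then have "lin B c = lin B ?d" using lin_add[OF Q.H_closed[OF h(1)] d(1), of B] K by simp
    then show ?thesis by (simp add: \<Lambda>_def)
  qed
  show ?thesis
  proof
    fix z w assume "z \<in> carrier T" "w \<in> carrier T"
    then obtain c d where "c \<in> carrier F" "d \<in> carrier F" "z = Q.\<pi> c" "w = Q.\<pi> d"
      unfolding T_eq Q.carrier_quotient by blast
    then show "\<Lambda> (z \<oplus>\<^bsub>T\<^esub> w) = \<Lambda> z + \<Lambda> w"
      unfolding T_eq by (simp add: Q.quotient_add \<Lambda> lin_add F.M.a_closed)
  next
    fix r z assume "r \<in> carrier R" "z \<in> carrier T"
    then obtain c where "c \<in> carrier F" "z = Q.\<pi> c" "r \<in> carrier R"
      unfolding T_eq Q.carrier_quotient by blast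
    then show "\<Lambda> (r \<odot>\<^bsub>T\<^esub> z) = r * \<Lambda> z"
      unfolding T_eq by (simp add: Q.quotient_smult \<Lambda> lin_smult)
  next
    fix m n assume "m \<in> carrier M" "n \<in> carrier N"
    then show "\<Lambda> (pure m n) = B m n" by (simp add: pure_eq \<Lambda> gen_closed lin_gen)
  qed
qed

end

section \<open>Line bundles over \<open>\<int>[1/m]\<close>\<close>

locale localization =
  fixes m :: int
  assumes m_nonzero: "m \<noteq> 0"
begin

section \<open>Arithmetic of the base ring\<close>

abbreviation "R \<equiv> localized_integers m"

lemma ops: "monoid.mult R = times" "ring.add R = (+)" "ring.zero R = 0" "monoid.one R = 1"
  by (auto simp: localized_integers_def ring_of_type_algebra_def fun_eq_iff)

lemma mem_R: "r \<in> carrier R \<longleftrightarrow> (\<exists>(z::int) (n::nat). r = of_int z / of_int m ^ n)"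
  by (simp add: localized_integers_def)

lemma of_int_R: "of_int k \<in> carrier R"
  unfolding mem_R by (intro exI[of _ k] exI[of _ 0]) simp

lemma R_add: "r \<in> carrier R \<Longrightarrow> s \<in> carrier R \<Longrightarrow> r + s \<in> carrier R"
proof -
  assume "r \<in> carrier R" "s \<in> carrier R"
  then obtain z n z' n' where rs: "r = of_int z / of_int m ^ n" "s = of_int z' / of_int m ^ n'" unfolding mem_R by blast
  have "r + s = of_int (z * m ^ n' + z' * m ^ n) / of_int m ^ (n + n')"
    unfolding rs using m_nonzero by (simp add: add_frac_eq power_add)
  then show ?thesis unfolding mem_R by blast
qed

lemma R_mult: "r \<in> carrier R \<Longrightarrow> s \<in> carrier R \<Longrightarrow> r * s \<in> carrier R"
proof -
  assume "r \<in> carrier R" "s \<in> carrier R"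
  then obtain z n z' n' where "r = of_int z / of_int m ^ n" "s = of_int z' / of_int m ^ n'" unfolding mem_R by blast
  then have "r * s = of_int (z * z') / of_int m ^ (n + n')" by (simp add: power_add)
  then show ?thesis unfolding mem_R by blast
qed

lemma R_uminus: "r \<in> carrier R \<Longrightarrow> - r \<in> carrier R"
  using R_mult[OF of_int_R[of "-1"]] by simp

lemma cring_R: "cring R"
proof (rule cringI)
  show "abelian_group R"
  proof (rule abelian_groupI)
    fix x assume "x \<in> carrier R"
    then show "\<exists>y\<in>carrier R. y \<oplus>\<^bsub>R\<^esub> x = \<zero>\<^bsub>R\<^esub>"
      by (intro bexI[of _ "- x"]) (simp_all add: ops R_uminus)
  qed (use of_int_R[of 0] in \<open>simp_all add: ops R_add\<close>)
  show "Group.comm_monoid R"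
    by (rule comm_monoidI) (use of_int_R[of 1] in \<open>simp_all add: ops R_mult\<close>)
qed (simp add: ops distrib_right)

sublocale R: cring R by (rule cring_R)

lemma add_pow_R: "[k] \<cdot>\<^bsub>R\<^esub> \<one>\<^bsub>R\<^esub> = of_int (k::int)"
  by (rule R.add_pow_int_eqI) (simp_all add: ops of_int_R)

lemma nat_pow_R: "g [^]\<^bsub>R\<^esub> (n::nat) = g ^ n"
  by (induction n) (simp_all add: ops mult.commute)

lemma R_pow: "g \<in> carrier R \<Longrightarrow> g ^ n \<in> carrier R"
  using R.nat_pow_closed[of g n] by (simp add: nat_pow_R)

lemma UnitsI: "u \<in> carrier R \<Longrightarrow> 1 / u \<in> carrier R \<Longrightarrow> u \<noteq> 0 \<Longrightarrow> u \<in> Units R"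
  by (auto simp: Units_def ops intro!: bexI[of _ "1 / u"])

lemma inverse_m_R: "1 / of_int m \<in> carrier R"
  unfolding mem_R by (intro exI[of _ 1] exI[of _ 1]) simp

lemma abs_le_1:
  assumes "padic l" "\<not> int l dvd m" "r \<in> carrier R" shows "padic_abs l r \<le> 1"
proof -
  interpret padic l by fact
  obtain z n where r: "r = of_int z / of_int m ^ n" using assms(3) mem_R by blast
  then show ?thesis using absp_int_eq_1[OF assms(2)] absp_int_le_1[of z]
    unfolding r by (simp add: absp_divide absp_power)
qed

text \<open>Otherwise \<open>G\<close> would lie in the prime ideal of elements of absolute value
  less than 1, and could not generate the unit ideal.\<close>

lemma cover:
  assumes G: "G \<subseteq> carrier R" "genideal R G = carrier R" and l: "padic l" "\<not> int l dvd m"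
  shows "\<exists>g\<in>G. padic_abs l g = 1"
proof (rule ccontr)
  interpret padic l by fact
  assume "\<not> (\<exists>g\<in>G. padic_abs l g = 1)"
  then have G1: "absp g < 1" if "g \<in> G" for g using that G(1) abs_le_1[OF l, of g] by force
  define P where "P = {r \<in> carrier R. absp r < 1}"
  have "ideal P R"
  proof (rule idealI)
    show "ring R" by (rule R.ring_axioms)
    show "subgroup P (add_monoid R)"
    proof (rule group.subgroupI[OF R.a_group])
      show "P \<noteq> {}" using of_int_R[of 0] by (auto simp: P_def intro!: exI[of _ 0])
    next
      fix r assume r: "r \<in> P"
      have "inv\<^bsub>add_monoid R\<^esub> r = - r"
        by (rule group.inv_equality[OF R.a_group]) (use r in \<open>auto simp: P_def ops R_uminus\<close>)
      then show "inv\<^bsub>add_monoid R\<^esub> r \<in> P" using r by (simp add: P_def R_uminus)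
    qed (auto simp: P_def ops R_add absp_add_less)
    have "absp (r * s) < 1" if "absp r \<le> 1" "absp s < 1" for r s
      using mult_right_mono[OF that(1) absp_nonneg[of s]] that(2) by (simp add: absp_mult)
    then show "x \<otimes>\<^bsub>R\<^esub> a \<in> P" "a \<otimes>\<^bsub>R\<^esub> x \<in> P" if "a \<in> P" "x \<in> carrier R" for a x
      using that abs_le_1[OF l, of x] by (auto simp: P_def ops R_mult mult.commute[of a x])
  qed
  moreover have "G \<subseteq> P" using G G1 by (auto simp: P_def)
  ultimately have "genideal R G \<subseteq> P" by (rule R.genideal_minimal)
  then have "1 \<in> P" using G(2) of_int_R[of 1] by auto
  then show False by (simp add: P_def)
qed

text \<open>One prime of the base ring is enough to select a nonzero element of a cover, namely one
  of absolute value 1 there.\<close>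

lemma ex_coprime_prime: "\<exists>l. padic l \<and> \<not> int l dvd m"
proof -
  obtain l where l: "prim l" "nat \<bar>m\<bar> < l" using bigger_prime by blast
  then have "\<not> int l dvd m" using m_nonzero zdvd_imp_le[of "int l" "\<bar>m\<bar>"] by auto
  then show ?thesis using l(1) by (auto intro: padic.intro)
qed

text \<open>
  A map of a line bundle to its generic fibre, with basis \<open>e\<close>. At each prime of the base ring a local
  generator has the largest absolute value.
\<close>

definition coordinate :: "(rat, 'b, 'c) module_scheme \<Rightarrow> ('b \<Rightarrow> rat) \<Rightarrow> 'b \<Rightarrow> bool"
  where "coordinate M \<phi> e \<longleftrightarrow>
    (\<forall>x\<in>carrier M. \<forall>y\<in>carrier M. \<phi> (x \<oplus>\<^bsub>M\<^esub> y) = \<phi> x + \<phi> y) \<and>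
    (\<forall>r\<in>carrier R. \<forall>x\<in>carrier M. \<phi> (r \<odot>\<^bsub>M\<^esub> x) = r * \<phi> x) \<and>
    e \<in> carrier M \<and> \<phi> e = 1 \<and>
    (\<forall>x\<in>carrier M. \<exists>s\<in>carrier R. s \<noteq> 0 \<and> s * \<phi> x \<in> carrier R \<and> s \<odot>\<^bsub>M\<^esub> x = (s * \<phi> x) \<odot>\<^bsub>M\<^esub> e) \<and>
    (\<forall>l. padic l \<and> \<not> int l dvd m \<longrightarrow>
      (\<exists>f\<in>carrier M. \<phi> f \<noteq> 0 \<and> (\<forall>x\<in>carrier M. padic_abs l (\<phi> x) \<le> padic_abs l (\<phi> f))))"

lemma coordinateD:
  assumes "coordinate M \<phi> e"
  shows "x \<in> carrier M \<Longrightarrow> y \<in> carrier M \<Longrightarrow> \<phi> (x \<oplus>\<^bsub>M\<^esub> y) = \<phi> x + \<phi> y"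
    "r \<in> carrier R \<Longrightarrow> x \<in> carrier M \<Longrightarrow> \<phi> (r \<odot>\<^bsub>M\<^esub> x) = r * \<phi> x"
    "e \<in> carrier M" "\<phi> e = 1"
    "x \<in> carrier M \<Longrightarrow> \<exists>s\<in>carrier R. s \<noteq> 0 \<and> s * \<phi> x \<in> carrier R \<and> s \<odot>\<^bsub>M\<^esub> x = (s * \<phi> x) \<odot>\<^bsub>M\<^esub> e"
    "padic l \<Longrightarrow> \<not> int l dvd m \<Longrightarrow>
      \<exists>f\<in>carrier M. \<phi> f \<noteq> 0 \<and> (\<forall>x\<in>carrier M. padic_abs l (\<phi> x) \<le> padic_abs l (\<phi> f))"
  using assms unfolding coordinate_def by blast+

text \<open>A generator e over one nonempty basic open set is a basis of the generic fibre, and the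
  coordinate is the quotient with respect to e. At a prime l, a cover element h of absolute value 1
  has a local generator f; from h^n x = r f and |r| at most 1 follows that f has the largest
  coordinate.\<close>

lemma line_bundle_coordinate:
  assumes "line_bundle R M" obtains \<phi> e where "coordinate M \<phi> e"
proof -
  obtain G where M: "module R M" and G: "G \<subseteq> carrier R" "genideal R G = carrier R"
    "\<forall>g\<in>G. \<exists>e\<in>carrier M. (\<forall>x\<in>carrier M. \<exists>n::nat. \<exists>r\<in>carrier R. (g [^]\<^bsub>R\<^esub> n) \<odot>\<^bsub>M\<^esub> x = r \<odot>\<^bsub>M\<^esub> e) \<and>
      (\<forall>r\<in>carrier R. r \<odot>\<^bsub>M\<^esub> e = \<zero>\<^bsub>M\<^esub> \<longrightarrow> (\<exists>n::nat. (g [^]\<^bsub>R\<^esub> n) \<otimes>\<^bsub>R\<^esub> r = \<zero>\<^bsub>R\<^esub>))"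
    using assms unfolding line_bundle_def by blast
  interpret M: module R M by (rule M)
  obtain l0 where l0: "padic l0" "\<not> int l0 dvd m" using ex_coprime_prime by blast
  obtain g where g: "g \<in> G" "padic_abs l0 g = 1" using cover[OF G(1,2) l0] by blast
  have g0: "g \<noteq> 0" "g \<in> carrier R" using g padic.absp_0[OF l0(1)] G(1) by auto
  \<comment> \<open>As g is nonzero, g^n r = 0 forces r = 0, so e has zero annihilator in R
    itself.\<close>
  obtain e where e: "e \<in> carrier M" "\<And>x. x \<in> carrier M \<Longrightarrow> \<exists>n. \<exists>r\<in>carrier R. g ^ n \<odot>\<^bsub>M\<^esub> x = r \<odot>\<^bsub>M\<^esub> e"
    "\<And>r. r \<in> carrier R \<Longrightarrow> r \<odot>\<^bsub>M\<^esub> e = \<zero>\<^bsub>M\<^esub> \<Longrightarrow> r = 0"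
    using bspec[OF G(3) g(1)] g0(1) by (auto simp: nat_pow_R ops)
  \<comment> \<open>The coordinate w is a fraction, so the equation x = w e is stated after
    multiplication by a denominator s.\<close>
  define coord where "coord x w \<longleftrightarrow> (\<exists>s\<in>carrier R. s \<noteq> 0 \<and> s * w \<in> carrier R \<and> s \<odot>\<^bsub>M\<^esub> x = (s * w) \<odot>\<^bsub>M\<^esub> e)" for x w
  have smult: "(r * s) \<odot>\<^bsub>M\<^esub> x = r \<odot>\<^bsub>M\<^esub> (s \<odot>\<^bsub>M\<^esub> x)" if "r \<in> carrier R" "s \<in> carrier R" "x \<in> carrier M" for r s x
    using M.smult_assoc1[OF that] by (simp add: ops)
  have ex: "\<exists>w. coord x w" if x: "x \<in> carrier M" for x
  proof -
    obtain n r where "r \<in> carrier R" "g ^ n \<odot>\<^bsub>M\<^esub> x = r \<odot>\<^bsub>M\<^esub> e" using e(2)[OF x] by blast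
    then show ?thesis unfolding coord_def using g0 R_pow[of g n]
      by (intro exI[of _ "r / g ^ n"] bexI[of _ "g ^ n"]) auto
  qed
  have uniq: "w = w'" if x: "x \<in> carrier M" and w: "coord x w" and w': "coord x w'" for x w w'
  proof -
    obtain s where s: "s \<in> carrier R" "s \<noteq> 0" "s * w \<in> carrier R" "s \<odot>\<^bsub>M\<^esub> x = (s * w) \<odot>\<^bsub>M\<^esub> e"
      using w coord_def by blast
    obtain s' where s': "s' \<in> carrier R" "s' \<noteq> 0" "s' * w' \<in> carrier R" "s' \<odot>\<^bsub>M\<^esub> x = (s' * w') \<odot>\<^bsub>M\<^esub> e"
      using w' coord_def by blast
    have "(s' * (s * w)) \<odot>\<^bsub>M\<^esub> e = (s * s') \<odot>\<^bsub>M\<^esub> x" using s s' x e(1) smult by (metis mult.commute)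
    also have "\<dots> = (s * (s' * w')) \<odot>\<^bsub>M\<^esub> e" using s s' x e(1) smult by metis
    finally have eq: "(s' * (s * w)) \<odot>\<^bsub>M\<^esub> e = (s * (s' * w')) \<odot>\<^bsub>M\<^esub> e" .
    have c: "s' * (s * w) \<in> carrier R" "s * (s' * w') \<in> carrier R" using s s' R_mult by auto
    have m1: "- 1 \<in> carrier R" using of_int_R[of "-1"] by simp
    have "(s' * (s * w) + (- 1) * (s * (s' * w'))) \<odot>\<^bsub>M\<^esub> e = \<zero>\<^bsub>M\<^esub>"
    proof -
      have "(s' * (s * w) + (- 1) * (s * (s' * w'))) \<odot>\<^bsub>M\<^esub> e = (s' * (s * w)) \<odot>\<^bsub>M\<^esub> e \<oplus>\<^bsub>M\<^esub> (- 1) \<odot>\<^bsub>M\<^esub> ((s * (s' * w')) \<odot>\<^bsub>M\<^esub> e)"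
        using M.smult_l_distr[OF c(1) R_mult[OF m1 c(2)] e(1)] smult[OF m1 c(2) e(1)] by (simp add: ops)
      also have "\<dots> = (1 + (- 1)) \<odot>\<^bsub>M\<^esub> ((s * (s' * w')) \<odot>\<^bsub>M\<^esub> e)"
        using M.smult_l_distr[OF R.one_closed m1 M.smult_closed[OF c(2) e(1)]] M.smult_one[OF M.smult_closed[OF c(2) e(1)]]
        unfolding eq by (simp add: ops)
      finally show ?thesis using M.smult_l_null[OF M.smult_closed[OF c(2) e(1)]] by (simp add: ops)
    qed
    then have "s' * (s * w) + (- 1) * (s * (s' * w')) = 0"
      by (rule e(3)[OF R_add[OF c(1) R_mult[OF m1 c(2)]]])
    then show ?thesis using s(2) s'(2) by simp
  qed
  define \<phi> where "\<phi> x = (THE w. coord x w)" for x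
  have \<phi>: "coord x (\<phi> x)" if "x \<in> carrier M" for x
    unfolding \<phi>_def using ex[OF that] uniq[OF that] by (metis theI)
  have \<phi>_eqI: "\<phi> x = w" if "x \<in> carrier M" "coord x w" for x w
    using uniq[OF that(1) \<phi>[OF that(1)] that(2)] .
  have add: "\<phi> (x \<oplus>\<^bsub>M\<^esub> y) = \<phi> x + \<phi> y" if x: "x \<in> carrier M" and y: "y \<in> carrier M" for x y
  proof (rule \<phi>_eqI)
    obtain s where s: "s \<in> carrier R" "s \<noteq> 0" "s * \<phi> x \<in> carrier R" "s \<odot>\<^bsub>M\<^esub> x = (s * \<phi> x) \<odot>\<^bsub>M\<^esub> e"
      using \<phi>[OF x] coord_def by blast
    obtain s' where s': "s' \<in> carrier R" "s' \<noteq> 0" "s' * \<phi> y \<in> carrier R" "s' \<odot>\<^bsub>M\<^esub> y = (s' * \<phi> y) \<odot>\<^bsub>M\<^esub> e"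
      using \<phi>[OF y] coord_def by blast
    have c: "s' * (s * \<phi> x) \<in> carrier R" "s * (s' * \<phi> y) \<in> carrier R" "s * s' \<in> carrier R" using s s' R_mult by auto
    have "(s * s') \<odot>\<^bsub>M\<^esub> (x \<oplus>\<^bsub>M\<^esub> y) = (s' * s) \<odot>\<^bsub>M\<^esub> x \<oplus>\<^bsub>M\<^esub> (s * s') \<odot>\<^bsub>M\<^esub> y"
      using M.smult_r_distr[OF c(3) x y] by (simp add: mult.commute)
    also have "\<dots> = (s' * (s * \<phi> x)) \<odot>\<^bsub>M\<^esub> e \<oplus>\<^bsub>M\<^esub> (s * (s' * \<phi> y)) \<odot>\<^bsub>M\<^esub> e"
      by (simp only: smult s s' x y e(1))
    also have "\<dots> = (s' * (s * \<phi> x) + s * (s' * \<phi> y)) \<odot>\<^bsub>M\<^esub> e"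
      using M.smult_l_distr[OF c(1,2) e(1)] by (simp add: ops)
    also have "s' * (s * \<phi> x) + s * (s' * \<phi> y) = s * s' * (\<phi> x + \<phi> y)" by (simp add: algebra_simps)
    finally show "coord (x \<oplus>\<^bsub>M\<^esub> y) (\<phi> x + \<phi> y)"
      unfolding coord_def using s(2) s'(2) c R_add[OF c(1,2)] by (intro bexI[of _ "s * s'"]) (auto simp: algebra_simps)
  qed (use x y in simp)
  have sm: "\<phi> (r \<odot>\<^bsub>M\<^esub> x) = r * \<phi> x" if r: "r \<in> carrier R" and x: "x \<in> carrier M" for r x
  proof (rule \<phi>_eqI)
    obtain s where s: "s \<in> carrier R" "s \<noteq> 0" "s * \<phi> x \<in> carrier R" "s \<odot>\<^bsub>M\<^esub> x = (s * \<phi> x) \<odot>\<^bsub>M\<^esub> e"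
      using \<phi>[OF x] coord_def by blast
    have "s \<odot>\<^bsub>M\<^esub> (r \<odot>\<^bsub>M\<^esub> x) = r \<odot>\<^bsub>M\<^esub> (s \<odot>\<^bsub>M\<^esub> x)" using smult[OF s(1) r x] smult[OF r s(1) x] by (simp add: mult.commute)
    also have "\<dots> = (r * (s * \<phi> x)) \<odot>\<^bsub>M\<^esub> e" using r s(3) e(1) unfolding s(4) by (simp add: smult)
    finally show "coord (r \<odot>\<^bsub>M\<^esub> x) (r * \<phi> x)"
      unfolding coord_def using s r R_mult[OF r s(3)] by (intro bexI[of _ s]) (auto simp: mult.left_commute)
  qed (use r x in simp)
  have \<phi>e: "\<phi> e = 1"
    using e(1) of_int_R[of 1] by (intro \<phi>_eqI) (auto simp: coord_def intro!: bexI[of _ 1])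
  have "\<exists>f\<in>carrier M. \<phi> f \<noteq> 0 \<and> (\<forall>x\<in>carrier M. padic_abs l (\<phi> x) \<le> padic_abs l (\<phi> f))"
    if l: "padic l" "\<not> int l dvd m" for l
  proof -
    interpret l: padic l by fact
    obtain h where h: "h \<in> G" "padic_abs l h = 1" using cover[OF G(1,2) l] by blast
    have hR: "h \<in> carrier R" using h G(1) by auto
    obtain f where f: "f \<in> carrier M" "\<And>x. x \<in> carrier M \<Longrightarrow> \<exists>n. \<exists>r\<in>carrier R. h ^ n \<odot>\<^bsub>M\<^esub> x = r \<odot>\<^bsub>M\<^esub> f"
      using bspec[OF G(3) h(1)] by (auto simp: nat_pow_R)
    have le: "padic_abs l (\<phi> x) \<le> padic_abs l (\<phi> f)" if x: "x \<in> carrier M" for x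
    proof -
      obtain n r where r: "r \<in> carrier R" "h ^ n \<odot>\<^bsub>M\<^esub> x = r \<odot>\<^bsub>M\<^esub> f" using f(2)[OF x] by blast
      have "h ^ n * \<phi> x = r * \<phi> f" using arg_cong[OF r(2), of \<phi>] sm R_pow[OF hR] x r(1) f(1) by simp
      then have "padic_abs l (h ^ n * \<phi> x) = padic_abs l (r * \<phi> f)" by simp
      then have "padic_abs l (\<phi> x) = padic_abs l r * padic_abs l (\<phi> f)"
        using h(2) by (simp add: l.absp_mult l.absp_power)
      then show ?thesis using mult_right_mono[OF abs_le_1[OF l r(1)] l.absp_nonneg[of "\<phi> f"]] by simp
    qed
    have "\<phi> f \<noteq> 0" using le[OF e(1)] \<phi>e by auto
    then show ?thesis using f(1) le by blast
  qed
  then have "coordinate M \<phi> e"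
    using add sm e(1) \<phi>e \<phi> unfolding coordinate_def coord_def by blast
  then show ?thesis by (rule that)
qed

end

lemma module_isos_add:
  "\<psi> \<in> module_isos R M N \<Longrightarrow> x \<in> carrier M \<Longrightarrow> y \<in> carrier M \<Longrightarrow> \<psi> (x \<oplus>\<^bsub>M\<^esub> y) = \<psi> x \<oplus>\<^bsub>N\<^esub> \<psi> y"
  by (auto simp: module_isos_def iso_def hom_def)

lemma module_isos_smult:
  "\<psi> \<in> module_isos R M N \<Longrightarrow> r \<in> carrier R \<Longrightarrow> x \<in> carrier M \<Longrightarrow> \<psi> (r \<odot>\<^bsub>M\<^esub> x) = r \<odot>\<^bsub>N\<^esub> \<psi> x"
  by (auto simp: module_isos_def)

lemma module_isos_bij: "\<psi> \<in> module_isos R M N \<Longrightarrow> bij_betw \<psi> (carrier M) (carrier N)"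
  by (auto simp: module_isos_def iso_def)

section \<open>Points and rational solutions\<close>

context localization
begin

text \<open>In coordinates of the generic fibres the isomorphism of tensor squares becomes
  multiplication by a rational \<rho>, and its condition on sections becomes the equation. At a
  prime of the base, the largest absolute values on the two tensor squares are |\<rho>| times a
  square and a square; the isomorphism forces them to agree.\<close>

theorem rational_solution_if_point:
  assumes P: "P \<in> root_objects R a b c"
  obtains \<rho> x y t where "\<rho> \<noteq> 0" "(x, y) \<noteq> (0, 0)" "of_int a * x\<^sup>2 + of_int b * x * y + of_int c * y\<^sup>2 = \<rho> * t\<^sup>2"
    "\<And>l. padic l \<Longrightarrow> \<not> int l dvd m \<Longrightarrow> \<exists>s. s \<noteq> 0 \<and> padic_abs l \<rho> = (padic_abs l s)\<^sup>2"
proof -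
  define L where "L = o1_bundle P"
  define M where "M = root_bundle P"
  define \<psi> where "\<psi> = root_iso P"
  have P': "line_bundle R L" "sec_X P \<in> carrier L" "sec_Y P \<in> carrier L"
    "\<forall>l\<in>carrier L. \<exists>r\<in>carrier R. \<exists>s\<in>carrier R. l = r \<odot>\<^bsub>L\<^esub> sec_X P \<oplus>\<^bsub>L\<^esub> s \<odot>\<^bsub>L\<^esub> sec_Y P"
    "line_bundle R M" "root_sec P \<in> carrier M"
    "\<psi> \<in> module_isos R (tensor_product R M M) (tensor_product R L L)"
    "\<psi> (pure_tensor R M M (root_sec P) (root_sec P)) = pulled_back_form R a b c L (sec_X P) (sec_Y P)"
    using P unfolding root_objects_def L_def M_def \<psi>_def tensor_square_def by auto
  interpret L: module R L using P'(1) by (simp add: line_bundle_def)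
  interpret M: module R M using P'(5) by (simp add: line_bundle_def)
  interpret TL: rat_tensor R L L by unfold_locales (simp_all add: ops)
  interpret TM: rat_tensor R M M by unfold_locales (simp_all add: ops)
  obtain \<phi> e where "coordinate M \<phi> e" using line_bundle_coordinate[OF P'(5)] .
  note \<phi> = coordinateD[OF this]
  obtain \<phi>' e' where "coordinate L \<phi>' e'" using line_bundle_coordinate[OF P'(1)] .
  note \<phi>' = coordinateD[OF this]
  obtain \<Lambda> where \<Lambda>: "\<And>z w. z \<in> carrier TL.T \<Longrightarrow> w \<in> carrier TL.T \<Longrightarrow> \<Lambda> (z \<oplus>\<^bsub>TL.T\<^esub> w) = \<Lambda> z + \<Lambda> w"
    "\<And>r z. r \<in> carrier R \<Longrightarrow> z \<in> carrier TL.T \<Longrightarrow> \<Lambda> (r \<odot>\<^bsub>TL.T\<^esub> z) = r * \<Lambda> z"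
    "\<And>m n. m \<in> carrier L \<Longrightarrow> n \<in> carrier L \<Longrightarrow> \<Lambda> (TL.pure m n) = \<phi>' m * \<phi>' n"
    by (rule TL.tensor_functional[of "\<lambda>m n. \<phi>' m * \<phi>' n"]) (auto simp: \<phi>' algebra_simps)
  have bij: "bij_betw \<psi> (carrier TM.T) (carrier TL.T)" by (rule module_isos_bij[OF P'(7)])
  have \<psi>_closed: "\<psi> z \<in> carrier TL.T" if "z \<in> carrier TM.T" for z using bij that by (auto simp: bij_betw_def)
  have surj: "\<exists>z\<in>carrier TM.T. \<psi> z = w" if "w \<in> carrier TL.T" for w
    using bij that unfolding bij_betw_def by (metis imageE)
  define \<Psi> where "\<Psi> z = \<Lambda> (\<psi> z)" for z
  have \<Psi>_add: "\<Psi> (z \<oplus>\<^bsub>TM.T\<^esub> w) = \<Psi> z + \<Psi> w" if "z \<in> carrier TM.T" "w \<in> carrier TM.T" for z w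
    using that \<psi>_closed \<Lambda> by (simp add: \<Psi>_def module_isos_add[OF P'(7)])
  have \<Psi>_smult: "\<Psi> (r \<odot>\<^bsub>TM.T\<^esub> z) = r * \<Psi> z" if "r \<in> carrier R" "z \<in> carrier TM.T" for r z
    using that \<psi>_closed \<Lambda> by (simp add: \<Psi>_def module_isos_smult[OF P'(7)])
  note \<Psi> = \<Psi>_add \<Psi>_smult
  define \<rho> where "\<rho> = \<Psi> (TM.pure e e)"
  \<comment> \<open>Both arguments are brought to multiples of e by denominators, which bilinearity
    then cancels.\<close>
  have \<Psi>_pure: "\<Psi> (TM.pure x y) = \<rho> * \<phi> x * \<phi> y" if x: "x \<in> carrier M" and y: "y \<in> carrier M" for x y
  proof -
    obtain s where s: "s \<in> carrier R" "s \<noteq> 0" "s * \<phi> x \<in> carrier R" "s \<odot>\<^bsub>M\<^esub> x = (s * \<phi> x) \<odot>\<^bsub>M\<^esub> e" using \<phi>(5)[OF x] by blast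
    obtain s' where s': "s' \<in> carrier R" "s' \<noteq> 0" "s' * \<phi> y \<in> carrier R" "s' \<odot>\<^bsub>M\<^esub> y = (s' * \<phi> y) \<odot>\<^bsub>M\<^esub> e" using \<phi>(5)[OF y] by blast
    have scale: "\<Psi> (TM.pure (r \<odot>\<^bsub>M\<^esub> x) (r' \<odot>\<^bsub>M\<^esub> y)) = r * r' * \<Psi> (TM.pure x y)"
      if "r \<in> carrier R" "r' \<in> carrier R" "x \<in> carrier M" "y \<in> carrier M" for r r' x y
    proof -
      have "TM.pure (r \<odot>\<^bsub>M\<^esub> x) (r' \<odot>\<^bsub>M\<^esub> y) = r \<odot>\<^bsub>TM.T\<^esub> (r' \<odot>\<^bsub>TM.T\<^esub> TM.pure x y)"
        by (simp only: TM.pure_smult_left[OF that(1,3) M.smult_closed[OF that(2,4)]] TM.pure_smult_right[OF that(2,3,4)])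
      moreover have "TM.pure x y \<in> carrier TM.T" "r' \<odot>\<^bsub>TM.T\<^esub> TM.pure x y \<in> carrier TM.T" using that by simp_all
      ultimately show ?thesis using that \<Psi>(2) by simp
    qed
    have "s * s' * \<Psi> (TM.pure x y) = s * \<phi> x * (s' * \<phi> y) * \<rho>"
      using scale[OF s(1) s'(1) x y] scale[OF s(3) s'(3) \<phi>(3) \<phi>(3)] unfolding s(4) s'(4) \<rho>_def by auto
    then show ?thesis using s(2) s'(2) by (simp add: mult_ac)
  qed
  \<comment> \<open>By surjectivity some tensor is mapped to the pure tensor of e' with itself,
    whose value is 1.\<close>
  have \<rho>0: "\<rho> \<noteq> 0"
  proof
    assume "\<rho> = 0"
    have zero: "\<Psi> z = 0" if "z \<in> carrier TM.T" for z
      using that by (induction rule: TM.tensor_induct) (simp_all add: \<Psi> \<Psi>_pure \<open>\<rho> = 0\<close>)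
    have "TL.pure e' e' \<in> carrier TL.T" using \<phi>'(3) by simp
    then obtain z where z: "z \<in> carrier TM.T" "\<psi> z = TL.pure e' e'" using surj by blast
    then have "\<Psi> z = 1" using \<Lambda>(3) \<phi>' by (simp add: \<Psi>_def)
    then show False using zero[OF z(1)] by simp
  qed
  let ?x = "\<phi>' (sec_X P)" and ?y = "\<phi>' (sec_Y P)" and ?t = "\<phi> (root_sec P)"
  \<comment> \<open>The sections generate e', whose coordinate is 1, so their coordinates cannot
    both vanish.\<close>
  have nonzero: "(?x, ?y) \<noteq> (0, 0)"
  proof
    assume xy: "(?x, ?y) = (0, 0)"
    obtain r s where "r \<in> carrier R" "s \<in> carrier R" "e' = r \<odot>\<^bsub>L\<^esub> sec_X P \<oplus>\<^bsub>L\<^esub> s \<odot>\<^bsub>L\<^esub> sec_Y P" using P'(4) \<phi>'(3) by blast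
    then have "\<phi>' e' = r * ?x + s * ?y" using P'(2,3) by (simp add: \<phi>')
    then show False using xy \<phi>'(4) by simp
  qed
  have eq: "of_int a * ?x\<^sup>2 + of_int b * ?x * ?y + of_int c * ?y\<^sup>2 = \<rho> * ?t\<^sup>2"
  proof -
    have pow: "\<Lambda> ([k] \<cdot>\<^bsub>TL.T\<^esub> z) = of_int k * \<Lambda> z" "[k] \<cdot>\<^bsub>TL.T\<^esub> z \<in> carrier TL.T" if "z \<in> carrier TL.T" for k :: int and z
      using that by (simp_all add: TL.T.add_pow_int_smult add_pow_R \<Lambda> of_int_R)
    have "\<rho> * ?t\<^sup>2 = \<Lambda> (\<psi> (TM.pure (root_sec P) (root_sec P)))"
      using \<Psi>_pure[OF P'(6) P'(6)] by (simp add: \<Psi>_def power2_eq_square mult_ac)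
    also have "\<dots> = of_int a * ?x\<^sup>2 + of_int b * ?x * ?y + of_int c * ?y\<^sup>2"
      unfolding P'(8) pulled_back_form_def tensor_square_def Let_def using P'(2,3)
      by (simp add: \<Lambda> pow power2_eq_square)
    finally show ?thesis by simp
  qed
  show ?thesis
  proof (rule that[OF \<rho>0 nonzero eq])
    fix l assume l: "padic l" "\<not> int l dvd m"
    interpret l: padic l by fact
    obtain f where f: "f \<in> carrier M" "\<phi> f \<noteq> 0" "\<And>x. x \<in> carrier M \<Longrightarrow> l.absp (\<phi> x) \<le> l.absp (\<phi> f)" using \<phi>(6)[OF l] by blast
    obtain f' where f': "f' \<in> carrier L" "\<phi>' f' \<noteq> 0" "\<And>x. x \<in> carrier L \<Longrightarrow> l.absp (\<phi>' x) \<le> l.absp (\<phi>' f')" using \<phi>'(6)[OF l] by blast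
    have smult_le: "l.absp (r * w) \<le> B" if "r \<in> carrier R" "l.absp w \<le> B" for r w B
      using mult_right_mono[OF abs_le_1[OF l that(1)] l.absp_nonneg[of w]] that(2) by (simp add: l.absp_mult)
    \<comment> \<open>By the ultrametric inequality a bound on pure tensors passes to all tensors; f
      gives the largest pure tensor.\<close>
    have M_le: "l.absp (\<Psi> z) \<le> l.absp (\<rho> * \<phi> f * \<phi> f)" if "z \<in> carrier TM.T" for z
      using that
    proof (induction rule: TM.tensor_induct)
      case (pure x y)
      have "l.absp (\<phi> x) * l.absp (\<phi> y) \<le> l.absp (\<phi> f) * l.absp (\<phi> f)" using pure f(3) by (intro mult_mono) auto
      then show ?case using pure by (simp add: \<Psi>_pure l.absp_mult mult.assoc mult_left_mono)
    qed (simp_all add: \<Psi> l.absp_add_le smult_le)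
    have L_le: "l.absp (\<Lambda> z) \<le> l.absp (\<phi>' f' * \<phi>' f')" if "z \<in> carrier TL.T" for z
      using that
    proof (induction rule: TL.tensor_induct)
      case (pure x y)
      then show ?case using f'(3) by (simp add: \<Lambda> l.absp_mult mult_mono)
    qed (simp_all add: \<Lambda> l.absp_add_le smult_le)
    have "TL.pure f' f' \<in> carrier TL.T" using f' by simp
    then obtain z where z: "z \<in> carrier TM.T" "\<psi> z = TL.pure f' f'" using surj by blast
    then have "\<Psi> z = \<phi>' f' * \<phi>' f'" using \<Lambda>(3) f' by (simp add: \<Psi>_def)
    then have 1: "l.absp (\<phi>' f' * \<phi>' f') \<le> l.absp (\<rho> * \<phi> f * \<phi> f)" using M_le[OF z(1)] by simp
    have "TM.pure f f \<in> carrier TM.T" using f by simp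
    then have 2: "l.absp (\<rho> * \<phi> f * \<phi> f) \<le> l.absp (\<phi>' f' * \<phi>' f')"
      using L_le[OF \<psi>_closed] \<Psi>_pure[OF f(1) f(1)] unfolding \<Psi>_def by metis
    have "l.absp (\<phi> f) > 0" using f(2) by (rule l.absp_pos)
    then have "l.absp \<rho> = (l.absp (\<phi>' f' / \<phi> f))\<^sup>2"
      using order_antisym[OF 1 2] by (simp add: l.absp_mult l.absp_divide power2_eq_square field_simps f(2))
    then show "\<exists>s. s \<noteq> 0 \<and> l.absp \<rho> = (l.absp s)\<^sup>2" using f f' by (intro exI[of _ "\<phi>' f' / \<phi> f"]) simp
  qed
qed

text \<open>The ring is integrally closed: multiplication by m^n makes the square of t an integer,
  and a rational number with integral square is an integer.\<close>

lemma square_in_R: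
  assumes "t\<^sup>2 \<in> carrier R" shows "t \<in> carrier R"
proof -
  obtain z n where z: "t\<^sup>2 = of_int z / of_int m ^ n" using assms mem_R by blast
  obtain k l where q: "quotient_of (t * of_int m ^ n) = (k, l)" by (cases "quotient_of (t * of_int m ^ n)")
  have l: "l > 0" "coprime k l" using quotient_of_denom_pos[OF q] quotient_of_coprime[OF q] by auto
  have t: "t * of_int m ^ n = of_int k / of_int l" by (rule quotient_of_div[OF q])
  have "(t * of_int m ^ n)\<^sup>2 = of_int (z * m ^ n)"
    unfolding power_mult_distrib z using m_nonzero by (simp add: power2_eq_square)
  then have "(of_int (k\<^sup>2) :: rat) = of_int (z * m ^ n * l\<^sup>2)"
    unfolding t using l by (simp add: power_divide field_simps)
  then have "k\<^sup>2 = z * m ^ n * l\<^sup>2" by (simp only: of_int_eq_iff)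
  then have "l\<^sup>2 dvd k\<^sup>2" by simp
  then have "l dvd k" by simp
  then have "l = 1" using l by (metis coprime_common_divisor dvd_refl zdvd1_eq abs_of_pos)
  then have "t = of_int k / of_int m ^ n" using t m_nonzero by (simp add: field_simps)
  then show ?thesis unfolding mem_R by blast
qed

lemma m_Units: "of_int m \<in> Units R"
proof (rule UnitsI)
  show "of_int m \<in> carrier R" by (rule of_int_R)
  show "1 / of_int m \<in> carrier R" by (rule inverse_m_R)
  show "of_int m \<noteq> (0::rat)" using m_nonzero by simp
qed

text \<open>Rescaling (x, y) to coprime integers provides generating sections by Bezout. The
  right-hand side then has the same unit d, and t is rescaled into the ring because its square lies
  there.\<close>

theorem point_if_rational_solution:
  assumes m: "m = 2 * disc a b c" and d: "d \<in> carrier R" "1 / d \<in> carrier R" "d \<noteq> 0"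
    and xy: "(x, y) \<noteq> (0, 0)" and eq: "of_int a * x\<^sup>2 + of_int b * x * y + of_int c * y\<^sup>2 = d * t\<^sup>2"
  shows "root_stack_points R a b c \<noteq> {}"
proof -
  obtain k1 l1 where 1: "quotient_of x = (k1, l1)" by (cases "quotient_of x")
  obtain k2 l2 where 2: "quotient_of y = (k2, l2)" by (cases "quotient_of y")
  have l: "l1 > 0" "l2 > 0" using quotient_of_denom_pos 1 2 by auto
  have xy': "x = of_int k1 / of_int l1" "y = of_int k2 / of_int l2" using quotient_of_div 1 2 by auto
  define g where "g = gcd (k1 * l2) (k2 * l1)"
  have "k1 * l2 \<noteq> 0 \<or> k2 * l1 \<noteq> 0" using xy l unfolding xy' by auto
  then have g: "g \<noteq> 0" unfolding g_def by auto
  obtain u v where uv: "k1 * l2 = u * g" "k2 * l1 = v * g" "coprime u v"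
    using gcd_coprime_exists[of "k1 * l2" "k2 * l1"] g unfolding g_def by blast
  obtain r s where rs: "r * u + s * v = 1" using uv(3) by (metis bezout_int coprime_imp_gcd_eq_1)
  \<comment> \<open>The factor that carries (x, y) to the coprime pair (u, v).\<close>
  define w :: rat where "w = of_int (l1 * l2) / of_int g"
  have w: "of_int u = w * x" "of_int v = w * y"
  proof -
    have "(of_int (k1 * l2) :: rat) = of_int (u * g)" "(of_int (k2 * l1) :: rat) = of_int (v * g)" using uv by simp_all
    then show "of_int u = w * x" "of_int v = w * y" using l g unfolding w_def xy' by (simp_all add: field_simps)
  qed
  have "of_int (a * u\<^sup>2 + b * u * v + c * v\<^sup>2) = w\<^sup>2 * (of_int a * x\<^sup>2 + of_int b * x * y + of_int c * y\<^sup>2)"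
    by (simp add: w power_mult_distrib algebra_simps power2_eq_square)
  then have form: "of_int (a * u\<^sup>2 + b * u * v + c * v\<^sup>2) = d * (w * t)\<^sup>2"
    unfolding eq by (simp add: power_mult_distrib mult_ac)
  then have "(w * t)\<^sup>2 = (1 / d) * of_int (a * u\<^sup>2 + b * u * v + c * v\<^sup>2)" using d(3) by (simp add: field_simps)
  then have "(w * t)\<^sup>2 \<in> carrier R" by (simp only: R_mult[OF d(2) of_int_R])
  then have wt: "w * t \<in> carrier R" by (rule square_in_R)
  have unit: "[(2 * disc a b c)] \<cdot>\<^bsub>R\<^esub> \<one>\<^bsub>R\<^esub> \<in> Units R"
    using m_Units add_pow_R[of m] m by simp
  show ?thesis
  proof (rule R.root_stack_points_nonempty[OF unit])
    show "of_int r \<otimes>\<^bsub>R\<^esub> of_int u \<oplus>\<^bsub>R\<^esub> of_int s \<otimes>\<^bsub>R\<^esub> of_int v = \<one>\<^bsub>R\<^esub>"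
      using arg_cong[OF rs, of "of_int :: int \<Rightarrow> rat"] by (simp add: ops)
    show "([a] \<cdot>\<^bsub>R\<^esub> \<one>\<^bsub>R\<^esub>) \<otimes>\<^bsub>R\<^esub> (of_int u \<otimes>\<^bsub>R\<^esub> of_int u) \<oplus>\<^bsub>R\<^esub> ([b] \<cdot>\<^bsub>R\<^esub> \<one>\<^bsub>R\<^esub>) \<otimes>\<^bsub>R\<^esub> (of_int u \<otimes>\<^bsub>R\<^esub> of_int v) \<oplus>\<^bsub>R\<^esub>
        ([c] \<cdot>\<^bsub>R\<^esub> \<one>\<^bsub>R\<^esub>) \<otimes>\<^bsub>R\<^esub> (of_int v \<otimes>\<^bsub>R\<^esub> of_int v) = d \<otimes>\<^bsub>R\<^esub> (w * t \<otimes>\<^bsub>R\<^esub> (w * t))"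
      using form unfolding add_pow_R by (simp add: ops power2_eq_square mult.assoc)
  qed (use d wt in \<open>simp_all add: of_int_R UnitsI\<close>)
qed

end

section \<open>Local points, square classes and Hilbert symbols\<close>

lemma (in ring) add_pow_mult_int:
  "([k] \<cdot> \<one>) \<otimes> ([l] \<cdot> \<one>) = [(k * l)] \<cdot> \<one>" for k l :: int
proof -
  define h where "h = (\<lambda>j::int. [j] \<cdot> ([l] \<cdot> \<one>))"
  have "([k] \<cdot> \<one>) \<otimes> ([l] \<cdot> \<one>) = [k] \<cdot> ([l] \<cdot> \<one>)"
    using add_pow_ldistr_int[of \<one> "[l] \<cdot> \<one>" k] by (simp add: add.int_pow_closed)
  also have "\<dots> = [(k * l)] \<cdot> \<one>"
    using add_pow_int_additive[of "\<lambda>j. [(j * l)] \<cdot> \<one>" k] by (simp add: add.int_pow_closed distrib_right add.int_pow_mult)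
  finally show ?thesis .
qed

text \<open>The value of the form serves as the unit u, with t = 1.\<close>

lemma (in cring) root_stack_points_nonempty_if_unit_value:
  assumes "[(2 * disc a b c)] \<cdot> \<one> \<in> Units R" "r * x + s * y = 1"
    "[(a * x\<^sup>2 + b * x * y + c * y\<^sup>2)] \<cdot> \<one> \<in> Units R"
  shows "root_stack_points R a b c \<noteq> {}"
proof (rule root_stack_points_nonempty[OF assms(1), where t = \<one>])
  show "([r] \<cdot> \<one>) \<otimes> ([x] \<cdot> \<one>) \<oplus> ([s] \<cdot> \<one>) \<otimes> ([y] \<cdot> \<one>) = \<one>"
    using assms(2) by (simp add: add_pow_mult_int flip: add.int_pow_mult)
  show "([a] \<cdot> \<one>) \<otimes> (([x] \<cdot> \<one>) \<otimes> ([x] \<cdot> \<one>)) \<oplus> ([b] \<cdot> \<one>) \<otimes> (([x] \<cdot> \<one>) \<otimes> ([y] \<cdot> \<one>)) \<oplus>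
      ([c] \<cdot> \<one>) \<otimes> (([y] \<cdot> \<one>) \<otimes> ([y] \<cdot> \<one>)) = ([(a * x\<^sup>2 + b * x * y + c * y\<^sup>2)] \<cdot> \<one>) \<otimes> (\<one> \<otimes> \<one>)"
    by (simp add: add_pow_mult_int add.int_pow_closed power2_eq_square mult.assoc flip: add.int_pow_mult)
qed (use assms(3) in \<open>simp_all add: add.int_pow_closed\<close>)

text \<open>One of the values a, c and a + b + c at (1, 0), (0, 1) and (1, 1) works: otherwise p
  divides a, b and c, hence the discriminant. The case p = 0 gives a nonzero value, as needed over
  fields.\<close>

lemma value_coprime:
  assumes "\<not> p dvd disc a b c"
  obtains r s x y where "r * x + s * y = 1" "\<not> p dvd a * x\<^sup>2 + b * x * y + c * (y::int)\<^sup>2"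
proof (cases "p dvd a \<and> p dvd c")
  case True
  then have "p dvd 4 * a * c" by simp
  have "\<not> p dvd b"
  proof
    assume "p dvd b"
    then have "p dvd b\<^sup>2" by (simp add: power2_eq_square)
    then show False using assms \<open>p dvd 4 * a * c\<close> unfolding disc_def by simp
  qed
  then have "\<not> p dvd a + b + c" using True by (metis dvd_add_left_iff dvd_add_right_iff)
  then show ?thesis using that[of 1 1 0 1] by simp
next
  case False
  then show ?thesis using that[of 1 1 0 0] that[of 0 0 1 1] by auto
qed

section \<open>The p-adic integers and p-adic square classes\<close>

context padic
begin

abbreviation "Zp \<equiv> padic_integers p"

lemma mem_Zp: "\<xi> \<in> carrier Zp \<longleftrightarrow> (\<exists>x. cauchy x \<and> (\<forall>n. absp (x n) \<le> 1) \<and> \<xi> = cls x)"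
proof
  assume "\<xi> \<in> carrier Zp"
  then obtain x y where xy: "cauchy y" "\<xi> = cls y" "x \<in> cls y" "\<forall>n. absp (x n) \<le> 1"
    unfolding padic_integers_def by (auto simp: carrier_Q)
  have d: "null (\<lambda>n. x n - y n)" using xy(3) by (simp add: mem_cls)
  then have "cauchy x" by (rule cauchy_null_close[OF xy(1)])
  then show "\<exists>x. cauchy x \<and> (\<forall>n. absp (x n) \<le> 1) \<and> \<xi> = cls x"
    using cls_eq_iff[OF _ xy(1), of x] d xy by blast
next
  assume "\<exists>x. cauchy x \<and> (\<forall>n. absp (x n) \<le> 1) \<and> \<xi> = cls x"
  then obtain x where x: "cauchy x" "\<forall>n. absp (x n) \<le> 1" "\<xi> = cls x" by blast
  then have "x \<in> \<xi>" by (simp add: mem_cls null_const)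
  then show "\<xi> \<in> carrier Zp" using x by (auto simp: padic_integers_def cls_closed)
qed

lemma cring_Zp: "cring Zp"
proof -
  have sub: "carrier Zp \<subseteq> carrier Q" by (auto simp: mem_Zp cls_closed)
  have "subring (carrier Zp) Q"
  proof (rule Q.subringI[OF sub])
    show "\<one>\<^bsub>Q\<^esub> \<in> carrier Zp" unfolding mem_Zp cls_one by (intro exI[of _ "\<lambda>_. 1"]) (simp add: cauchy_const)
  next
    fix h assume "h \<in> carrier Zp"
    then obtain x where x: "cauchy x" "\<forall>n. absp (x n) \<le> 1" "h = cls x" unfolding mem_Zp by blast
    then show "\<ominus>\<^bsub>Q\<^esub> h \<in> carrier Zp"
      unfolding mem_Zp by (intro exI[of _ "\<lambda>n. - x n"]) (simp add: cls_uminus cauchy_uminus)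
  next
    fix h h' assume "h \<in> carrier Zp" "h' \<in> carrier Zp"
    then obtain x y where xy: "cauchy x" "\<forall>n. absp (x n) \<le> 1" "h = cls x" "cauchy y" "\<forall>n. absp (y n) \<le> 1" "h' = cls y"
      unfolding mem_Zp by blast
    show "h \<otimes>\<^bsub>Q\<^esub> h' \<in> carrier Zp" unfolding mem_Zp
      by (intro exI[of _ "\<lambda>n. x n * y n"]) (use xy in \<open>simp add: cls_mult cauchy_mult absp_mult mult_le_one\<close>)
    show "h \<oplus>\<^bsub>Q\<^esub> h' \<in> carrier Zp" unfolding mem_Zp
      by (intro exI[of _ "\<lambda>n. x n + y n"]) (use xy in \<open>simp add: cls_add cauchy_add absp_add_le\<close>)
  qed
  then have "subcring (carrier Zp) Q" by (rule Q.subcringI')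
  then have "cring (Q\<lparr>carrier := carrier Zp\<rparr>)" using Q.subcring_iff[OF sub] by blast
  then show ?thesis by (simp add: padic_integers_def)
qed

sublocale Zp: cring Zp by (rule cring_Zp)

lemma cst_Zp: "absp r \<le> 1 \<Longrightarrow> cst r \<in> carrier Zp"
  unfolding mem_Zp cst_def by (intro exI[of _ "\<lambda>_. r"]) (simp add: cauchy_const)

lemma Zp_ops: "x \<otimes>\<^bsub>Zp\<^esub> y = x \<otimes>\<^bsub>Q\<^esub> y" "x \<oplus>\<^bsub>Zp\<^esub> y = x \<oplus>\<^bsub>Q\<^esub> y" "\<one>\<^bsub>Zp\<^esub> = \<one>\<^bsub>Q\<^esub>"
  by (simp_all add: padic_integers_def)

lemma add_pow_Zp: "[k] \<cdot>\<^bsub>Zp\<^esub> \<one>\<^bsub>Zp\<^esub> = cst (of_int k)"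
  by (rule Zp.add_pow_int_eqI) (simp_all add: cst_Zp absp_int_le_1 Zp_ops cst_1 cst_add)

lemma int_Units_Zp: assumes "\<not> int p dvd k" shows "[k] \<cdot>\<^bsub>Zp\<^esub> \<one>\<^bsub>Zp\<^esub> \<in> Units Zp"
proof -
  have k: "absp (of_int k) = 1" by (rule absp_int_eq_1[OF assms])
  then have k0: "of_int k \<noteq> (0::rat)" by auto
  have "cst (1 / of_int k) \<in> carrier Zp" "cst (of_int k) \<in> carrier Zp" using k by (auto intro!: cst_Zp simp: absp_inverse)
  moreover have "cst (of_int k) \<otimes>\<^bsub>Zp\<^esub> cst (1 / of_int k) = \<one>\<^bsub>Zp\<^esub>" unfolding Zp_ops by (rule cst_inverse[OF k0])
  ultimately show ?thesis unfolding add_pow_Zp Units_def using Zp.m_comm by fastforce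
qed

theorem points_padic_integers:
  assumes "\<not> int p dvd 2 * disc a b c" shows "root_stack_points Zp a b c \<noteq> {}"
proof -
  have "\<not> int p dvd disc a b c" using assms dvd_mult[of "int p" "disc a b c" 2] by blast
  then obtain r s x y where "r * x + s * y = 1" "\<not> int p dvd a * x\<^sup>2 + b * x * y + c * y\<^sup>2" by (rule value_coprime)
  then show ?thesis using Zp.root_stack_points_nonempty_if_unit_value[OF int_Units_Zp[OF assms]] int_Units_Zp by blast
qed

theorem points_padic_field:
  assumes "disc a b c \<noteq> 0" shows "root_stack_points Q a b c \<noteq> {}"
proof -
  have unit: "[k] \<cdot>\<^bsub>Q\<^esub> \<one>\<^bsub>Q\<^esub> \<in> Units Q" if "k \<noteq> 0" for k :: int
    unfolding add_pow_Q using that by (intro cst_Units) simp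
  have "\<not> 0 dvd disc a b c" using assms by simp
  then obtain r s x y where "r * x + s * y = 1" "\<not> 0 dvd a * x\<^sup>2 + b * x * y + c * y\<^sup>2" by (rule value_coprime)
  then show ?thesis using Q.root_stack_points_nonempty_if_unit_value[of a b c r x s y] unit assms by simp
qed

lemma square_class_if_local_square:
  assumes "local_square (Prime_Place p) (d * m)" shows "d \<in> square_class Q m"
proof -
  obtain s where s: "cauchy s" "null (\<lambda>n. (s n)\<^sup>2 - of_int (d * m))" using local_square_sqrt[OF assms] by blast
  have nz: "of_int d \<noteq> (0::rat)" "of_int m \<noteq> (0::rat)" using assms by (auto simp: local_square_def)
  \<comment> \<open>From s^2 = d m follow d = m (s/m)^2 and the inverse s/d of s/m.\<close>
  define y where "y = cls (\<lambda>n. 1 / of_int m * s n)"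
  define y' where "y' = cls (\<lambda>n. 1 / of_int d * s n)"
  have "null (\<lambda>n. 1 / (of_int d * of_int m) * ((s n)\<^sup>2 - of_int (d * m)))" by (rule null_cmult[OF s(2)])
  moreover have "1 / (of_int d * of_int m) * ((s n)\<^sup>2 - of_int (d * m)) = (1 / of_int m * s n) * (1 / of_int d * s n) - 1" for n
    using nz by (simp add: field_simps power2_eq_square)
  ultimately have "null (\<lambda>n. (1 / of_int m * s n) * (1 / of_int d * s n) - 1)" by simp
  then have inv: "y \<otimes>\<^bsub>Q\<^esub> y' = \<one>\<^bsub>Q\<^esub>"
    unfolding y_def y'_def cls_one using s(1)
    by (simp only: cls_mult cauchy_cmult cls_eq_iff cauchy_mult cauchy_const)
  have closed: "y \<in> carrier Q" "y' \<in> carrier Q" unfolding y_def y'_def by (rule cls_closed[OF cauchy_cmult[OF s(1)]])+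
  then have "y \<in> Units Q" using inv Q.m_comm[OF closed] by (auto simp: Units_def)
  moreover have "cst (of_int d) = cst (of_int m) \<otimes>\<^bsub>Q\<^esub> (y \<otimes>\<^bsub>Q\<^esub> y)"
  proof -
    have "null (\<lambda>n. (- 1 / of_int m) * ((s n)\<^sup>2 - of_int (d * m)))" by (rule null_cmult[OF s(2)])
    moreover have "(- 1 / of_int m) * ((s n)\<^sup>2 - of_int (d * m)) = of_int d - of_int m * ((1 / of_int m * s n) * (1 / of_int m * s n))" for n
      using nz by (simp add: field_simps power2_eq_square)
    ultimately have "null (\<lambda>n. of_int d - of_int m * ((1 / of_int m * s n) * (1 / of_int m * s n)))" by simp
    then show ?thesis unfolding y_def cst_def using s(1)
      by (simp only: cls_mult cauchy_cmult cls_eq_iff cauchy_mult cauchy_const)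
  qed
  ultimately show ?thesis unfolding square_class_def add_pow_Q by blast
qed

text \<open>If d = m y^2 then d m = (m y)^2, so x = 0, y = 1 solves the equation for (w, d m).
  Bilinearity then compares (w, d) with (w, m).\<close>

lemma symbol_square_class:
  assumes "d \<in> square_class Q m" and nz: "w \<noteq> 0" "d \<noteq> 0" "m \<noteq> 0"
  shows "symbol (Prime_Place p) w d = symbol (Prime_Place p) w m"
proof -
  have v: "Prime_Place p \<in> places" using prime by (simp add: places_def)
  obtain y where y: "y \<in> Units Q" "cst (of_int d) = cst (of_int m) \<otimes>\<^bsub>Q\<^esub> (y \<otimes>\<^bsub>Q\<^esub> y)"
    using assms(1) unfolding square_class_def add_pow_Q by blast
  then have "y \<in> carrier Q" by auto
  then obtain z where z: "cauchy z" "y = cls z" by (auto simp: carrier_Q)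
  have "null (\<lambda>n. of_int d - of_int m * (z n * z n))"
    using y(2) z(1) unfolding z(2) cst_def by (simp only: cls_mult cauchy_cmult cls_eq_iff cauchy_mult cauchy_const)
  then have "null (\<lambda>n. (- of_int m) * (of_int d - of_int m * (z n * z n)))" by (rule null_cmult)
  then have "null (\<lambda>n. (of_int m * z n)\<^sup>2 - of_int w * 0\<^sup>2 - of_int (d * m) * 1\<^sup>2)"
    by (simp add: algebra_simps power2_eq_square)
  then have "soluble (of_int w) (of_int (d * m))"
    by (intro solubleI[of "\<lambda>_. 0" "\<lambda>_. 1" "\<lambda>n. of_int m * z n"]) (simp_all add: cauchy_const cauchy_cmult z null_const)
  then have "symbol (Prime_Place p) w (d * m) = 1" using soluble_iff_symbol[of w "d * m"] nz by simp
  then show ?thesis using symbol_mult_right[OF v nz] symbol_pm[OF v nz(1,2)] symbol_pm[OF v nz(1,3)] by auto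
qed

end

section \<open>The real place, and uniform statements for all places\<close>

lemma real_field_ops: "monoid.mult real_field = times" "ring.add real_field = (+)" "ring.zero real_field = 0"
  "monoid.one real_field = 1" "carrier real_field = UNIV"
  by (auto simp: real_field_def ring_of_type_algebra_def)

lemma cring_real_field: "cring real_field"
  unfolding real_field_def by (rule cring_from_type_algebra)

lemma add_pow_real: "[k] \<cdot>\<^bsub>real_field\<^esub> \<one>\<^bsub>real_field\<^esub> = of_int (k::int)"
proof -
  interpret cring real_field by (rule cring_real_field)
  show ?thesis by (rule add_pow_int_eqI) (simp_all add: real_field_ops)
qed

lemma Units_real: "Units real_field = {x. x \<noteq> 0}"
proof (rule Set.set_eqI)
  fix x :: real
  have "x \<in> Units real_field \<longleftrightarrow> (\<exists>y. y * x = 1 \<and> x * y = 1)" by (simp add: Units_def real_field_ops)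
  also have "\<dots> \<longleftrightarrow> x \<noteq> 0" by (auto intro: exI[of _ "inverse x"])
  finally show "x \<in> Units real_field \<longleftrightarrow> x \<in> {x. x \<noteq> 0}" by simp
qed

lemma a_minus_real: "x \<ominus>\<^bsub>real_field\<^esub> y = x - y"
proof -
  interpret cring real_field by (rule cring_real_field)
  have "\<ominus>\<^bsub>real_field\<^esub> y = - y" by (rule minus_equality) (simp_all add: real_field_ops)
  then show ?thesis by (simp add: a_minus_def real_field_ops)
qed

lemma of_rat_field_real: "of_rat_field real_field r = real_of_rat r"
proof -
  interpret cring real_field by (rule cring_real_field)
  obtain k l where q: "quotient_of r = (k, l)" by (cases "quotient_of r")
  have l: "l > 0" using quotient_of_denom_pos[OF q] .
  have "inv\<^bsub>real_field\<^esub> (of_int l) = 1 / of_int l"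
    by (rule comm_inv_char) (use l in \<open>simp_all add: real_field_ops\<close>)
  then have "of_rat_field real_field r = of_int k / of_int l"
    by (simp add: of_rat_field_def q add_pow_real) (simp add: real_field_ops)
  also have "\<dots> = real_of_rat r" unfolding quotient_of_div[OF q] by (simp add: of_rat_divide)
  finally show ?thesis .
qed

lemma hilbert_symbol_real:
  assumes "a \<noteq> 0" "b \<noteq> 0" shows "hilbert_symbol real_field a b = (if a < 0 \<and> b < 0 then - 1 else 1)"
proof (cases "a < 0 \<and> b < 0")
  case True
  have "x = 0 \<and> y = 0 \<and> z = 0" if "z * z - a * (x * x) - b * (y * y) = 0" for x y z :: real
  proof -
    have 1: "a * (x * x) \<le> 0" "b * (y * y) \<le> 0" using True by (simp_all add: mult_nonpos_nonneg)
    have "z * z \<ge> 0" by simp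
    then have "a * (x * x) = 0" "b * (y * y) = 0" "z * z = 0" using that 1 by linarith+
    then show ?thesis using assms by simp
  qed
  then show ?thesis using True by (auto simp: hilbert_symbol_def real_field_ops a_minus_real)
next
  case False
  then consider "a > 0" | "b > 0" using assms by linarith
  then have "\<exists>x y z. (x, y, z) \<noteq> (0, 0, 0) \<and> z * z - a * (x * x) - b * (y * y) = (0::real)"
  proof cases
    case 1 then show ?thesis by (intro exI[of _ 1] exI[of _ 0] exI[of _ "sqrt a"]) simp
  next
    case 2 then show ?thesis by (intro exI[of _ 0] exI[of _ 1] exI[of _ "sqrt b"]) simp
  qed
  then show ?thesis using False by (auto simp: hilbert_symbol_def real_field_ops a_minus_real)
qed

theorem points_local:
  assumes "v \<in> places" "disc a b c \<noteq> 0" shows "has_local_point v a b c"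
proof (cases v)
  case Real_Place
  interpret cring real_field by (rule cring_real_field)
  have unit: "[k] \<cdot>\<^bsub>real_field\<^esub> \<one>\<^bsub>real_field\<^esub> \<in> Units real_field" if "k \<noteq> 0" for k :: int
    unfolding add_pow_real Units_real using that by simp
  have "\<not> 0 dvd disc a b c" using assms by simp
  then obtain r s x y where "r * x + s * y = 1" "\<not> 0 dvd a * x\<^sup>2 + b * x * y + c * y\<^sup>2" by (rule value_coprime)
  then show ?thesis using root_stack_points_nonempty_if_unit_value[of a b c r x s y] unit assms
    by (simp add: has_local_point_def Real_Place)
next
  case (Prime_Place p)
  then interpret padic p using assms(1) by unfold_locales (auto simp: places_def)
  show ?thesis using points_padic_field[OF assms(2)] by (simp add: has_local_point_def Prime_Place)
qed

lemma local_square_class_if_local_square: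
  assumes "v \<in> places" "local_square v (d * m)" shows "d \<in> local_square_class v m"
proof (cases v)
  case Real_Place
  then have dm: "0 < d * m" using assms(2) by (simp add: local_square_def)
  then have m: "real_of_int m \<noteq> 0" by auto
  have "real_of_int d = real_of_int m * (sqrt (real_of_int d / real_of_int m) * sqrt (real_of_int d / real_of_int m))"
  proof -
    have "0 \<le> real_of_int d / real_of_int m" using dm by (auto simp: zero_less_mult_iff zero_le_divide_iff)
    then show ?thesis unfolding real_sqrt_mult_self using m by (simp only: abs_of_nonneg) simp
  qed
  moreover have "sqrt (real_of_int d / real_of_int m) \<noteq> 0" using dm by auto
  ultimately show ?thesis
    unfolding Real_Place local_square_class_def square_class_def place.case add_pow_real Units_real real_field_ops(1)
    by blast
next
  case (Prime_Place p)
  then interpret padic p using assms(1) by unfold_locales (auto simp: places_def)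
  show ?thesis using square_class_if_local_square assms(2) by (simp add: Prime_Place local_square_class_def)
qed

lemma symbol_local_square_class:
  assumes "v \<in> places" "d \<in> local_square_class v m" "w \<noteq> 0" "d \<noteq> 0" "m \<noteq> 0"
  shows "symbol v w d = symbol v w m"
proof (cases v)
  case Real_Place
  obtain y where "y \<noteq> 0" "real_of_int d = real_of_int m * (y * y)"
    using assms(2) unfolding Real_Place local_square_class_def square_class_def place.case add_pow_real Units_real
    by (auto simp: real_field_ops)
  moreover have "y * y > 0" using \<open>y \<noteq> 0\<close> by (simp add: zero_less_mult_iff) linarith
  ultimately have "real_of_int d < 0 \<longleftrightarrow> real_of_int m < 0" by (simp add: mult_less_0_iff)
  then show ?thesis by (simp add: Real_Place symbol_Real)
next
  case (Prime_Place p)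
  then interpret padic p using assms(1) by unfold_locales (auto simp: places_def)
  show ?thesis using symbol_square_class assms by (simp add: Prime_Place local_square_class_def)
qed

text \<open>Every nonzero rational is an integer divided by a square, and squares do not affect the
  symbol; so symbols of integers cover the entries of any diagonalization.\<close>

lemma local_hilbert_symbol:
  assumes v: "v \<in> places" and nz: "A \<noteq> 0" "B \<noteq> 0" "k \<noteq> 0" "l \<noteq> 0"
  shows "local_hilbert v (of_int A / (of_int k)\<^sup>2) (of_int B / (of_int l)\<^sup>2) = symbol v A B"
proof (cases v)
  case Real_Place
  have "(real_of_int A / (real_of_int k)\<^sup>2 < 0) = (A < 0)" "(real_of_int B / (real_of_int l)\<^sup>2 < 0) = (B < 0)"
    using nz by (simp_all add: divide_less_0_iff)
  then show ?thesis using nz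
    by (simp add: local_hilbert_def Real_Place of_rat_field_real hilbert_symbol_real symbol_Real of_rat_divide of_rat_power)
next
  case (Prime_Place p)
  then interpret padic p using v by unfold_locales (auto simp: places_def)
  have A: "of_int A / (of_int k)\<^sup>2 = of_int A * (1 / of_int k :: rat)\<^sup>2" "of_int B / (of_int l)\<^sup>2 = of_int B * (1 / of_int l :: rat)\<^sup>2"
    by (simp_all add: power_one_over)
  have "soluble (of_int A / (of_int k)\<^sup>2) (of_int B / (of_int l)\<^sup>2) \<longleftrightarrow> soluble (of_int A) (of_int B)"
  proof -
    have kl: "1 / of_int k \<noteq> (0::rat)" "1 / of_int l \<noteq> (0::rat)" using nz by simp_all
    have "soluble (of_int A / (of_int k)\<^sup>2) (of_int B / (of_int l)\<^sup>2) \<longleftrightarrow> soluble (of_int A * (1 / of_int k)\<^sup>2) (of_int B)"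
      unfolding A by (rule soluble_square_iff[OF kl(2)])
    also have "\<dots> \<longleftrightarrow> soluble (of_int B) (of_int A * (1 / of_int k)\<^sup>2)" using soluble_commute by blast
    also have "\<dots> \<longleftrightarrow> soluble (of_int B) (of_int A)" by (rule soluble_square_iff[OF kl(1)])
    also have "\<dots> \<longleftrightarrow> soluble (of_int A) (of_int B)" using soluble_commute by blast
    finally show ?thesis .
  qed
  then show ?thesis using soluble_iff_symbol[OF nz(1,2)] symbol_pm[OF v nz(1,2)]
    by (auto simp: local_hilbert_def Prime_Place of_rat_field_Q hilbert_symbol_Q)
qed

section \<open>Points over \<open>\<int>[1/2q]\<close>\<close>

text \<open>An integer \<open>n\<close> with \<open>f \<sim> n x\<^sup>2 - n q y\<^sup>2\<close> over the rationals.\<close>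

definition represented :: "int \<Rightarrow> int \<Rightarrow> int \<Rightarrow> int"
  where "represented a b c = (if a \<noteq> 0 then a else if c \<noteq> 0 then c else b)"

lemma represented_nonzero: "disc a b c \<noteq> 0 \<Longrightarrow> represented a b c \<noteq> 0"
  by (auto simp: represented_def disc_def)

lemma disc_square_mod_represented: "represented a b c dvd b\<^sup>2 - disc a b c"
  by (auto simp: represented_def disc_def power2_eq_square)

text \<open>The first basis vector takes the value n, the second is orthogonal to it and takes the
  value -n q. For a nonzero these are (1, 0) and (-b, 2a); for f = b X Y they are (1, 1) and (-b,
  b), with q = b^2.\<close>

lemma diagonalizes_represented:
  assumes "disc a b c \<noteq> 0"
  shows "diagonalizes a b c (of_int (represented a b c)) (of_int (- represented a b c * disc a b c))"
proof -
  consider "a \<noteq> 0" | "a = 0" "c \<noteq> 0" | "a = 0" "c = 0" by blast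
  then show ?thesis
  proof cases
    case 1
    show ?thesis unfolding diagonalizes_def
      by (rule exI[of _ 1], rule exI[of _ "- of_int b"], rule exI[of _ 0], rule exI[of _ "2 * of_int a"])
        (use 1 in \<open>simp add: represented_def form_value_def disc_def power2_eq_square algebra_simps\<close>)
  next
    case 2
    show ?thesis unfolding diagonalizes_def
      by (rule exI[of _ 0], rule exI[of _ "2 * of_int c"], rule exI[of _ 1], rule exI[of _ "- of_int b"])
        (use 2 in \<open>simp add: represented_def form_value_def disc_def power2_eq_square algebra_simps\<close>)
  next
    case 3
    then have "b \<noteq> 0" using assms by (auto simp: disc_def)
    then show ?thesis unfolding diagonalizes_def
      by (intro exI[of _ 1] exI[of _ "- of_int b"] exI[of _ 1] exI[of _ "of_int b"])
        (use 3 in \<open>simp add: represented_def form_value_def disc_def power2_eq_square algebra_simps\<close>)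
  qed
qed

text \<open>Completing the square: a f = (a x + b y/2)^2 - q (y/2)^2, and likewise with c. For f = b
  X Y the product x y is a difference of squares of (x + y)/2 and (x - y)/2.\<close>

lemma represented_norm:
  assumes q: "disc a b c \<noteq> 0" and xy: "(x, y) \<noteq> (0, 0)"
  obtains z w where "(z, w) \<noteq> (0, 0)"
    "of_int (represented a b c) * form_value (of_int a) (of_int b) (of_int c) x y = z\<^sup>2 - of_int (disc a b c) * w\<^sup>2"
proof -
  consider "a \<noteq> 0" | "a = 0" "c \<noteq> 0" | "a = 0" "c = 0" by blast
  then show ?thesis
  proof cases
    case 1
    show ?thesis
      by (rule that[of "of_int a * x + of_int b * y / 2" "y / 2"])
        (use 1 xy in \<open>auto simp: represented_def form_value_def disc_def power2_eq_square field_simps\<close>)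
  next
    case 2
    show ?thesis
      by (rule that[of "of_int c * y + of_int b * x / 2" "x / 2"])
        (use 2 xy in \<open>auto simp: represented_def form_value_def disc_def power2_eq_square field_simps\<close>)
  next
    case 3
    then have b: "b \<noteq> 0" using q by (auto simp: disc_def)
    have "x + y \<noteq> 0 \<or> x - y \<noteq> 0" using xy by auto
    then show ?thesis
      by (intro that[of "of_int b * (x + y) / 2" "(x - y) / 2"])
        (use 3 b in \<open>auto simp: represented_def form_value_def disc_def power2_eq_square field_simps\<close>)
  qed
qed

lemma symbol_if_rational_soluble:
  fixes x y z :: rat
  assumes v: "v \<in> places" and nz: "a \<noteq> 0" "b \<noteq> 0"
    and xyz: "(x, y, z) \<noteq> (0, 0, 0)" "z\<^sup>2 = of_int a * x\<^sup>2 + of_int b * y\<^sup>2"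
  shows "symbol v a b = 1"
proof -
  obtain k1 l1 where 1: "quotient_of x = (k1, l1)" by (cases "quotient_of x")
  obtain k2 l2 where 2: "quotient_of y = (k2, l2)" by (cases "quotient_of y")
  obtain k3 l3 where 3: "quotient_of z = (k3, l3)" by (cases "quotient_of z")
  have l: "l1 > 0" "l2 > 0" "l3 > 0" using quotient_of_denom_pos 1 2 3 by auto
  have e: "x = of_int k1 / of_int l1" "y = of_int k2 / of_int l2" "z = of_int k3 / of_int l3"
    using quotient_of_div 1 2 3 by auto
  define D :: rat where "D = of_int (l1 * l2 * l3)"
  have w: "of_int (k1 * l2 * l3) = D * x" "of_int (k2 * l1 * l3) = D * y" "of_int (k3 * l1 * l2) = D * z"
    using l unfolding D_def e by simp_all
  have "(D * z)\<^sup>2 = of_int a * (D * x)\<^sup>2 + of_int b * (D * y)\<^sup>2"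
    unfolding power_mult_distrib xyz(2) by (simp add: algebra_simps)
  then have "(of_int ((k3 * l1 * l2)\<^sup>2) :: rat) = of_int (a * (k1 * l2 * l3)\<^sup>2 + b * (k2 * l1 * l3)\<^sup>2)"
    unfolding w[symmetric] by simp
  then have "(k3 * l1 * l2)\<^sup>2 = a * (k1 * l2 * l3)\<^sup>2 + b * (k2 * l1 * l3)\<^sup>2" by (simp only: of_int_eq_iff)
  moreover have "(k1 * l2 * l3, k2 * l1 * l3, k3 * l1 * l2) \<noteq> (0, 0, 0)" using xyz(1) l unfolding e by auto
  ultimately show ?thesis using symbol_if_soluble[OF v nz] by blast
qed

lemma rat_square_multiple:
  assumes "r \<noteq> (0::rat)" obtains A k where "r = of_int A / (of_int k)\<^sup>2" "A \<noteq> 0" "k \<noteq> 0"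
proof -
  obtain k l where q: "quotient_of r = (k, l)" by (cases "quotient_of r")
  have "l > 0" "r = of_int k / of_int l" using quotient_of_denom_pos[OF q] quotient_of_div[OF q] by auto
  then show ?thesis using assms that[of "k * l" l] by (auto simp: power2_eq_square)
qed

text \<open>Comparison of determinants shows that a2 is -q a1 up to squares, so (a1, a2) = (a1, -q
  a1) = (a1, q). Since a1 is a value of f, n a1 has the form z^2 - q y^2, so a1 may be replaced by
  n.\<close>

lemma local_hilbert_diagonalization:
  assumes q: "disc a b c \<noteq> 0" and v: "v \<in> places" and nz: "a1 \<noteq> 0" "a2 \<noteq> 0" and diag: "diagonalizes a b c a1 a2"
  shows "local_hilbert v a1 a2 = symbol v (represented a b c) (disc a b c)"
proof -
  let ?n = "represented a b c" and ?q = "disc a b c"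
  have n: "?n \<noteq> 0" by (rule represented_nonzero[OF q])
  obtain s t u w where stuw: "s * w - t * u \<noteq> 0"
    "\<And>x y. form_value (of_int a) (of_int b) (of_int c) (s * x + t * y) (u * x + w * y) = form_value a1 0 a2 x y"
    using diag unfolding diagonalizes_def by blast
  define \<delta> where "\<delta> = s * w - t * u"
  have a1: "form_value (of_int a) (of_int b) (of_int c) s u = a1" using stuw(2)[of 1 0] by (simp add: form_value_def)
  have a2: "form_value (of_int a) (of_int b) (of_int c) t w = a2" using stuw(2)[of 0 1] by (simp add: form_value_def)
  \<comment> \<open>The value at (1, 1), minus those at (1, 0) and (0, 1), is the cross term, which
    a diagonal form lacks.\<close>
  have cross: "2 * of_int a * s * t + of_int b * (s * w + t * u) + 2 * of_int c * u * w = 0"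
    using stuw(2)[of 1 1] a1 a2 by (simp add: form_value_def power2_eq_square algebra_simps)
  \<comment> \<open>The discriminant of a transformed form is q times the square of the
    determinant.\<close>
  have "(2 * of_int a * s * t + of_int b * (s * w + t * u) + 2 * of_int c * u * w)\<^sup>2 - 4 * a1 * a2 = of_int ?q * \<delta>\<^sup>2"
    unfolding a1[symmetric] a2[symmetric] \<delta>_def form_value_def disc_def
    by (simp add: power2_eq_square algebra_simps)
  then have det: "- 4 * a1 * a2 = of_int ?q * \<delta>\<^sup>2" unfolding cross by simp
  obtain A k where A: "a1 = of_int A / (of_int k)\<^sup>2" "A \<noteq> 0" "k \<noteq> 0" using rat_square_multiple[OF nz(1)] .
  \<comment> \<open>Chosen so that a2 = -q A (B/l)^2.\<close>
  obtain B l where Bl: "quotient_of (\<delta> * of_int k / (2 * of_int A)) = (B, l)"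
    by (cases "quotient_of (\<delta> * of_int k / (2 * of_int A))")
  have "\<delta> * of_int k / (2 * of_int A) \<noteq> 0" using stuw(1) A unfolding \<delta>_def by simp
  then have B: "\<delta> * of_int k / (2 * of_int A) = of_int B / of_int l" "B \<noteq> 0" "l \<noteq> 0"
    using quotient_of_div[OF Bl] quotient_of_denom_pos[OF Bl] by auto
  have "a2 = - (of_int ?q * \<delta>\<^sup>2) / (4 * a1)" using det nz by (simp add: field_simps)
  also have "\<dots> = - of_int ?q * of_int A * (\<delta> * of_int k / (2 * of_int A))\<^sup>2"
    unfolding A(1) using A(2,3) by (simp add: field_simps power2_eq_square)
  also have "\<dots> = of_int (- ?q * A * B\<^sup>2) / (of_int l)\<^sup>2" unfolding B(1) by (simp add: power_divide)
  finally have a2': "a2 = of_int (- ?q * A * B\<^sup>2) / (of_int l)\<^sup>2" .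
  have nA: "- ?q * A \<noteq> 0" "- ?q * A * B\<^sup>2 \<noteq> 0" "- A \<noteq> 0" using q A B by simp_all
  have "local_hilbert v a1 a2 = symbol v A (- ?q * A * B\<^sup>2)"
    unfolding A(1) a2' by (rule local_hilbert_symbol[OF v A(2) nA(2) A(3) B(3)])
  also have "\<dots> = symbol v A (?q * - A)" using symbol_square_right[OF v A(2) nA(1) B(2)] by simp
  also have "\<dots> = symbol v A ?q" using symbol_mult_right[OF v A(2) q nA(3)] symbol_neg_self[OF v A(2)] by simp
  also have "symbol v A ?q = symbol v ?n ?q"
  proof -
    have "(s, u) \<noteq> (0, 0)" using stuw(1) by auto
    then obtain z y where zy: "(z, y) \<noteq> (0, 0)" "of_int ?n * a1 = z\<^sup>2 - of_int ?q * y\<^sup>2"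
      using represented_norm[OF q] a1 by metis
    have "z\<^sup>2 = of_int (?n * A) * (1 / of_int k)\<^sup>2 + of_int ?q * y\<^sup>2"
      using zy(2) unfolding A(1) by (simp add: power_divide)
    then have "symbol v (?n * A) ?q = 1"
      using symbol_if_rational_soluble[OF v _ q, of "?n * A" "1 / of_int k" y z] n A zy(1) by simp
    then show ?thesis using symbol_mult_left[OF v q n A(2)] symbol_pm[OF v n q] symbol_pm[OF v A(2) q] by auto
  qed
  finally show ?thesis .
qed

lemma epsilon_invariant_eq:
  assumes q: "disc a b c \<noteq> 0" and v: "v \<in> places"
  shows "epsilon_invariant v a b c = symbol v (represented a b c) (disc a b c)"
  unfolding epsilon_invariant_def
proof (rule the_equality)
  let ?n = "represented a b c" and ?q = "disc a b c"
  have nz: "of_int ?n \<noteq> (0::rat)" "of_int (- ?n * ?q) \<noteq> (0::rat)" using q represented_nonzero[OF q] by simp_all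
  show "\<exists>a1 a2. a1 \<noteq> 0 \<and> a2 \<noteq> 0 \<and> diagonalizes a b c a1 a2 \<and> symbol v ?n ?q = local_hilbert v a1 a2"
    using nz diagonalizes_represented[OF q] local_hilbert_diagonalization[OF q v nz] by metis
qed (use local_hilbert_diagonalization[OF q v] in blast)

text \<open>The form represents \<open>d t\<^sup>2\<close> if and only if \<open>d n\<close> is a norm from \<open>\<rat>(\<surd>q)\<close>.\<close>

lemma represents_if_symbol:
  assumes q: "disc a b c \<noteq> 0" and d: "d \<noteq> 0"
    and sym: "\<And>v. v \<in> places \<Longrightarrow> symbol v (d * represented a b c) (disc a b c) = 1"
  obtains x y t where "(x, y) \<noteq> (0, 0)" "form_value (of_int a) (of_int b) (of_int c) x y = of_int d * t\<^sup>2"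
proof -
  let ?n = "represented a b c" and ?q = "disc a b c"
  have n: "?n \<noteq> 0" by (rule represented_nonzero[OF q])
  obtain x y z where xyz: "(x, y, z) \<noteq> (0, 0, 0)" "z\<^sup>2 = d * ?n * x\<^sup>2 + ?q * y\<^sup>2"
    using Hasse_Minkowski_ternary[of "d * ?n" ?q] d n q sym by auto
  obtain s t u w where stuw: "s * w - t * u \<noteq> (0::rat)"
    "\<And>x y. form_value (of_int a) (of_int b) (of_int c) (s * x + t * y) (u * x + w * y) = form_value (of_int ?n) 0 (of_int (- ?n * ?q)) x y"
    using diagonalizes_represented[OF q] unfolding diagonalizes_def by blast
  let ?x = "s * of_int z + t * of_int y" and ?y = "u * of_int z + w * of_int y"
  have "(?x, ?y) \<noteq> (0, 0)"
  proof
    assume "(?x, ?y) = (0, 0)"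
    \<comment> \<open>The inverse of the base change, multiplied by its determinant.\<close>
    then have "w * ?x - t * ?y = 0" "s * ?y - u * ?x = 0" by simp_all
    then have "(s * w - t * u) * of_int z = 0" "(s * w - t * u) * of_int y = 0" by (simp_all add: algebra_simps)
    then have "z = 0" "y = 0" using stuw(1) by simp_all
    then show False using xyz d n by auto
  qed
  moreover have "form_value (of_int a) (of_int b) (of_int c) ?x ?y = of_int d * (of_int (?n * x))\<^sup>2"
  proof -
    \<comment> \<open>As z^2 - q y^2 = d n x^2, multiplication by n completes the square on the
      right.\<close>
    have "?n * z\<^sup>2 - ?n * ?q * y\<^sup>2 = d * (?n * x)\<^sup>2" unfolding xyz(2) by (simp add: power2_eq_square algebra_simps)
    then have "(of_int (?n * z\<^sup>2 - ?n * ?q * y\<^sup>2) :: rat) = of_int (d * (?n * x)\<^sup>2)" by simp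
    then show ?thesis unfolding stuw(2) by (simp add: form_value_def)
  qed
  ultimately show ?thesis by (rule that)
qed

lemma symbol_if_represents:
  assumes q: "disc a b c \<noteq> 0" and d: "d \<noteq> 0" and v: "v \<in> places"
    and xy: "(x, y) \<noteq> (0, 0)" "form_value (of_int a) (of_int b) (of_int c) x y = of_int d * t\<^sup>2"
  shows "symbol v (d * represented a b c) (disc a b c) = 1"
proof -
  let ?n = "represented a b c" and ?q = "disc a b c"
  obtain z w where zw: "(z, w) \<noteq> (0, 0)" "of_int ?n * (of_int d * t\<^sup>2) = z\<^sup>2 - of_int ?q * w\<^sup>2"
    using represented_norm[OF q xy(1)] xy(2) by metis
  have "z\<^sup>2 = of_int (d * ?n) * t\<^sup>2 + of_int ?q * w\<^sup>2" using zw(2) by (simp add: mult_ac)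
  then show ?thesis using symbol_if_rational_soluble[OF v _ q, of "d * ?n" t w z] d represented_nonzero[OF q] zw(1) by auto
qed

section \<open>Units of the base ring and the criterion for points\<close>

lemma places_dividing_subset: "places_dividing m \<subseteq> places"
  by (auto simp: places_dividing_def places_def)

lemma finite_places_dividing: "m \<noteq> 0 \<Longrightarrow> finite (places_dividing m)"
proof -
  assume "m \<noteq> 0"
  then have "finite {k. k dvd m}" by (rule finite_divisors_int)
  then have "finite (int -` {k. k dvd m})" by (rule finite_vimageI) simp
  then have "finite (Prime_Place ` (int -` {k. k dvd m}))" by (rule finite_imageI)
  moreover have "places_dividing m \<subseteq> insert Real_Place (Prime_Place ` (int -` {k. k dvd m}))"
    by (auto simp: places_dividing_def)
  ultimately show ?thesis by (meson finite_insert finite_subset)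
qed

lemma supported_places_dividing: "supported (places_dividing m) d \<longleftrightarrow> d \<noteq> 0 \<and> (\<forall>p. prim p \<and> int p dvd d \<longrightarrow> int p dvd m)"
  by (auto simp: supported_def places_dividing_def)

lemma supported_dvd_power:
  assumes m: "m \<noteq> 0" and d: "supported (places_dividing m) d" shows "\<exists>k. d dvd m ^ k"
  using d
proof (induction rule: supported_induct)
  case minus_one
  then show ?case by (intro exI[of _ 0]) simp
next
  case (prime p)
  then show ?case by (intro exI[of _ 1]) (simp add: places_dividing_def)
next
  case (mult a b)
  then obtain k l where "a dvd m ^ k" "b dvd m ^ l" by blast
  then have "a * b dvd m ^ (k + l)" by (simp add: power_add mult_dvd_mono)
  then show ?case by blast
qed

lemma inverse_supported:
  assumes m: "m \<noteq> 0" and d: "supported (places_dividing m) d"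
  shows "1 / of_int d \<in> carrier (localized_integers m)"
proof -
  interpret localization m by unfold_locales (rule m)
  obtain k e where e: "m ^ k = d * e" using supported_dvd_power[OF m d] by (auto simp: dvd_def)
  have d0: "d \<noteq> 0" "e \<noteq> 0" using d e m by (auto simp: supported_def)
  have "(of_int m ^ k :: rat) = of_int d * of_int e" using arg_cong[OF e, of "of_int :: int \<Rightarrow> rat"] by simp
  then have "1 / of_int d = (of_int e / of_int m ^ k :: rat)" using d0 m by (simp add: field_simps)
  then show ?thesis unfolding mem_R by blast
qed

text \<open>A point gives an equation with a rational \<rho> in place of the unit; its squarefree
  class d is supported because the valuations of \<rho> at the primes of the base are even.
  Conversely, a supported d is a unit, and Hasse-Minkowski supplies the rational solution.\<close>

theorem point_iff_symbols:
  assumes q: "disc a b c \<noteq> 0"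
  defines "m \<equiv> 2 * disc a b c" and "n \<equiv> represented a b c"
  shows "root_stack_points (localized_integers m) a b c \<noteq> {} \<longleftrightarrow>
    (\<exists>d. supported (places_dividing m) d \<and> (\<forall>v\<in>places. symbol v (d * n) (disc a b c) = 1))"
proof
  have m: "m \<noteq> 0" using q by (simp add: m_def)
  interpret localization m by unfold_locales (rule m)
  {
    assume "root_stack_points (localized_integers m) a b c \<noteq> {}"
    then obtain P :: "(rat, rat list set) root_object" where P: "P \<in> root_objects (localized_integers m) a b c"
      by (auto simp: root_stack_points_empty_iff)
    obtain \<rho> x y t where \<rho>: "\<rho> \<noteq> 0" "(x, y) \<noteq> (0, 0)" "of_int a * x\<^sup>2 + of_int b * x * y + of_int c * y\<^sup>2 = \<rho> * t\<^sup>2"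
      "\<And>l. padic l \<Longrightarrow> \<not> int l dvd m \<Longrightarrow> \<exists>s. s \<noteq> 0 \<and> padic_abs l \<rho> = (padic_abs l s)\<^sup>2"
      using rational_solution_if_point[OF P] by metis
    obtain A k where A: "\<rho> = of_int A / (of_int k)\<^sup>2" "A \<noteq> 0" "k \<noteq> 0" using rat_square_multiple[OF \<rho>(1)] .
    define d r where "d = squarefree_part A" and "r = square_part A"
    have Ad: "A = d * r\<^sup>2" unfolding d_def r_def by (rule squarefree_decompose)
    have "supported (places_dividing m) d"
      unfolding supported_places_dividing
    proof (intro conjI allI impI)
      show "d \<noteq> 0" using A Ad by auto
      fix p assume p: "prim p \<and> int p dvd d"
      show "int p dvd m"
      proof (rule ccontr)
        assume pm: "\<not> int p dvd m"
        interpret padic p using p by unfold_locales auto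
        obtain s where s: "s \<noteq> 0" "absp \<rho> = (absp s)\<^sup>2" using \<rho>(4)[OF padic_axioms pm] by blast
        \<comment> \<open>This makes A j^2 and B^2 have the same valuation, so that of A is even and
          p drops out of the squarefree part.\<close>
        obtain B j where B: "s * of_int k = of_int B / of_int j" "j \<noteq> 0" using rat_frac .
        have B0: "B \<noteq> 0" using B s A by auto
        have "absp (of_int A) = absp (\<rho> * (of_int k)\<^sup>2)" using A by simp
        also have "\<dots> = (absp (s * of_int k))\<^sup>2" using s by (simp add: absp_mult absp_power power_mult_distrib)
        finally have "absp (of_int A) = (absp (of_int B / of_int j))\<^sup>2" unfolding B(1) .
        then have "absp (of_int A) * (absp (of_int j))\<^sup>2 = (absp (of_int B))\<^sup>2"
          using B(2) by (simp add: absp_divide power_divide)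
        then have "absp (of_int (A * j\<^sup>2)) = absp (of_int (B\<^sup>2))" by (simp add: absp_mult absp_power)
        then have "(1 / real p) ^ multiplicity (int p) (A * j\<^sup>2) = (1 / real p) ^ multiplicity (int p) (B\<^sup>2)"
          using A B B0 by (simp only: absp_int mult_eq_0_iff power_eq_0_iff simp_thms)
        then have "multiplicity (int p) (A * j\<^sup>2) = multiplicity (int p) (B\<^sup>2)"
          using p_gt_1 by (simp add: power_one_over power_inject_exp)
        then have "even (multiplicity (int p) A)"
          using A(2) B(2) B0 prime by (simp add: prime_elem_multiplicity_mult_distrib prime_elem_multiplicity_power_distrib) presburger
        then have "multiplicity (int p) d = 0"
          using prime_multiplicity_squarefree_part[of "int p" A] A(2) prime by (simp add: d_def)
        then show False using not_dvd_if_multiplicity_0[OF prime \<open>d \<noteq> 0\<close>] p by blast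
      qed
    qed
    moreover have "symbol v (d * n) (disc a b c) = 1" if v: "v \<in> places" for v
    proof -
      have "form_value (of_int a) (of_int b) (of_int c) x y = of_int d * (of_int r * t / of_int k)\<^sup>2"
        unfolding form_value_def \<rho>(3) A(1) Ad by (simp add: power_divide power_mult_distrib)
      then show ?thesis unfolding n_def using A Ad by (intro symbol_if_represents[OF q _ v \<rho>(2)]) auto
    qed
    ultimately show "\<exists>d. supported (places_dividing m) d \<and> (\<forall>v\<in>places. symbol v (d * n) (disc a b c) = 1)" by blast
  }
  assume "\<exists>d. supported (places_dividing m) d \<and> (\<forall>v\<in>places. symbol v (d * n) (disc a b c) = 1)"
  then obtain d where d: "supported (places_dividing m) d" "\<And>v. v \<in> places \<Longrightarrow> symbol v (d * n) (disc a b c) = 1" by blast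
  have d0: "d \<noteq> 0" using d(1) by (simp add: supported_def)
  obtain x y t where xy: "(x, y) \<noteq> (0, 0)" "form_value (of_int a) (of_int b) (of_int c) x y = of_int d * t\<^sup>2"
    using represents_if_symbol[OF q d0 d(2)[unfolded n_def]] .
  show "root_stack_points (localized_integers m) a b c \<noteq> {}"
    by (rule point_if_rational_solution[OF m_def[THEN meta_eq_to_obj_eq] of_int_R inverse_supported[OF m d(1)] _ xy(1)])
      (use d0 xy(2) in \<open>simp_all add: form_value_def\<close>)
qed

section \<open>Families of local classes orthogonal to the units\<close>

lemma symbol_one: assumes "v \<in> places" "a \<noteq> 0" shows "symbol v a 1 = 1"
  using symbol_mult_right[OF assms, of 1 1] symbol_pm[OF assms, of 1] by auto

lemma symbol_even_unit:
  assumes p: "prim p" "p \<noteq> 2" and d: "\<not> int p dvd d" and w: "w \<noteq> 0" "even (multiplicity (int p) w)"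
  shows "symbol (Prime_Place p) d w = 1"
proof -
  have "Legendre d p = 1 \<or> Legendre d p = - 1" using Legendre_pm[OF d] .
  then show ?thesis using unit_part_not_dvd[OF p(1) d] p(2) w(2)
    by (auto simp: symbol_def prime_symbol_def)
qed

lemma symbol_local_square:
  assumes v: "v \<in> places" and d: "d \<noteq> 0" and w: "local_square v w" shows "symbol v d w = 1"
proof -
  have w0: "w \<noteq> 0" using w by (simp add: local_square_def)
  have "w \<in> local_square_class v 1" using local_square_class_if_local_square[OF v, of w 1] w by simp
  then show ?thesis using symbol_local_square_class[OF v _ d w0] symbol_one[OF v d] by simp
qed

text \<open>Integers supported on \<open>S\<close> embed in the product of the local square class groups as their own orthogonal
  complement. A family orthogonal to them, once its valuations and signs are trivial, is shown to
  consist of squares by pairing it with \<open>-1\<close>, 2 and the odd primes of \<open>S\<close> in turn.\<close>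

lemma local_squares_if_orthogonal:
  assumes S: "finite S" "Real_Place \<in> S" "Prime_Place 2 \<in> S" "S \<subseteq> places"
    and w: "\<And>v. v \<in> S \<Longrightarrow> w v \<noteq> 0" "w Real_Place > 0"
      "\<And>p. Prime_Place p \<in> S \<Longrightarrow> even (multiplicity (int p) (w (Prime_Place p)))"
    and orth: "\<And>d. supported S d \<Longrightarrow> (\<Prod>v\<in>S. symbol v d (w v)) = 1"
    and v: "v \<in> S"
  shows "local_square v (w v)"
proof -
  let ?w2 = "w (Prime_Place 2)"
  have real: "symbol Real_Place d (w Real_Place) = 1" for d using w(2) by (simp add: symbol_Real)
  have one: "symbol u d (w u) = 1" if "u \<in> S" "u \<noteq> Prime_Place 2" "\<And>p. u = Prime_Place p \<Longrightarrow> \<not> int p dvd d" for u d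
  proof (cases u)
    case Real_Place then show ?thesis using real by simp
  next
    case (Prime_Place p)
    then have "prim p" using that(1) S(4) by (auto simp: places_def)
    then show ?thesis using symbol_even_unit[of p d "w u"] that w(1,3) Prime_Place by auto
  qed
  \<comment> \<open>If every other factor of an orthogonality relation is 1, the remaining factor is
    1.\<close>
  have single: "symbol u d (w u) = 1"
    if "supported S d" "u \<in> S" "\<And>u'. u' \<in> S \<Longrightarrow> u' \<noteq> u \<Longrightarrow> symbol u' d (w u') = 1" for u d
    using orth[OF that(1)] prod_eq_subset[OF S(1), of "{u}" "\<lambda>v. symbol v d (w v)"] that(2,3) by auto
  \<comment> \<open>Pairing with -1 shows that the unit part is 1 modulo 4, and pairing with 2 that
    it is 1 or 7 modulo 8; together it is 1 modulo 8.\<close>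
  have w2: "local_square (Prime_Place 2) ?w2"
  proof -
    let ?u = "unit_part 2 ?w2"
    have nz: "?w2 \<noteq> 0" "even (multiplicity 2 ?w2)" using w(1)[OF S(3)] w(3)[OF S(3)] by simp_all
    have odd: "odd ?u" using not_dvd_unit_part[of 2 ?w2] nz(1) by simp
    have "symbol (Prime_Place 2) (- 1) ?w2 = 1"
    proof (rule single[OF _ S(3)])
      show "supported S (- 1)" by (auto simp: supported_def)
      fix u assume "u \<in> S" "u \<noteq> Prime_Place 2"
      then show "symbol u (- 1) (w u) = 1" using S(4) by (intro one) (auto simp: places_def)
    qed
    then have "chi4 (- 1) ?u = 1"
      using unit_part_not_dvd[of 2 "-1"] nz(2) by (simp add: symbol_def prime_symbol_def chi8_def)
    moreover have "symbol (Prime_Place 2) 2 ?w2 = 1"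
    proof (rule single[OF _ S(3)])
      have "p = 2" if "prim p" "int p dvd 2" for p
      proof -
        have "p dvd 2" using that(2) int_dvd_int_iff[of p 2] by simp
        then show ?thesis using primes_dvd_imp_eq[OF that(1) two_is_prime_nat] by simp
      qed
      then show "supported S 2" using S(3) by (auto simp: supported_def)
      fix u assume u: "u \<in> S" "u \<noteq> Prime_Place 2"
      show "symbol u 2 (w u) = 1"
      proof (rule one[OF u])
        fix p assume p: "u = Prime_Place p"
        then have "prim p" "p \<noteq> 2" using u S(4) by (auto simp: places_def)
        then show "\<not> int p dvd 2" using odd_prime_ge_3[of p] zdvd_imp_le[of "int p" 2] by auto
      qed
    qed
    then have "chi8 ?u = 1"
      using unit_part_eqI[of 2 2 1 1] nz(2)
      by (simp add: symbol_def prime_symbol_def chi4_def chi8_def Let_def split: if_splits)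
    ultimately have "?u mod 8 = 1" using odd unfolding chi4_def chi8_def by (simp split: if_splits) presburger+
    then show ?thesis using nz by (simp add: local_square_def)
  qed
  show ?thesis
  proof (cases v)
    case Real_Place then show ?thesis using w(2) by (simp add: local_square_def)
  next
    case (Prime_Place p)
    then have p: "prim p" using v S(4) by (auto simp: places_def)
    show ?thesis
    proof (cases "p = 2")
      case True then show ?thesis using w2 Prime_Place by simp
    next
      case False
      let ?wp = "w (Prime_Place p)"
      have nz: "?wp \<noteq> 0" "even (multiplicity (int p) ?wp)" using w(1)[OF v] w(3) v Prime_Place by auto
      have "symbol v (int p) (w v) = 1"
      proof (rule single[OF _ v])
        show "supported S (int p)"
          using p v Prime_Place by (auto simp: supported_def dest: primes_dvd_imp_eq)
        fix u assume u: "u \<in> S" "u \<noteq> v"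
        \<comment> \<open>At 2 the entry is already known to be a square. At the other finite places
          p is a unit and the entry has even valuation.\<close>
        show "symbol u (int p) (w u) = 1"
        proof (cases "u = Prime_Place 2")
          case True
          then show ?thesis using symbol_local_square[OF _ _ w2, of "int p"] S(3,4) p by auto
        next
          case False
          show ?thesis
          proof (rule one[OF u(1) False])
            fix r assume r: "u = Prime_Place r"
            then have "prim r" "r \<noteq> p" using u S(4) Prime_Place by (auto simp: places_def)
            then show "\<not> int r dvd int p" using p primes_dvd_imp_eq[of r p] by auto
          qed
        qed
      qed
      then have "Legendre (unit_part p ?wp) p = 1"
        using unit_part_eqI[of p "int p" 1 1] p prime_gt_1_nat[OF p] False nz(2) Legendre_1[OF p] Prime_Place
          Legendre_pm[of p "-1"]
        by (auto simp: symbol_def prime_symbol_def)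
      then show ?thesis using nz False by (auto simp: Prime_Place local_square_def Legendre_def split: if_splits)
    qed
  qed
qed

text \<open>Up to squares e must have the valuations of q at the primes of \<open>T\<close> and
  trivial ones elsewhere; taking the full power of a prime or none keeps it a divisor of q. The sign
  does the same at the real place.\<close>

definition signed_part :: "place set \<Rightarrow> int \<Rightarrow> int"
  where "signed_part T q = (if Real_Place \<in> T then sgn q else 1) *
    (\<Prod>p\<in>{p. prim p \<and> p dvd q \<and> Prime_Place (nat p) \<in> T}. p ^ multiplicity p q)"

lemma
  assumes q: "q \<noteq> 0"
  shows signed_part_nonzero: "signed_part T q \<noteq> 0"
    and signed_part_dvd: "signed_part T q dvd q"
    and multiplicity_signed_part: "prim p \<Longrightarrow>
      multiplicity (int p) (signed_part T q) = (if Prime_Place p \<in> T then multiplicity (int p) q else 0)"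
    and signed_part_sgn: "sgn (signed_part T q) = (if Real_Place \<in> T then sgn q else 1)"
proof -
  let ?A = "{p. prim p \<and> p dvd q \<and> Prime_Place (nat p) \<in> T}"
  let ?P = "\<Prod>p\<in>?A. p ^ multiplicity p q"
  let ?s = "if Real_Place \<in> T then sgn q else 1"
  have fin: "finite ?A" using finite_subset[OF _ finite_divisors_int[OF q]] by auto
  have P: "?P > 0" by (intro prod_pos) (auto dest: prime_gt_0_int)
  have s: "?s = 1 \<or> ?s = - 1" using q by (auto simp: sgn_if)
  show nz: "signed_part T q \<noteq> 0" using P s unfolding signed_part_def by auto
  show "sgn (signed_part T q) = (if Real_Place \<in> T then sgn q else 1)"
    using P unfolding signed_part_def sgn_mult by simp
  have mP: "multiplicity p ?P = (if p \<in> ?A then multiplicity p q else 0)" if "prim p" for p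
    by (rule multiplicity_prod_prime_powers[OF fin _ that]) auto
  have m: "multiplicity p (signed_part T q) = (if p \<in> ?A then multiplicity p q else 0)" if "prim p" for p
    using mP[OF that] s unfolding signed_part_def by (auto split: if_splits)
  show "multiplicity (int p) (signed_part T q) = (if Prime_Place p \<in> T then multiplicity (int p) q else 0)" if "prim p"
    using m[of "int p"] that q by (auto simp: not_dvd_imp_multiplicity_0)
  show "signed_part T q dvd q"
    by (rule multiplicity_le_imp_dvd[OF nz]) (simp add: m)
qed

theorem theorem7p3:
  fixes a b c q :: int
  assumes q_def: "q = disc a b c"
    and q_nonzero: "q \<noteq> 0"
  shows "(\<forall>p::nat. Factorial_Ring.prime p \<and> \<not> int p dvd 2 * q \<longrightarrow>
            root_stack_points (padic_integers p) a b c \<noteq> {}) \<and>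
         (\<forall>v\<in>places_dividing (2 * q). has_local_point v a b c) \<and>
         (root_stack_points (localized_integers (2 * q)) a b c \<noteq> {} \<longleftrightarrow>
           \<not> (\<exists>d::int. d dvd 2 * q \<and>
              (\<forall>v\<in>places_dividing (2 * q).
                 d \<in> local_square_class v 1 \<or> d \<in> local_square_class v q) \<and>
              (\<Prod>v\<in>{v\<in>places_dividing (2 * q). d \<notin> local_square_class v 1}.
                 epsilon_invariant v a b c) = - 1 \<and>
              (\<Prod>v\<in>{v\<in>places_dividing (2 * q). d \<in> local_square_class v 1}.
                 epsilon_invariant v a b c) = - 1))"
proof (intro conjI allI impI ballI)
  fix p :: nat assume "prim p \<and> \<not> int p dvd 2 * q"
  then show "root_stack_points (padic_integers p) a b c \<noteq> {}"
    using padic.points_padic_integers[OF padic.intro] q_def by blast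
next
  fix v assume "v \<in> places_dividing (2 * q)"
  then show "has_local_point v a b c" using points_local places_dividing_subset q_def q_nonzero by blast
next
  define S where "S = places_dividing (2 * q)"
  define n where "n = represented a b c"
  define \<epsilon> where "\<epsilon> v = epsilon_invariant v a b c" for v
  have dq: "disc a b c \<noteq> 0" using q_def q_nonzero by simp
  have n: "n \<noteq> 0" unfolding n_def by (rule represented_nonzero[OF dq])
  have S: "finite S" "Real_Place \<in> S" "Prime_Place 2 \<in> S" "S \<subseteq> places"
    unfolding S_def using finite_places_dividing places_dividing_subset q_nonzero by (auto simp: places_dividing_def)
  have memS: "Prime_Place p \<in> S \<longleftrightarrow> prim p \<and> int p dvd 2 * q" for p by (auto simp: S_def places_dividing_def)
  have supp_dvd: "supported S d" if "d dvd 2 * q" for d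
    using that q_nonzero unfolding S_def supported_places_dividing by (auto intro: dvd_trans)
  have supp_q: "supported S q" by (rule supp_dvd) simp
  have \<epsilon>: "\<epsilon> v = symbol v n q" if "v \<in> S" for v
    using epsilon_invariant_eq[OF dq, of v] that S(4) unfolding \<epsilon>_def n_def q_def by blast
  have \<epsilon>_pm: "\<epsilon> v = 1 \<or> \<epsilon> v = - 1" if "v \<in> S" for v
    using \<epsilon>[OF that] symbol_pm n q_nonzero S(4) that by auto
  \<comment> \<open>Either n is a unit at p, or p divides n and then b^2 - q, so q is a nonzero
    square modulo p and hence a local square.\<close>
  have outside: "symbol v n q = 1" if v: "v \<in> places" "v \<notin> S" for v
  proof -
    obtain p where p: "v = Prime_Place p" "prim p" using v S(2) by (auto simp: places_def)
    then have pq: "\<not> int p dvd 2 * q" using v memS by simp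
    then have p2: "p \<noteq> 2" "\<not> int p dvd q" by auto
    show ?thesis
    proof (cases "int p dvd n")
      case False
      then show ?thesis using symbol_unramified[OF p(2) p2(1)] p2(2) p(1) by simp
    next
      case True
      then have "int p dvd b\<^sup>2 - q" using disc_square_mod_represented[of a b c] unfolding n_def q_def by (rule dvd_trans)
      then have "QuadRes p q" unfolding QuadRes_def by (auto simp: cong_iff_dvd_diff)
      then have "local_square v q" using local_square_unit[OF p(2) p2(2)] p(1) p2(1) by simp
      then show ?thesis by (rule symbol_local_square[OF v(1) n])
    qed
  qed
  have \<epsilon>_prod: "(\<Prod>v\<in>S. \<epsilon> v) = 1"
  proof -
    \<comment> \<open>n may have primes outside \<open>S\<close>, so the product formula is applied
      on a larger set, whose additional factors are 1.\<close>
    let ?S' = "S \<union> places_dividing n"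
    have S': "finite ?S'" "?S' \<subseteq> places" using S finite_places_dividing[OF n] places_dividing_subset by auto
    have "supported ?S' n" "supported ?S' q" using n supp_q by (auto simp: supported_def places_dividing_def)
    then have "(\<Prod>v\<in>?S'. symbol v n q) = 1" using symbol_product_formula[of ?S'] S' S(2,3) by simp
    moreover have "(\<Prod>v\<in>?S'. symbol v n q) = (\<Prod>v\<in>S. symbol v n q)"
      by (rule prod_eq_subset[OF S'(1)]) (use outside S'(2) in auto)
    ultimately show ?thesis using \<epsilon> by simp
  qed
  have point: "root_stack_points (localized_integers (2 * q)) a b c \<noteq> {} \<longleftrightarrow>
    (\<exists>d. supported S d \<and> (\<forall>v\<in>S. symbol v d q = \<epsilon> v))"
  proof -
    have "symbol v (d * n) q = 1 \<longleftrightarrow> (v \<in> S \<longrightarrow> symbol v d q = \<epsilon> v)" if d: "supported S d" and v: "v \<in> places" for d v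
    proof -
      have d0: "d \<noteq> 0" using d by (simp add: supported_def)
      have "symbol v (d * n) q = symbol v d q * symbol v n q" by (rule symbol_mult_left[OF v q_nonzero d0 n])
      moreover have "symbol v d q = 1" if vS: "v \<notin> S"
      proof -
        obtain p where p: "v = Prime_Place p" "prim p" using v vS S(2) by (auto simp: places_def)
        then have "\<not> int p dvd 2 * q" "\<not> int p dvd d" using vS memS d by (auto simp: supported_def)
        moreover from this have "p \<noteq> 2" "\<not> int p dvd q" by auto
        ultimately show ?thesis using symbol_unramified[OF p(2)] p(1) by simp
      qed
      ultimately show ?thesis
        using \<epsilon>[of v] outside[OF v] symbol_pm[OF v d0 q_nonzero] symbol_pm[OF v n q_nonzero] by auto
    qed
    then show ?thesis
      using point_iff_symbols[OF dq, folded q_def, folded n_def, folded S_def] S(4) by blast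
  qed
  show "root_stack_points (localized_integers (2 * q)) a b c \<noteq> {} \<longleftrightarrow>
           \<not> (\<exists>d::int. d dvd 2 * q \<and>
              (\<forall>v\<in>places_dividing (2 * q).
                 d \<in> local_square_class v 1 \<or> d \<in> local_square_class v q) \<and>
              (\<Prod>v\<in>{v\<in>places_dividing (2 * q). d \<notin> local_square_class v 1}.
                 epsilon_invariant v a b c) = - 1 \<and>
              (\<Prod>v\<in>{v\<in>places_dividing (2 * q). d \<in> local_square_class v 1}.
                 epsilon_invariant v a b c) = - 1)"
    unfolding S_def[symmetric] \<epsilon>_def[symmetric] point
  proof (rule iffI; rule ccontr)
    assume "\<exists>d. supported S d \<and> (\<forall>v\<in>S. symbol v d q = \<epsilon> v)"
      and "\<not> \<not> (\<exists>d. d dvd 2 * q \<and> (\<forall>v\<in>S. d \<in> local_square_class v 1 \<or> d \<in> local_square_class v q) \<and>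
        (\<Prod>v\<in>{v\<in>S. d \<notin> local_square_class v 1}. \<epsilon> v) = - 1 \<and> (\<Prod>v\<in>{v\<in>S. d \<in> local_square_class v 1}. \<epsilon> v) = - 1)"
    then obtain d e where d: "supported S d" "\<And>v. v \<in> S \<Longrightarrow> symbol v d q = \<epsilon> v"
      and e: "e dvd 2 * q" "\<And>v. v \<in> S \<Longrightarrow> e \<in> local_square_class v 1 \<or> e \<in> local_square_class v q"
        "(\<Prod>v\<in>{v\<in>S. e \<notin> local_square_class v 1}. \<epsilon> v) = - 1" by blast
    have supp: "supported S e" by (rule supp_dvd[OF e(1)])
    have nz: "d \<noteq> 0" "e \<noteq> 0" using d(1) supp by (auto simp: supported_def)
    \<comment> \<open>Where e is a square the symbol is 1; elsewhere e lies in the class of q, and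
      (d, q) = \<epsilon>_v. The product formula for (d, e) then contradicts the product -1.\<close>
    have "symbol v d e = (if e \<in> local_square_class v 1 then 1 else \<epsilon> v)" if v: "v \<in> S" for v
    proof -
      have vp: "v \<in> places" using v S(4) by blast
      show ?thesis
        using e(2)[OF v] d(2)[OF v] symbol_local_square_class[OF vp _ nz, of 1] symbol_local_square_class[OF vp _ nz q_nonzero]
          symbol_one[OF vp nz(1)] by auto
    qed
    then have "(\<Prod>v\<in>S. symbol v d e) = (\<Prod>v\<in>S. if e \<in> local_square_class v 1 then 1 else \<epsilon> v)" by simp
    also have "\<dots> = (\<Prod>v\<in>{v\<in>S. e \<notin> local_square_class v 1}. \<epsilon> v)"
      using S(1) by (intro prod.mono_neutral_cong_right) auto
    finally show False using symbol_product_formula[OF S d(1) supp] e(3) by simp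
  next
    assume no: "\<not> (\<exists>d. supported S d \<and> (\<forall>v\<in>S. symbol v d q = \<epsilon> v))"
      and no_obstruction: "\<not> (\<exists>d. d dvd 2 * q \<and> (\<forall>v\<in>S. d \<in> local_square_class v 1 \<or> d \<in> local_square_class v q) \<and>
        (\<Prod>v\<in>{v\<in>S. d \<notin> local_square_class v 1}. \<epsilon> v) = - 1 \<and> (\<Prod>v\<in>{v\<in>S. d \<in> local_square_class v 1}. \<epsilon> v) = - 1)"
    \<comment> \<open>Off \<open>S\<close> the functions are set to 1, so that the constant function
      1 and all products belong to \<open>W\<close> as functions on the whole type
      \<open>place\<close>.\<close>
    define W where "W = {\<lambda>v. if v \<in> S then symbol v d q else 1 | d. supported S d}"
    have "\<exists>T\<subseteq>S. (\<forall>f\<in>W. (\<Prod>v\<in>T. f v) = 1) \<and> (\<Prod>v\<in>T. \<epsilon> v) = - 1"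
    proof (rule separating_subset[OF S(1)])
      show "f v = 1 \<or> f v = - 1" if f: "f \<in> W" and v: "v \<in> S" for f v
      proof -
        obtain d where "supported S d" "f = (\<lambda>v. if v \<in> S then symbol v d q else 1)"
          using f unfolding W_def by blast
        then show ?thesis using symbol_pm[of v d q] q_nonzero S(4) v by (auto simp: supported_def)
      qed
      have "supported S 1" by (auto simp: supported_def)
      moreover have "(\<lambda>v. if v \<in> S then symbol v 1 q else 1) = (\<lambda>_. 1)"
      proof (rule ext)
        fix v
        show "(if v \<in> S then symbol v 1 q else 1) = 1"
          using subsetD[OF S(4), of v] symbol_one[OF _ q_nonzero, of v] symbol_commute[of v 1 q] by simp
      qed
      ultimately show "(\<lambda>_. 1) \<in> W" unfolding W_def by (auto intro!: exI[of _ 1])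
      show "(\<lambda>v. f v * g v) \<in> W" if fg: "f \<in> W" "g \<in> W" for f g
      proof -
        obtain d d' where d: "supported S d" "supported S d'" "f = (\<lambda>v. if v \<in> S then symbol v d q else 1)"
          "g = (\<lambda>v. if v \<in> S then symbol v d' q else 1)" using fg unfolding W_def by blast
        have "(\<lambda>v. f v * g v) = (\<lambda>v. if v \<in> S then symbol v (d * d') q else 1)"
          unfolding d(3,4) using symbol_mult_left[OF _ q_nonzero, of _ d d'] S(4) d(1,2)
          by (auto simp: fun_eq_iff supported_def)
        then show ?thesis using supported_mult[OF d(1,2)] unfolding W_def by blast
      qed
      show "\<not> (\<exists>f\<in>W. \<forall>v\<in>S. f v = \<epsilon> v)" using no unfolding W_def by auto
    qed (rule \<epsilon>_pm)
    then obtain T where T: "T \<subseteq> S" "\<And>f. f \<in> W \<Longrightarrow> (\<Prod>v\<in>T. f v) = 1" "(\<Prod>v\<in>T. \<epsilon> v) = - 1" by blast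
    define e where "e = signed_part T q"
    note e = signed_part_nonzero[OF q_nonzero, of T, folded e_def] signed_part_dvd[OF q_nonzero, of T, folded e_def]
      multiplicity_signed_part[OF q_nonzero, of _ T, folded e_def] signed_part_sgn[OF q_nonzero, of T, folded e_def]
    have e2: "e dvd 2 * q" using e(2) by simp
    have supp: "supported S e" by (rule supp_dvd[OF e2])
    \<comment> \<open>That e lies in the class of q on \<open>T\<close> and is a square off
      \<open>T\<close> means that w is a local square throughout \<open>S\<close>. Its valuations
      are twice those of q on \<open>T\<close> and 0 off \<open>T\<close>.\<close>
    define w where "w v = (if v \<in> T then e * q else e)" for v
    have sq: "local_square v (w v)" if v: "v \<in> S" for v
    proof (rule local_squares_if_orthogonal[OF S _ _ _ _ v])
      show "w v \<noteq> 0" for v using e(1) q_nonzero by (simp add: w_def)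
      have "sgn (w Real_Place) = (if Real_Place \<in> T then sgn q * sgn q else 1)"
        using e(4) by (simp add: w_def sgn_mult)
      also have "\<dots> = 1" using q_nonzero by (simp add: sgn_if)
      finally have "sgn (w Real_Place) = 1" .
      then show "w Real_Place > 0" by (simp add: sgn_1_pos)
      show "even (multiplicity (int p) (w (Prime_Place p)))" if "Prime_Place p \<in> S" for p
      proof -
        have p: "prim p" using that memS by simp
        show ?thesis using e(3)[OF p] unit_part_mult(1)[OF p e(1) q_nonzero] by (simp add: w_def)
      qed
      show "(\<Prod>v\<in>S. symbol v d (w v)) = 1" if d: "supported S d" for d
      proof -
        have d0: "d \<noteq> 0" using d by (simp add: supported_def)
        \<comment> \<open>The symbols with e cancel by the product formula. What is left is the
          product of (d, q) over \<open>T\<close>, which is 1 by the choice of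
          \<open>T\<close>.\<close>
        have "(\<Prod>v\<in>S. symbol v d (w v)) = (\<Prod>v\<in>S. symbol v d e * (if v \<in> T then symbol v d q else 1))"
          using symbol_mult_right[OF _ d0 e(1) q_nonzero] S(4) by (intro prod.cong) (auto simp: w_def)
        also have "\<dots> = (\<Prod>v\<in>S. if v \<in> T then symbol v d q else 1)"
          using symbol_product_formula[OF S d supp] by (simp add: prod.distrib)
        also have "\<dots> = (\<Prod>v\<in>T. if v \<in> S then symbol v d q else 1)"
          using S(1) T(1) by (intro prod.mono_neutral_cong_right) auto
        also have "\<dots> = 1" by (rule T(2)) (use d in \<open>auto simp: W_def\<close>)
        finally show ?thesis .
      qed
    qed
    have class_q: "e \<in> local_square_class v q" if "v \<in> T" for v
      using local_square_class_if_local_square[of v e q] sq[of v] that T(1) S(4) by (auto simp: w_def)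
    have class_1: "e \<in> local_square_class v 1" if "v \<in> S" "v \<notin> T" for v
      using local_square_class_if_local_square[of v e 1] sq[of v] that S(4) by (auto simp: w_def)
    let ?U = "{v\<in>S. e \<notin> local_square_class v 1}"
    \<comment> \<open>A place of \<open>T\<close> where e is also a square is one where q is a
      square, so it does not affect the product.\<close>
    have "\<epsilon> v = 1" if "v \<in> T - ?U" for v
    proof -
      have v: "v \<in> S" "v \<in> places" "e \<in> local_square_class v 1" "e \<in> local_square_class v q"
        using that T(1) S(4) class_q by auto
      have "symbol v n q = symbol v n 1"
        using symbol_local_square_class[OF v(2,4) n e(1) q_nonzero] symbol_local_square_class[OF v(2,3) n e(1)] by simp
      then show ?thesis using \<epsilon>[OF v(1)] symbol_one[OF v(2) n] by simp
    qed
    moreover have "?U \<subseteq> T" using class_1 by blast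
    ultimately have U: "(\<Prod>v\<in>?U. \<epsilon> v) = - 1"
      using prod_eq_subset[OF finite_subset[OF T(1) S(1)], of ?U \<epsilon>] T(3) by simp
    \<comment> \<open>All \<epsilon>_v multiply to 1, so the product over the complementary places
      is -1 as well.\<close>
    have "(\<Prod>v\<in>S. \<epsilon> v) = (\<Prod>v\<in>?U. \<epsilon> v) * (\<Prod>v\<in>{v\<in>S. e \<in> local_square_class v 1}. \<epsilon> v)"
      using S(1) by (subst prod.union_disjoint[symmetric]) (auto intro!: prod.cong)
    then have "(\<Prod>v\<in>{v\<in>S. e \<in> local_square_class v 1}. \<epsilon> v) = - 1" using U \<epsilon>_prod by simp
    then show False using no_obstruction e2 class_q class_1 U by blast
  qed
qed

end
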